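(* Let $F$ be the distribution function of the limiting QuickSort distribution, let $\underline{F}(x):=F(-x)$ and $\overline{F}(x):=1-F(x)$ for $x \in \mathbb{R}$, and let $\gamma:=\left(2-\frac{1}{\ln 2}\right)^{-1}$. For a function $h:\mathbb{R}\to\mathbb{R}$ write $\|h\|_x:=\sup_{t\ge x}|h(t)|$. Then for every fixed integer $k\ge 0$, as $x\to\infty$, the $k$th derivatives satisfy $$\exp\left[-e^{\gamma x+\ln\ln x+O(1)}\right]\le \|\underline{F}^{(k)}\|_x\le \exp\left[-e^{\gamma x+O(1)}\right],$$ $$\exp\left[-x\ln x-(k\vee 1)\,x\ln\ln x+O(x)\right]\le \|\overline{F}^{(k)}\|_x\le \exp\left[-x\ln x+O(x)\right].$$
   Context: The limiting QuickSort distribution is the unique probability law $\mathcal{L}(Z)$ on $\mathbb{R}$ such that $\mathbb{E}Z$ exists and equals $0$ and $$Z \overset{\mathcal{L}}{=} UZ+(1-U)Z^*+g(U),$$ where $U$ is uniform on $(0,1)$, $Z^*$ has the same law as $Z$, the variables $U,Z,Z^*$ are independent, and $g(u):=2u\ln u+2(1-u)\ln(1-u)+1$ for $u\in(0,1)$. It is known that this law has a unique continuous density $f=F'$, which is everywhere positive and infinitely differentiable on $\mathbb{R}$. Here $k\vee 1=\max(k,1)$, and $h^{(0)}=h$. Each occurrence of $O(1)$ or $O(x)$ in an inequality stands for some function of $x$ (possibly different in each occurrence and depending on $k$) whose absolute value is at most a constant, respectively a constant times $x$, for all sufficiently large $x$. *)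

theory Defs
  imports "HOL-Probability.Probability" "HOL-Library.Landau_Symbols"
begin

definition quicksort_toll :: "real \<Rightarrow> real" where
  "quicksort_toll u = 2 * u * ln u + 2 * (1 - u) * ln (1 - u) + 1"

text \<open>The law of \<open>U Z + (1 - U) Z\<^sup>* + g(U)\<close> for independent \<open>U\<close>, \<open>Z\<close>, \<open>Z\<^sup>*\<close>,
  with \<open>U\<close> uniform on \<open>(0,1)\<close> and \<open>Z\<close>, \<open>Z\<^sup>*\<close> both of law \<open>M\<close>; independence is expressed
  by taking the product of the three laws.\<close>

definition quicksort_map :: "real measure \<Rightarrow> real measure" where
  "quicksort_map M =
     distr (uniform_measure lborel {0<..<1} \<Otimes>\<^sub>M (M \<Otimes>\<^sub>M M)) borel
       (\<lambda>(u, z, z'). u * z + (1 - u) * z' + quicksort_toll u)"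

text \<open>The limiting QuickSort distribution is the unique law with this property.\<close>

definition quicksort_law :: "real measure \<Rightarrow> bool" where
  "quicksort_law M \<longleftrightarrow>
     real_distribution M \<and>
     integrable M (\<lambda>z. z) \<and> (\<integral>z. z \<partial>M) = 0 \<and>
     M = quicksort_map M"

definition lower_tail :: "real measure \<Rightarrow> real \<Rightarrow> real" where
  "lower_tail M x = cdf M (- x)"

definition upper_tail :: "real measure \<Rightarrow> real \<Rightarrow> real" where
  "upper_tail M x = 1 - cdf M x"

definition quicksort_gamma :: real where
  "quicksort_gamma = inverse (2 - 1 / ln 2)"

text \<open>The supremum is taken in the extended reals, so that it is \<open>\<infinity>\<close> (and not an
  unspecified real) when \<open>h\<close> is unbounded on \<open>[x, \<infinity>)\<close>.\<close>

definition tail_norm :: "(real \<Rightarrow> real) \<Rightarrow> real \<Rightarrow> ereal" where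
  "tail_norm h x = (SUP t\<in>{x..}. ereal \<bar>h t\<bar>)"

end

theory Submission
  imports Defs "HOL-Real_Asymp.Real_Asymp"
begin

text \<open>
  The fixed-point equation is a contraction for characteristic functions with vanishing first
  moment, so the law is the weak limit of the iterates started at the point mass at 0; hence any
  bound on the moment generating function that the map preserves passes to the law.  Two such
  bounds, \<open>exp (64 (e\<^bsup>|t|\<^esup> - 1 - |t|))\<close> and, for negative arguments,
  \<open>exp (a s ln s + b s + c)\<close> with \<open>a = 2 - 1/ln 2\<close>, give the upper tail bounds by Chernoff's
  inequality.  For the lower bounds, splitting near \<open>u = 1/2\<close> with both subproblems in the left tail
  squares the tail probability while moving by \<open>2 ln 2 - 1\<close>, and splitting with
  \<open>u \<approx> 1/(x ln x)\<close> moves the right tail by almost 1 at the cost of a factor of order \<open>u\<close>.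
  For the derivatives, van der Corput's lemma (the combination \<open>u z + (1 - u) z' + g(u)\<close> is
  strongly convex in \<open>u\<close>) gives \<open>|char t| = O(|t|\<^bsup>-1/2\<^esup>)\<close>, which the fixed-point equation
  bootstraps to any polynomial rate, so the distribution function is smooth with the \<open>n\<close>-th
  derivative bounded by \<open>exp (O(n\<^sup>2))\<close>.  Landau's inequality then transfers the upper bounds to all
  derivatives, interpolating between the orders \<open>k\<close> and \<open>k + ln x\<close> for the right tail, and the mean
  value theorem on \<open>[x, 2x]\<close> transfers the lower bounds.
\<close>

section \<open>The toll function and the entropy\<close>

text \<open>A priori only the mean of the law is known, so the fixed-point equation cannot bound its
  moment generating function directly: an infinite value would satisfy every inequality. The
  iteration starts from the value 1, so there induction can begin. On the left, each squaring of the
  probability doubles the exponent and shifts the point by \<open>2 ln 2 - 1\<close>; reaching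
  \<open>x\<close> costs an exponent of order \<open>2 ^ (x / (2 ln 2 - 1)) = exp (gamma x)\<close>,
  which is where \<open>gamma = 1/a\<close> comes from. The growing interpolation order is forced by
  the right tail: Landau's inequality between fixed orders keeps only a fixed fraction of
  \<open>x ln x\<close>, whereas an order \<open>p >= ln x\<close> loses only
  \<open>x ln x / (p + 1) <= x\<close>. This needs derivative bounds explicit in the order, and
  \<open>exp (O(n^2))\<close> is affordable because its \<open>(p + 1)\<close>-th root is
  \<open>exp (O(ln x))\<close>. On the left a halved exponent is merely a shift inside the double
  exponential. Lower bounds pass to derivatives because both tails at \<open>2x\<close> are
  negligible against those at \<open>x\<close>.\<close>

lemma quicksort_toll_measurable [measurable]: "quicksort_toll \<in> borel_measurable borel"
  unfolding quicksort_toll_def[abs_def] by measurable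

lemma ln_ge_one_minus_inverse:
  fixes x :: real
  assumes "0 < x"
  shows "1 - 1 / x \<le> ln x"
  using ln_le_minus_one[of "1 / x"] assms by (simp add: ln_div)

text \<open>The tangent bound \<open>1 - 1/y <= ln y\<close> at \<open>y = c * x\<close>, multiplied
  by \<open>x\<close>. With \<open>c = 2\<close>, the copies for \<open>u\<close> and
  \<open>1 - u\<close> sum to the entropy bound; with \<open>c = 1\<close> it yields
  \<open>-1 <= x * ln x\<close>.\<close>

lemma mult_ln_ge:
  fixes x c :: real
  assumes "0 < x" "0 < c"
  shows "x - 1 / c \<le> x * (ln c + ln x)"
proof -
  have "x * (1 - 1 / (c * x)) \<le> x * ln (c * x)"
    using assms by (intro mult_left_mono ln_ge_one_minus_inverse) auto
  moreover have "x * (1 - 1 / (c * x)) = x - 1 / c"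
    using assms by (simp add: right_diff_distrib)
  ultimately show ?thesis using assms by (simp add: ln_mult)
qed

lemma mult_ln_gt:
  fixes x c :: real
  assumes "0 < x" "0 < c" "c * x \<noteq> 1"
  shows "x - 1 / c < x * (ln c + ln x)"
proof -
  have "ln (1 / (c * x)) \<noteq> 1 / (c * x) - 1"
    using assms ln_eq_minus_one[of "1 / (c * x)"] by (auto simp: field_simps)
  then have "1 - 1 / (c * x) < ln (c * x)"
    using assms ln_le_minus_one[of "1 / (c * x)"] by (simp add: ln_div)
  then have "x * (1 - 1 / (c * x)) < x * ln (c * x)"
    using assms by simp
  moreover have "x * (1 - 1 / (c * x)) = x - 1 / c"
    using assms by (simp add: right_diff_distrib)
  ultimately show ?thesis using assms by (simp add: ln_mult)
qed

lemma entropy_ge: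
  fixes u :: real
  assumes "0 < u" "u < 1"
  shows "- ln 2 \<le> u * ln u + (1 - u) * ln (1 - u)"
  using mult_ln_ge[of u 2] mult_ln_ge[of "1 - u" 2] assms by (simp add: algebra_simps)

text \<open>Strictness off the midpoint makes the exponent in
  \<open>nn_integral_entropy_decay\<close> positive almost everywhere.\<close>

lemma entropy_gt:
  fixes u :: real
  assumes "0 < u" "u < 1" "u \<noteq> 1 / 2"
  shows "- ln 2 < u * ln u + (1 - u) * ln (1 - u)"
  using mult_ln_gt[of u 2] mult_ln_ge[of "1 - u" 2] assms by (simp add: algebra_simps)

lemma quicksort_toll_eq:
  "quicksort_toll u = 2 * (u * ln u + (1 - u) * ln (1 - u)) + 1"
  by (simp add: quicksort_toll_def)

lemma quicksort_toll_le_1: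
  assumes "0 < u" "u < 1"
  shows "quicksort_toll u \<le> 1"
  using assms mult_nonneg_nonpos[of u "ln u"] mult_nonneg_nonpos[of "1 - u" "ln (1 - u)"]
  by (simp add: quicksort_toll_eq)

text \<open>The lower bound makes \<open>2 - 1 / ln 2\<close> and \<open>2 * ln 2 - 1\<close>
  positive; the upper one gives \<open>1 - 2 * ln 2 > - 1\<close>, so that the toll is at most 1 in
  absolute value.\<close>

lemma ln_2_bounds: "1 / 2 < ln (2::real)" "ln (2::real) < 1"
proof -
  have "exp (1 / 2 :: real) < 2"
  proof -
    have "exp (1 / 2 :: real) \<le> 1 + 1 / 2 + (1 / 2)\<^sup>2"
      by (rule exp_bound) auto
    also have "\<dots> < 2" by (simp add: power2_eq_square)
    finally show ?thesis .
  qed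
  then show "1 / 2 < ln (2::real)" by (metis exp_less_cancel_iff exp_ln zero_less_numeral)
  have "ln (2::real) \<noteq> 2 - 1" using ln_eq_minus_one[of 2] by auto
  then show "ln (2::real) < 1" using ln_le_minus_one[of 2] by simp
qed

lemma quicksort_toll_abs_le_1:
  assumes "0 < u" "u < 1"
  shows "\<bar>quicksort_toll u\<bar> \<le> 1"
  using entropy_ge[OF assms] quicksort_toll_le_1[OF assms] ln_2_bounds
  by (simp add: quicksort_toll_eq)

text \<open>Applying \<open>ln y <= y - 1\<close> at \<open>y = 2u\<close> and
  \<open>y = 2(1 - u)\<close> makes the two contributions add up to \<open>(2u - 1)^2\<close>. This
  measures the loss when the left-tail recursion splits near, but not at, the midpoint.\<close>

lemma quicksort_toll_upper_quadratic:
  assumes "0 < u" "u < 1"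
  shows "quicksort_toll u \<le> 1 - 2 * ln 2 + 8 * (u - 1 / 2)\<^sup>2"
proof -
  have *: "x * (ln 2 + ln x) \<le> x * (2 * x - 1)" if "0 < x" for x :: real
    using that ln_le_minus_one[of "2 * x"] by (intro mult_left_mono) (auto simp: ln_mult)
  show ?thesis
    using *[of u] *[of "1 - u"] assms
    by (simp add: quicksort_toll_eq power2_eq_square algebra_simps)
qed

lemma quicksort_toll_lower_small:
  assumes "0 < u" "u < 1"
  shows "1 - 2 * u - 2 * u * ln (1 / u) \<le> quicksort_toll u"
proof -
  have "- u \<le> (1 - u) * ln (1 - u)"
    using mult_ln_ge[of "1 - u" 1] assms by simp
  then show ?thesis using assms by (simp add: quicksort_toll_eq ln_div)
qed

text \<open>Mean zero of the toll removes the term of first order in \<open>t\<close> from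
  \<open>nn_integral_small_mgf\<close>.\<close>

lemma quicksort_toll_integral:
  "set_integrable lborel {0<..<1} quicksort_toll"
  "(LINT u:{0<..<1}|lborel. quicksort_toll u) = 0"
proof -
  \<comment> \<open>By parts, \<open>u^2 ln u - u^2 / 2\<close> has derivative
    \<open>2 u ln u\<close>. The logarithms are singular at the endpoints, so the boundary values
    (both 1/2) enter as one-sided limits.\<close>
  let ?G = "\<lambda>u::real. u\<^sup>2 * ln u - u\<^sup>2 / 2 - ((1 - u)\<^sup>2 * ln (1 - u) - (1 - u)\<^sup>2 / 2) + u"
  show int: "set_integrable lborel {0<..<1} quicksort_toll"
    unfolding set_integrable_def
    by (rule Bochner_Integration.integrable_bound[of _ "indicator {0<..<1}"])
       (auto simp: indicator_def quicksort_toll_abs_le_1)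
  have "(LBINT u=0..1. quicksort_toll u) = 1 / 2 - 1 / 2"
  proof (rule interval_integral_FTC_integrable)
    fix x :: real assume "0 < ereal x" "ereal x < 1"
    then have x: "0 < x" "x < 1" by auto
    have "((1 - x)\<^sup>2 / (1 - x)) = 1 - x" "x\<^sup>2 / x = x"
      using x by (simp_all add: power2_eq_square del: left_diff_distrib' right_diff_distrib')
    then have "(?G has_real_derivative quicksort_toll x) (at x)"
      unfolding quicksort_toll_def
      using x by (auto intro!: derivative_eq_intros simp: field_simps)
    then show "(?G has_vector_derivative quicksort_toll x) (at x)"
      by (simp add: has_real_derivative_iff_has_vector_derivative)
    show "isCont quicksort_toll x"
      unfolding quicksort_toll_def[abs_def] using x by (intro continuous_intros) auto
  next
    show "set_integrable lborel (einterval 0 1) quicksort_toll"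
      using int by (simp add: zero_ereal_def one_ereal_def)
    have "(?G \<longlongrightarrow> 1 / 2) (at_right 0)" by real_asymp
    then show "((?G \<circ> real_of_ereal) \<longlongrightarrow> 1 / 2) (at_right 0)"
      by (simp add: zero_ereal_def ereal_tendsto_simps)
    have "(?G \<longlongrightarrow> 1 / 2) (at_left 1)" by real_asymp
    then show "((?G \<circ> real_of_ereal) \<longlongrightarrow> 1 / 2) (at_left 1)"
      by (simp add: one_ereal_def ereal_tendsto_simps)
  qed (auto simp: zero_ereal_def one_ereal_def)
  then show "(LINT u:{0<..<1}|lborel. quicksort_toll u) = 0"
    by (simp add: interval_lebesgue_integral_def zero_ereal_def one_ereal_def)
qed

section \<open>The fixed-point map\<close>

abbreviation unif01 :: "real measure" where
  "unif01 \<equiv> uniform_measure lborel {0<..<1}"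

lemma prob_space_unif01: "prob_space unif01"
  by (rule prob_space_uniform_measure) auto

lemma AE_unif01: "AE u in unif01. 0 < u \<and> u < 1"
  by (rule AE_uniform_measureI) auto

lemma integral_unif01:
  fixes f :: "real \<Rightarrow> 'a::{banach, second_countable_topology}"
  assumes [measurable]: "f \<in> borel_measurable borel"
  shows "(LINT u|unif01. f u) = (LINT u:{0<..<1}|lborel. f u)"
    and "integrable unif01 f \<longleftrightarrow> set_integrable lborel {0<..<1} f"
proof -
  have "unif01 = density lborel (\<lambda>x. ennreal (indicator {0<..<1} x))"
    by (simp add: uniform_measure_def ennreal_indicator[symmetric] divide_ennreal_def)
  then show "(LINT u|unif01. f u) = (LINT u:{0<..<1}|lborel. f u)"
    "integrable unif01 f \<longleftrightarrow> set_integrable lborel {0<..<1} f"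
    by (auto simp: integral_density integrable_density set_lebesgue_integral_def set_integrable_def)
qed

definition qs_comb :: "real \<Rightarrow> real \<Rightarrow> real \<Rightarrow> real" where
  "qs_comb u z z' = u * z + (1 - u) * z' + quicksort_toll u"

lemma qs_comb_measurable [measurable (raw)]:
  assumes [measurable]: "f \<in> borel_measurable N" "p \<in> borel_measurable N" "q \<in> borel_measurable N"
  shows "(\<lambda>x. qs_comb (f x) (p x) (q x)) \<in> borel_measurable N"
  unfolding qs_comb_def by measurable

lemma quicksort_map_eq:
  "quicksort_map M = distr (unif01 \<Otimes>\<^sub>M (M \<Otimes>\<^sub>M M)) borel (\<lambda>(u, z, z'). qs_comb u z z')"
  by (simp add: quicksort_map_def qs_comb_def)

context real_distribution
begin

lemma qs_measurable [measurable]: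
  "(\<lambda>(u, z, z'). qs_comb u z z') \<in> borel_measurable (unif01 \<Otimes>\<^sub>M (M \<Otimes>\<^sub>M M))"
  by measurable

lemma real_distribution_quicksort_map: "real_distribution (quicksort_map M)"
proof -
  interpret MM: pair_prob_space M M ..
  interpret U: prob_space unif01 by (rule prob_space_unif01)
  interpret pair_prob_space unif01 "M \<Otimes>\<^sub>M M" ..
  show ?thesis
    unfolding quicksort_map_eq by (rule P.real_distribution_distr) simp
qed

lemma nn_integral_quicksort_map:
  assumes [measurable]: "h \<in> borel_measurable borel"
  shows "(\<integral>\<^sup>+x. h x \<partial>quicksort_map M) =
    (\<integral>\<^sup>+u. \<integral>\<^sup>+z. \<integral>\<^sup>+z'. h (qs_comb u z z') \<partial>M \<partial>M \<partial>unif01)"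
proof -
  have sf: "sigma_finite_measure M" ..
  interpret MM: pair_prob_space M M ..
  interpret U: prob_space unif01 by (rule prob_space_unif01)
  interpret pair_prob_space unif01 "M \<Otimes>\<^sub>M M" ..
  have "(\<integral>\<^sup>+x. h x \<partial>quicksort_map M) =
      (\<integral>\<^sup>+w. h ((\<lambda>(u, z, z'). qs_comb u z z') w) \<partial>(unif01 \<Otimes>\<^sub>M (M \<Otimes>\<^sub>M M)))"
    unfolding quicksort_map_eq by (rule nn_integral_distr) auto
  also have "\<dots> = (\<integral>\<^sup>+u. \<integral>\<^sup>+p. h ((\<lambda>(u, z, z'). qs_comb u z z') (u, p)) \<partial>(M \<Otimes>\<^sub>M M) \<partial>unif01)"
    by (rule MM.P.nn_integral_fst[symmetric]) measurable
  also have "\<dots> = (\<integral>\<^sup>+u. \<integral>\<^sup>+z. \<integral>\<^sup>+z'. h (qs_comb u z z') \<partial>M \<partial>M \<partial>unif01)"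
  proof (rule nn_integral_cong)
    fix u
    show "(\<integral>\<^sup>+p. h ((\<lambda>(u, z, z'). qs_comb u z z') (u, p)) \<partial>(M \<Otimes>\<^sub>M M)) =
      (\<integral>\<^sup>+z. \<integral>\<^sup>+z'. h (qs_comb u z z') \<partial>M \<partial>M)"
      using sigma_finite_measure.nn_integral_fst[OF sf, of "\<lambda>(z, z'). h (qs_comb u z z')" M] by (simp add: case_prod_beta')
  qed
  finally show ?thesis .
qed

lemma char_quicksort_map:
  "char (quicksort_map M) t =
    (CLINT u|unif01. iexp (t * quicksort_toll u) * char M (t * u) * char M (t * (1 - u)))"
proof -
  interpret MM: pair_prob_space M M ..
  interpret U: prob_space unif01 by (rule prob_space_unif01)
  interpret pair_prob_space unif01 "M \<Otimes>\<^sub>M M" ..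
  let ?f = "\<lambda>w. iexp (t * (\<lambda>(u, z, z'). qs_comb u z z') w)"
  have int: "integrable (unif01 \<Otimes>\<^sub>M (M \<Otimes>\<^sub>M M)) ?f"
    by (rule P.integrable_const_bound[of _ 1]) auto
  have "char (quicksort_map M) t = (CLINT w|unif01 \<Otimes>\<^sub>M (M \<Otimes>\<^sub>M M). ?f w)"
    unfolding quicksort_map_eq char_def by (rule integral_distr) auto
  also have "\<dots> = (CLINT u|unif01. CLINT p|M \<Otimes>\<^sub>M M. ?f (u, p))"
    by (rule integral_fst'[symmetric, OF int])
  also have "\<dots> = (CLINT u|unif01. iexp (t * quicksort_toll u) * char M (t * u) * char M (t * (1 - u)))"
  proof (rule Bochner_Integration.integral_cong)
    fix u
    have int2: "integrable (M \<Otimes>\<^sub>M M) (\<lambda>p. ?f (u, p))"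
      by (rule MM.P.integrable_const_bound[of _ 1]) auto
    have "(CLINT p|M \<Otimes>\<^sub>M M. ?f (u, p)) = (CLINT z|M. CLINT z'|M. ?f (u, z, z'))"
      by (rule MM.integral_fst'[symmetric, OF int2])
    also have "\<dots> = (CLINT z|M. CLINT z'|M. (iexp (t * quicksort_toll u) * iexp ((t * u) * z)) * iexp ((t * (1 - u)) * z'))"
      by (intro Bochner_Integration.integral_cong refl)
         (simp add: qs_comb_def algebra_simps exp_add[symmetric] exp_diff[symmetric])
    also have "\<dots> = iexp (t * quicksort_toll u) * char M (t * u) * char M (t * (1 - u))"
      by (simp add: char_def)
    finally show "(CLINT p|M \<Otimes>\<^sub>M M. ?f (u, p)) =
      iexp (t * quicksort_toll u) * char M (t * u) * char M (t * (1 - u))" .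
  qed simp
  finally show ?thesis .
qed

text \<open>Fubini with the \<open>u\<close>-integral innermost: an oscillatory bound in
  \<open>u\<close>, uniform in \<open>z\<close> and \<open>z'\<close>, passes to the characteristic
  function without any information on the law of \<open>z\<close> and \<open>z'\<close>.\<close>

lemma norm_char_quicksort_map_le:
  assumes "\<And>z z'. norm (CLINT u|unif01. iexp (t * qs_comb u z z')) \<le> B"
  shows "norm (char (quicksort_map M) t) \<le> B"
proof -
  interpret MM: pair_prob_space M M ..
  interpret U: prob_space unif01 by (rule prob_space_unif01)
  interpret pair_prob_space unif01 "M \<Otimes>\<^sub>M M" ..
  let ?f = "\<lambda>w. iexp (t * (\<lambda>(u, z, z'). qs_comb u z z') w)"
  have int: "integrable (unif01 \<Otimes>\<^sub>M (M \<Otimes>\<^sub>M M)) ?f"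
    by (rule P.integrable_const_bound[of _ 1]) auto
  have "char (quicksort_map M) t = (CLINT w|unif01 \<Otimes>\<^sub>M (M \<Otimes>\<^sub>M M). ?f w)"
    unfolding quicksort_map_eq char_def by (rule integral_distr) auto
  also have "\<dots> = (CLINT p|M \<Otimes>\<^sub>M M. CLINT u|unif01. ?f (u, p))"
    using integral_snd[of "\<lambda>u p. ?f (u, p)"] int by (simp add: case_prod_beta')
  also have "norm \<dots> \<le> (LINT p|(M \<Otimes>\<^sub>M M). B)"
  proof (rule Bochner_Integration.integral_norm_bound_integral)
    show "integrable (M \<Otimes>\<^sub>M M) (\<lambda>p. CLINT u|unif01. ?f (u, p))"
      using integrable_snd[of "\<lambda>u p. ?f (u, p)"] int by (simp add: case_prod_beta')
    show "norm (CLINT u|unif01. ?f (u, p)) \<le> B" for p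
      using assms[of "fst p" "snd p"] by (simp add: case_prod_beta')
  qed simp
  also have "\<dots> = B" using MM.P.prob_space by simp
  finally show ?thesis .
qed

end

section \<open>Moment generating functions of the iterates\<close>

lemma integral_unif01_FTC:
  fixes f F :: "real \<Rightarrow> real"
  assumes "\<And>x. 0 \<le> x \<Longrightarrow> x \<le> 1 \<Longrightarrow> (F has_real_derivative f x) (at x)"
    and "continuous_on UNIV f"
  shows "integrable unif01 f" "(LINT u|unif01. f u) = F 1 - F 0"
proof -
  have [measurable]: "f \<in> borel_measurable borel"
    using assms(2) by (rule borel_measurable_continuous_onI)
  have "(LBINT x=ereal 0..ereal 1. f x) = F 1 - F 0"
    using assms
    by (intro interval_integral_FTC_finite)
       (auto simp: has_real_derivative_iff_has_vector_derivative[symmetric]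
          intro: continuous_on_subset has_field_derivative_at_within)
  then show "(LINT u|unif01. f u) = F 1 - F 0"
    by (simp add: integral_unif01 interval_lebesgue_integral_def)
  have "interval_lebesgue_integrable lborel (ereal 0) (ereal 1) f"
    by (intro interval_integrable_continuous_on continuous_on_subset[OF assms(2)]) auto
  then show "integrable unif01 f"
    by (simp add: integral_unif01 interval_lebesgue_integrable_def)
qed

text \<open>Valued in \<open>ennreal\<close>, since finiteness for the limit law is a result and not
  a hypothesis.\<close>

definition mgf :: "real measure \<Rightarrow> real \<Rightarrow> ennreal" where
  "mgf M t = (\<integral>\<^sup>+z. ennreal (exp (t * z)) \<partial>M)"

lemma (in real_distribution) mgf_measurable [measurable]: "mgf M \<in> borel_measurable borel"
  unfolding mgf_def[abs_def] by measurable

lemma (in real_distribution) mgf_quicksort_map: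
  "mgf (quicksort_map M) t =
    (\<integral>\<^sup>+u. ennreal (exp (t * quicksort_toll u)) * mgf M (t * u) * mgf M (t * (1 - u)) \<partial>unif01)"
proof -
  have "mgf (quicksort_map M) t =
      (\<integral>\<^sup>+u. \<integral>\<^sup>+z. \<integral>\<^sup>+z'. ennreal (exp (t * qs_comb u z z')) \<partial>M \<partial>M \<partial>unif01)"
    unfolding mgf_def by (rule nn_integral_quicksort_map) measurable
  also have "\<dots> = (\<integral>\<^sup>+u. \<integral>\<^sup>+z. \<integral>\<^sup>+z'. (ennreal (exp (t * quicksort_toll u)) *
      ennreal (exp (t * u * z))) * ennreal (exp (t * (1 - u) * z')) \<partial>M \<partial>M \<partial>unif01)"
    by (intro nn_integral_cong)
       (simp add: qs_comb_def algebra_simps exp_add[symmetric] ennreal_mult[symmetric])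
  also have "\<dots> = (\<integral>\<^sup>+u. ennreal (exp (t * quicksort_toll u)) * mgf M (t * u) * mgf M (t * (1 - u)) \<partial>unif01)"
    by (simp add: mgf_def nn_integral_cmult nn_integral_multc)
  finally show ?thesis .
qed

text \<open>Common induction step for both exponent bounds \<open>B\<close>: the part
  \<open>D\<close> of the exponent that is free of \<open>u\<close> leaves the integral, and the
  integral of the rest, \<open>exp (d u)\<close>, is estimated by \<open>exp e\<close>. The two uses
  have \<open>e = 0\<close> and \<open>e = - a\<close>.\<close>

lemma (in real_distribution) mgf_quicksort_map_le:
  assumes "\<And>u. 0 < u \<Longrightarrow> u < 1 \<Longrightarrow> mgf M (t * u) \<le> ennreal (exp (B (t * u)))"
    and "\<And>u. 0 < u \<Longrightarrow> u < 1 \<Longrightarrow>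
      t * quicksort_toll u + B (t * u) + B (t * (1 - u)) \<le> D + d u"
    and "(\<integral>\<^sup>+u. ennreal (exp (d u)) \<partial>unif01) \<le> ennreal (exp e)"
    and [measurable]: "d \<in> borel_measurable borel"
  shows "mgf (quicksort_map M) t \<le> ennreal (exp (D + e))"
proof -
  have "mgf (quicksort_map M) t \<le> (\<integral>\<^sup>+u. ennreal (exp D) * ennreal (exp (d u)) \<partial>unif01)"
    unfolding mgf_quicksort_map
  proof (rule nn_integral_mono_AE, rule AE_mp[OF AE_unif01], rule AE_I2, rule impI)
    fix u :: real assume u: "0 < u \<and> u < 1"
    have "ennreal (exp (t * quicksort_toll u)) * mgf M (t * u) * mgf M (t * (1 - u)) \<le>
        ennreal (exp (t * quicksort_toll u)) * ennreal (exp (B (t * u))) * ennreal (exp (B (t * (1 - u))))"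
      using assms(1)[of u] assms(1)[of "1 - u"] u by (intro mult_mono) auto
    also have "\<dots> = ennreal (exp (t * quicksort_toll u + B (t * u) + B (t * (1 - u))))"
      by (simp add: ennreal_mult[symmetric] exp_add)
    also have "\<dots> \<le> ennreal (exp D) * ennreal (exp (d u))"
      using assms(2)[of u] u by (simp add: ennreal_mult[symmetric] exp_add[symmetric])
    finally show "ennreal (exp (t * quicksort_toll u)) * mgf M (t * u) * mgf M (t * (1 - u)) \<le>
      ennreal (exp D) * ennreal (exp (d u))" .
  qed
  also have "\<dots> = ennreal (exp D) * (\<integral>\<^sup>+u. ennreal (exp (d u)) \<partial>unif01)"
    by (rule nn_integral_cmult) measurable
  also have "\<dots> \<le> ennreal (exp D) * ennreal (exp e)"
    using assms(3) by (rule mult_left_mono) simp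
  finally show ?thesis by (simp add: ennreal_mult[symmetric] exp_add)
qed

text \<open>For \<open>b s = exp s - 1 - s\<close> the product equals
  \<open>b s - b (s * u) - b (s * (1 - u))\<close>: it is what the exponent gains by splitting. The
  estimate here is the one that is effective for small \<open>s\<close>.\<close>

lemma exp_diff_products:
  fixes u s :: real
  assumes "0 \<le> u" "u \<le> 1" "0 \<le> s"
  shows "s\<^sup>2 * (u * (1 - u)) \<le> (exp (s * u) - 1) * (exp (s * (1 - u)) - 1)"
proof -
  have "(s * u) * (s * (1 - u)) \<le> (exp (s * u) - 1) * (exp (s * (1 - u)) - 1)"
  proof (rule mult_mono)
    show "s * u \<le> exp (s * u) - 1" using exp_ge_add_one_self[of "s * u"] by linarith
    show "s * (1 - u) \<le> exp (s * (1 - u)) - 1"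
      using exp_ge_add_one_self[of "s * (1 - u)"] by linarith
  qed (use assms in auto)
  then show ?thesis by (simp add: power2_eq_square algebra_simps)
qed

lemma exp_convex_le:
  fixes a b x :: real
  assumes "0 \<le> x" "x \<le> 1"
  shows "exp ((1 - x) * a + x * b) \<le> (1 - x) * exp a + x * exp b"
  using convex_onD[OF exp_convex, of x a b] assms by (simp add: scaleR_conv_of_real)

text \<open>The right-hand side is concave in \<open>u\<close>, vanishes at \<open>u = 0\<close> and is symmetric about \<open>u = 1/2\<close>.\<close>

lemma exp_products_lower:
  fixes u s :: real
  assumes "0 \<le> u" "u \<le> 1 / 2" "1 / 2 \<le> s"
  shows "2 / 25 * u * exp s \<le> (exp (s * u) - 1) * (exp (s * (1 - u)) - 1)"
proof -
  have 1: "exp (s * u) \<le> (1 - 2 * u) + 2 * u * exp (s / 2)"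
    using exp_convex_le[of "2 * u" 0 "s / 2"] assms by (simp add: algebra_simps)
  have 2: "exp (s * (1 - u)) \<le> (1 - 2 * u) * exp s + 2 * u * exp (s / 2)"
    using exp_convex_le[of "2 * u" s "s / 2"] assms by (simp add: algebra_simps)
  \<comment> \<open>For \<open>E = exp (s / 2)\<close>, \<open>E >= 5/4\<close> gives
    \<open>E - 1 >= E / 5\<close>; squaring yields 1/25, and the chord factor \<open>2 * u\<close>
    turns it into 2/25.\<close>
  have "1 + 1 / 4 \<le> exp (s / 2)"
    using exp_ge_add_one_self[of "s / 2"] assms by linarith
  then have "(exp (s / 2) / 5)\<^sup>2 \<le> (exp (s / 2) - 1)\<^sup>2"
    by (intro power_mono) auto
  also have "exp (s / 2) * exp (s / 2) = exp s"
    by (simp add: exp_add[symmetric])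
  ultimately have "exp s / 25 \<le> (exp (s / 2) - 1)\<^sup>2"
    by (simp add: power2_eq_square power_divide)
  then have "2 * u * (exp s / 25) \<le> 2 * u * (exp (s / 2) - 1)\<^sup>2"
    using assms by (intro mult_left_mono) auto
  also have "\<dots> = exp s + 1 - ((1 - 2 * u) + 2 * u * exp (s / 2)) - ((1 - 2 * u) * exp s + 2 * u * exp (s / 2))"
    using \<open>exp (s / 2) * exp (s / 2) = exp s\<close> by (simp add: power2_eq_square algebra_simps)
  also have "\<dots> \<le> exp s + 1 - exp (s * u) - exp (s * (1 - u))"
    using 1 2 by linarith
  also have "\<dots> = (exp (s * u) - 1) * (exp (s * (1 - u)) - 1)"
    by (simp add: algebra_simps exp_add[symmetric])
  finally show ?thesis by simp
qed

lemma nn_integral_unif01_exp_le: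
  fixes A :: real
  assumes "0 < A"
  shows "(\<integral>\<^sup>+u. ennreal (exp (- A * u)) \<partial>unif01) \<le> ennreal (1 / A)"
    and "(\<integral>\<^sup>+u. ennreal (exp (- A * (1 - u))) \<partial>unif01) \<le> ennreal (1 / A)"
proof -
  have "integrable unif01 (\<lambda>u. exp (- A * u))"
       "(LINT u|unif01. exp (- A * u)) = (- exp (- A * 1) / A) - (- exp (- A * 0) / A)"
    using assms by (intro integral_unif01_FTC[where F = "\<lambda>u. - exp (- A * u) / A"];
      auto intro!: derivative_eq_intros continuous_intros)+
  moreover have "(- exp (- A * 1) / A) - (- exp (- A * 0) / A) \<le> 1 / A"
    using assms by (simp add: field_simps)
  ultimately show "(\<integral>\<^sup>+u. ennreal (exp (- A * u)) \<partial>unif01) \<le> ennreal (1 / A)"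
    by (subst nn_integral_eq_integral) (auto intro!: ennreal_leI)
  have "integrable unif01 (\<lambda>u. exp (- A * (1 - u)))"
       "(LINT u|unif01. exp (- A * (1 - u))) = (exp (- A * (1 - 1)) / A) - (exp (- A * (1 - 0)) / A)"
    using assms by (intro integral_unif01_FTC[where F = "\<lambda>u. exp (- A * (1 - u)) / A"];
      auto intro!: derivative_eq_intros continuous_intros)+
  moreover have "(exp (- A * (1 - 1)) / A) - (exp (- A * (1 - 0)) / A) \<le> 1 / A"
    using assms by (simp add: field_simps)
  ultimately show "(\<integral>\<^sup>+u. ennreal (exp (- A * (1 - u))) \<partial>unif01) \<le> ennreal (1 / A)"
    by (subst nn_integral_eq_integral) (auto intro!: ennreal_leI)
qed

lemma integral_unif01_quicksort_toll:
  "integrable unif01 quicksort_toll" "(LINT u|unif01. quicksort_toll u) = 0"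
  using quicksort_toll_integral by (auto simp: integral_unif01)

lemma exp_le_quadratic:
  fixes x :: real
  assumes "\<bar>x\<bar> \<le> 1"
  shows "exp x \<le> 1 + x + x\<^sup>2"
proof (cases "0 \<le> x")
  case True
  then show ?thesis using exp_bound[of x] assms by simp
next
  case False
  \<comment> \<open>The product is \<open>1 - x^3\<close>.\<close>
  have "1 \<le> (1 - x) * (1 + x + x\<^sup>2)"
    using False mult_nonneg_nonpos[of "x\<^sup>2" x] by (simp add: algebra_simps power2_eq_square)
  also have "\<dots> \<le> exp (- x) * (1 + x + x\<^sup>2)"
  proof (rule mult_right_mono)
    show "1 - x \<le> exp (- x)" using exp_ge_add_one_self[of "- x"] by simp
    show "0 \<le> 1 + x + x\<^sup>2" using assms by (simp add: add_nonneg_nonneg)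
  qed
  finally show ?thesis by (simp add: exp_minus field_simps)
qed

text \<open>The excess \<open>t^2\<close> of the quadratic bound for \<open>exp\<close> is repaid by
  \<open>2 t^2\<close> on the middle half, a set of probability 1/2, so the right-hand side
  integrates to exactly 1. The factor 64 is ample for this: on the middle half the gain is at least
  \<open>64 * 3/16 * t^2 = 12 t^2\<close>.\<close>

lemma small_mgf_pointwise:
  fixes t u :: real
  assumes "\<bar>t\<bar> \<le> 1 / 2" "0 < u" "u < 1"
  shows "exp (t * quicksort_toll u - 64 * ((exp (\<bar>t\<bar> * u) - 1) * (exp (\<bar>t\<bar> * (1 - u)) - 1)))
    \<le> 1 + t * quicksort_toll u + t\<^sup>2 - 2 * t\<^sup>2 * indicator {1/4<..<3/4} u"
proof -
  define g where "g = t * quicksort_toll u"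
  define P where "P = (exp (\<bar>t\<bar> * u) - 1) * (exp (\<bar>t\<bar> * (1 - u)) - 1)"
  have g: "\<bar>g\<bar> \<le> \<bar>t\<bar>"
    using quicksort_toll_abs_le_1[of u] assms mult_left_le[of "\<bar>quicksort_toll u\<bar>" "\<bar>t\<bar>"]
    by (simp add: g_def abs_mult)
  have g2: "g\<^sup>2 \<le> t\<^sup>2" using g by (simp add: abs_le_square_iff)
  have "exp g \<le> 1 + g + g\<^sup>2"
    using g assms by (intro exp_le_quadratic) auto
  then have eg: "exp g \<le> 1 + g + t\<^sup>2" using g2 by simp
  have P0: "t\<^sup>2 * (u * (1 - u)) \<le> P"
    using exp_diff_products[of u "\<bar>t\<bar>"] assms by (simp add: P_def)
  show ?thesis
  proof (cases "u \<in> {1/4<..<3/4}")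
    case False
    have "0 \<le> P" using P0 assms by (smt (verit) mult_nonneg_nonneg zero_le_power2)
    then have "exp (g - 64 * P) \<le> exp g" by simp
    with eg have "exp (g - 64 * P) \<le> 1 + g + t\<^sup>2" by linarith
    with False show ?thesis unfolding g_def P_def by simp
  next
    case True
    have "0 \<le> (u - 1 / 4) * (3 / 4 - u)" using True by (intro mult_nonneg_nonneg) auto
    also have "(u - 1 / 4) * (3 / 4 - u) = u * (1 - u) - 3 / 16" by (simp add: field_simps)
    finally have "3 / 16 \<le> u * (1 - u)" by simp
    then have "t\<^sup>2 * (3 / 16) \<le> P" using P0 by (meson mult_left_mono order_trans zero_le_power2)
    then have "12 * t\<^sup>2 \<le> 64 * P" by simp
    then have "exp (- (64 * P)) \<le> exp (- (12 * t\<^sup>2))" by simp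
    \<comment> \<open>Convexity of \<open>exp\<close> between 0 and -3 with weight
      \<open>4 t^2 <= 1\<close>; since \<open>exp (-3) <= 1/4\<close>, the result is
      \<open>1 - 3 t^2\<close>.\<close>
    also have "\<dots> = exp (4 * t\<^sup>2 * (-3) + (1 - 4 * t\<^sup>2) * 0)" by simp
    also have "\<dots> \<le> 4 * t\<^sup>2 * exp (-3) + (1 - 4 * t\<^sup>2) * exp 0"
    proof -
      have "4 * t\<^sup>2 \<le> 1" using power_mono[OF assms(1), of 2] by (simp add: power2_eq_square)
      then show ?thesis using exp_convex_le[of "4 * t\<^sup>2" 0 "-3"] by (simp add: algebra_simps)
    qed
    also have "exp (-3) \<le> (1 / 4 :: real)"
      using exp_ge_add_one_self[of "3::real"] by (simp add: exp_minus field_simps)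
    then have "4 * t\<^sup>2 * exp (-3) + (1 - 4 * t\<^sup>2) * exp 0 \<le> 4 * t\<^sup>2 * (1 / 4) + (1 - 4 * t\<^sup>2)"
      by (intro add_mono mult_left_mono) auto
    finally have w: "exp (- (64 * P)) \<le> 1 - 3 * t\<^sup>2" by simp
    have "exp (g - 64 * P) = exp g * exp (- (64 * P))" by (simp add: exp_add[symmetric])
    also have "\<dots> \<le> (1 + g + t\<^sup>2) * (1 - 3 * t\<^sup>2)"
      using eg w by (intro mult_mono) (auto intro: order_trans[OF exp_ge_zero])
    also have "\<dots> = 1 + g + t\<^sup>2 - 3 * t\<^sup>2 * (1 + g + t\<^sup>2)" by (simp add: algebra_simps)
    also have "\<dots> \<le> 1 + g + t\<^sup>2 - 3 * t\<^sup>2 * (2 / 3)"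
    proof -
      \<comment> \<open>Gives \<open>1 + g + t^2 >= 1 - |t| + t^2 >= 3/4\<close>.\<close>
      have "0 \<le> (\<bar>t\<bar> - 1 / 2)\<^sup>2" by simp
      then have "2 / 3 \<le> 1 + g + t\<^sup>2" using g by (simp add: power2_eq_square algebra_simps) 
      then show ?thesis by (intro diff_left_mono mult_left_mono) auto
    qed
    finally show ?thesis using True by (simp add: g_def P_def)
  qed
qed

lemma nn_integral_small_mgf:
  fixes t :: real
  assumes "\<bar>t\<bar> \<le> 1 / 2"
  shows "(\<integral>\<^sup>+u. ennreal (exp (t * quicksort_toll u -
    64 * ((exp (\<bar>t\<bar> * u) - 1) * (exp (\<bar>t\<bar> * (1 - u)) - 1)))) \<partial>unif01) \<le> 1" (is "?I \<le> 1")
proof -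
  interpret U: prob_space unif01 by (rule prob_space_unif01)
  let ?r = "\<lambda>u. 1 + t * quicksort_toll u + t\<^sup>2 - 2 * t\<^sup>2 * indicator {1/4<..<3/4} u"
  have nonneg: "AE u in unif01. 0 \<le> ?r u"
  proof (rule AE_mp[OF AE_unif01], rule AE_I2, rule impI)
    fix u :: real assume "0 < u \<and> u < 1"
    then show "0 \<le> ?r u"
      by (intro order_trans[OF exp_ge_zero small_mgf_pointwise[OF assms]]) auto
  qed
  have ind: "(LINT u|unif01. indicator {1/4<..<3/4} u) = (1 / 2 :: real)"
  proof -
    have "{0<..<1::real} \<inter> {1/4<..<3/4} = {1/4<..<3/4}" by auto
    then show ?thesis by simp
  qed
  have 1: "integrable unif01 (indicator {1/4<..<3/4} :: real \<Rightarrow> real)"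
    by (rule U.integrable_const_bound[of _ 1]) auto
  have int: "integrable unif01 ?r"
    by (intro Bochner_Integration.integrable_add Bochner_Integration.integrable_diff
        integrable_mult_right integral_unif01_quicksort_toll 1) auto
  have "?I \<le> (\<integral>\<^sup>+u. ennreal (?r u) \<partial>unif01)"
    by (rule nn_integral_mono_AE, rule AE_mp[OF AE_unif01])
       (auto intro!: AE_I2 ennreal_leI small_mgf_pointwise assms)
  also have "\<dots> = ennreal (LINT u|unif01. ?r u)"
    by (rule nn_integral_eq_integral[OF int nonneg])
  also have "(LINT u|unif01. ?r u) = 1"
  proof -
    show ?thesis
      using 1 ind integral_unif01_quicksort_toll U.prob_space
      by (simp add: integral_unif01_quicksort_toll)
  qed
  finally show ?thesis by simp
qed

text \<open>Here the crude \<open>t * g(u) <= |t|\<close> is enough. The gain is at least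
  \<open>A * min u (1 - u)\<close> with \<open>A = 64 * 2/25 * exp |t|\<close>; covering the minimum
  by the sum of both exponentials, the integral is at most
  \<open>exp |t| * 2 / A = 25/64\<close>.\<close>

lemma nn_integral_large_mgf:
  fixes t :: real
  assumes "1 / 2 \<le> \<bar>t\<bar>"
  shows "(\<integral>\<^sup>+u. ennreal (exp (t * quicksort_toll u -
    64 * ((exp (\<bar>t\<bar> * u) - 1) * (exp (\<bar>t\<bar> * (1 - u)) - 1)))) \<partial>unif01) \<le> 1" (is "?I \<le> 1")
proof -
  define A where "A = 128 / 25 * exp \<bar>t\<bar>"
  have A: "0 < A" by (simp add: A_def)
  have "?I \<le> (\<integral>\<^sup>+u. ennreal (exp \<bar>t\<bar>) * (ennreal (exp (- A * u)) + ennreal (exp (- A * (1 - u)))) \<partial>unif01)"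
  proof (rule nn_integral_mono_AE, rule AE_mp[OF AE_unif01], rule AE_I2, rule impI)
    fix u :: real assume u: "0 < u \<and> u < 1"
    define P where "P = (exp (\<bar>t\<bar> * u) - 1) * (exp (\<bar>t\<bar> * (1 - u)) - 1)"
    have "t * quicksort_toll u \<le> \<bar>t\<bar>"
      using quicksort_toll_abs_le_1[of u] u mult_left_le[of "\<bar>quicksort_toll u\<bar>" "\<bar>t\<bar>"]
      abs_ge_self[of "t * quicksort_toll u"]
      by (simp add: abs_mult)
    moreover have "A * u \<le> 64 * P \<or> A * (1 - u) \<le> 64 * P"
    proof (cases "u \<le> 1 / 2")
      case True
      then have "2 / 25 * u * exp \<bar>t\<bar> \<le> P"
        unfolding P_def using u assms by (intro exp_products_lower) auto
      then show ?thesis by (simp add: A_def)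
    next
      case False
      then have "2 / 25 * (1 - u) * exp \<bar>t\<bar> \<le> P"
        using exp_products_lower[of "1 - u" "\<bar>t\<bar>"] u assms by (simp add: P_def mult.commute)
      moreover have "A * (1 - u) = 64 * (2 / 25 * (1 - u) * exp \<bar>t\<bar>)" by (simp add: A_def)
      ultimately show ?thesis by linarith
    qed
    ultimately have "t * quicksort_toll u - 64 * P \<le> \<bar>t\<bar> + - A * u \<or>
        t * quicksort_toll u - 64 * P \<le> \<bar>t\<bar> + - A * (1 - u)"
      by auto
    then have "exp (t * quicksort_toll u - 64 * P) \<le> exp \<bar>t\<bar> * exp (- A * u) \<or>
        exp (t * quicksort_toll u - 64 * P) \<le> exp \<bar>t\<bar> * exp (- A * (1 - u))"
      unfolding exp_add[symmetric] by (metis exp_le_cancel_iff)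
    then have "exp (t * quicksort_toll u - 64 * P) \<le>
        exp \<bar>t\<bar> * (exp (- A * u) + exp (- A * (1 - u)))"
    proof
      assume "exp (t * quicksort_toll u - 64 * P) \<le> exp \<bar>t\<bar> * exp (- A * u)"
      also have "\<dots> \<le> exp \<bar>t\<bar> * (exp (- A * u) + exp (- A * (1 - u)))" by simp
      finally show ?thesis .
    next
      assume "exp (t * quicksort_toll u - 64 * P) \<le> exp \<bar>t\<bar> * exp (- A * (1 - u))"
      also have "\<dots> \<le> exp \<bar>t\<bar> * (exp (- A * u) + exp (- A * (1 - u)))" by simp
      finally show ?thesis .
    qed
    then show "ennreal (exp (t * quicksort_toll u - 64 * ((exp (\<bar>t\<bar> * u) - 1) * (exp (\<bar>t\<bar> * (1 - u)) - 1))))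
      \<le> ennreal (exp \<bar>t\<bar>) * (ennreal (exp (- A * u)) + ennreal (exp (- A * (1 - u))))"
      by (simp add: P_def ennreal_mult[symmetric] ennreal_plus[symmetric] del: ennreal_plus)
  qed
  also have "\<dots> = ennreal (exp \<bar>t\<bar>) * ((\<integral>\<^sup>+u. ennreal (exp (- A * u)) \<partial>unif01) +
      (\<integral>\<^sup>+u. ennreal (exp (- A * (1 - u))) \<partial>unif01))"
    by (subst nn_integral_cmult, simp, subst nn_integral_add) auto
  also have "\<dots> \<le> ennreal (exp \<bar>t\<bar>) * (ennreal (1 / A) + ennreal (1 / A))"
    by (intro mult_left_mono add_mono nn_integral_unif01_exp_le A) auto
  also have "\<dots> = ennreal (exp \<bar>t\<bar> * (2 / A))"
    using A by (simp add: ennreal_mult[symmetric] ennreal_plus[symmetric] del: ennreal_plus)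
  also have "\<dots> \<le> 1"
    by (simp add: A_def)
  finally show ?thesis .
qed

section \<open>Iterates of the map and bounds on their moment generating functions\<close>

definition qs_iter :: "nat \<Rightarrow> real measure" where
  "qs_iter n = (quicksort_map ^^ n) (return borel 0)"

lemma qs_iter_simps: "qs_iter 0 = return borel 0" "qs_iter (Suc n) = quicksort_map (qs_iter n)"
  by (simp_all add: qs_iter_def)

lemma real_distribution_qs_iter: "real_distribution (qs_iter n)"
proof (induction n)
  case 0
  have "prob_space (return borel (0::real))" by (rule prob_space_return) simp
  then show ?case
    by (simp add: qs_iter_simps real_distribution_def real_distribution_axioms_def)
next
  case (Suc n)
  then show ?case by (simp add: qs_iter_simps real_distribution.real_distribution_quicksort_map)
qed

lemma mgf_qs_iter_0: "mgf (qs_iter 0) t = 1"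
  by (simp add: mgf_def qs_iter_simps nn_integral_return)

text \<open>Subtracting \<open>1 + |t|\<close> makes the exponent quadratic at 0, as befits mean
  zero. Its exponential growth in \<open>|t|\<close> is what turns into \<open>x * ln x\<close> in
  the right tail.\<close>

lemma mgf_qs_iter_le:
  "mgf (qs_iter n) t \<le> ennreal (exp (64 * (exp \<bar>t\<bar> - 1 - \<bar>t\<bar>)))"
proof (induction n arbitrary: t)
  case 0
  have "1 + \<bar>t\<bar> \<le> exp \<bar>t\<bar>" by (rule exp_ge_add_one_self)
  then have "1 \<le> exp (64 * (exp \<bar>t\<bar> - 1 - \<bar>t\<bar>))" by (subst one_le_exp_iff) (intro mult_nonneg_nonneg; linarith)
  then have "ennreal 1 \<le> ennreal (exp (64 * (exp \<bar>t\<bar> - 1 - \<bar>t\<bar>)))" by (rule ennreal_leI)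
  then show ?case by (simp only: mgf_qs_iter_0 ennreal_1)
next
  case (Suc n)
  interpret real_distribution "qs_iter n" by (rule real_distribution_qs_iter)
  let ?B = "\<lambda>t. 64 * (exp \<bar>t\<bar> - 1 - \<bar>t\<bar>)"
  let ?d = "\<lambda>u. t * quicksort_toll u - 64 * ((exp (\<bar>t\<bar> * u) - 1) * (exp (\<bar>t\<bar> * (1 - u)) - 1))"
  have "mgf (quicksort_map (qs_iter n)) t \<le> ennreal (exp (?B t + 0))"
  proof (rule mgf_quicksort_map_le)
    fix u :: real assume u: "0 < u" "u < 1"
    have "exp \<bar>t\<bar> = exp (\<bar>t\<bar> * u) * exp (\<bar>t\<bar> * (1 - u))"
      by (simp add: exp_add[symmetric] algebra_simps)
    moreover have "\<bar>t * u\<bar> = \<bar>t\<bar> * u" "\<bar>t * (1 - u)\<bar> = \<bar>t\<bar> * (1 - u)"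
      using u by (simp_all add: abs_mult)
    ultimately show "t * quicksort_toll u + ?B (t * u) + ?B (t * (1 - u)) \<le> ?B t + ?d u"
      by (simp only:) (simp add: algebra_simps)
    show "mgf (qs_iter n) (t * u) \<le> ennreal (exp (?B (t * u)))" by (rule Suc)
  next
    show "(\<integral>\<^sup>+u. ennreal (exp (?d u)) \<partial>unif01) \<le> ennreal (exp 0)"
      using nn_integral_small_mgf[of t] nn_integral_large_mgf[of t]
      by (cases "\<bar>t\<bar> \<le> 1 / 2") auto
  qed measurable
  then show ?case by (simp add: qs_iter_simps)
qed

text \<open>The factor of \<open>s\<close> is positive except at \<open>u = 1/2\<close>, so
  dominated convergence along integers makes the integral arbitrarily small; monotonicity in
  \<open>s\<close> covers the reals in between.\<close>

lemma nn_integral_entropy_decay: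
  fixes c :: real
  shows "\<exists>t0>0. \<forall>s\<ge>t0. (\<integral>\<^sup>+u. ennreal (exp (- (s * (1 + (u * ln u + (1 - u) * ln (1 - u)) / ln 2)))) \<partial>unif01)
    \<le> ennreal (exp (- c))"
proof -
  interpret U: prob_space unif01 by (rule prob_space_unif01)
  define w :: "real \<Rightarrow> real" where "w = (\<lambda>u. 1 + (u * ln u + (1 - u) * ln (1 - u)) / ln 2)"
  have [measurable]: "w \<in> borel_measurable borel" unfolding w_def by measurable
  have w_pos: "AE u in unif01. 0 < w u"
  proof (rule AE_uniform_measureI)
    show "AE u in lborel. u \<in> {0<..<1} \<longrightarrow> 0 < w u"
      using AE_lborel_singleton[of "1 / 2 :: real"]
    proof eventually_elim
      case (elim u)
      show ?case
      proof
        assume "u \<in> {0<..<1}"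
        then have "- ln 2 < u * ln u + (1 - u) * ln (1 - u)" using elim by (intro entropy_gt) auto
        then have "- ln 2 / ln 2 < (u * ln u + (1 - u) * ln (1 - u)) / ln 2"
          by (intro divide_strict_right_mono) auto
        then show "0 < w u" by (simp add: w_def)
      qed
    qed
  qed simp
  have "(\<lambda>n. LINT u|unif01. exp (- (real n * w u))) \<longlonglongrightarrow> (LINT u|unif01. 0)"
  proof (rule integral_dominated_convergence)
    show "AE u in unif01. (\<lambda>n. exp (- (real n * w u))) \<longlonglongrightarrow> 0"
      using w_pos by eventually_elim real_asymp
    show "AE u in unif01. norm (exp (- (real n * w u))) \<le> 1" for n
      using w_pos by eventually_elim simp
    show "integrable unif01 (\<lambda>u. 1::real)" by simp
  qed measurable
  then have "(\<lambda>n. LINT u|unif01. exp (- (real n * w u))) \<longlonglongrightarrow> 0" by simp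
  then have "\<forall>\<^sub>F n in sequentially. (LINT u|unif01. exp (- (real n * w u))) < exp (- c)"
    by (rule order_tendstoD) simp
  then obtain N where N: "\<And>n. n \<ge> N \<Longrightarrow> (LINT u|unif01. exp (- (real n * w u))) < exp (- c)"
    by (auto simp: eventually_sequentially)
  show ?thesis
  proof (intro exI[of _ "real (Suc N)"] conjI allI impI)
    fix s assume s: "real (Suc N) \<le> s"
    have "(\<integral>\<^sup>+u. ennreal (exp (- (s * w u))) \<partial>unif01) \<le>
        (\<integral>\<^sup>+u. ennreal (exp (- (real (Suc N) * w u))) \<partial>unif01)"
      by (rule nn_integral_mono_AE, use w_pos in eventually_elim)
         (use s in \<open>auto intro!: ennreal_leI mult_right_mono\<close>)
    also have "\<dots> = ennreal (LINT u|unif01. exp (- (real (Suc N) * w u)))"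
    proof (rule nn_integral_eq_integral)
      have "AE u in unif01. norm (exp (- (real (Suc N) * w u))) \<le> 1"
        using w_pos by eventually_elim simp
      then show "integrable unif01 (\<lambda>u. exp (- (real (Suc N) * w u)))"
        by (rule U.integrable_const_bound) measurable
    qed auto
    also have "\<dots> \<le> ennreal (exp (- c))"
      using N[of "Suc N"] by (intro ennreal_leI) auto
    finally show "(\<integral>\<^sup>+u. ennreal (exp (- (s * (1 + (u * ln u + (1 - u) * ln (1 - u)) / ln 2)))) \<partial>unif01)
      \<le> ennreal (exp (- c))" by (simp add: w_def)
  qed simp
qed

text \<open>The coefficient \<open>a = 2 - 1/ln 2\<close> is the one for which the exponent
  \<open>a s ln s + b s\<close> reproduces itself exactly at the splitting point \<open>u = 1/2\<close>; the mass
  near that point is small enough to absorb the additive constant.\<close>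

lemma mgf_qs_iter_left:
  defines "a \<equiv> 2 - 1 / ln (2::real)"
  shows "\<exists>b c. \<forall>n s. 0 \<le> s \<longrightarrow> mgf (qs_iter n) (- s) \<le> ennreal (exp (a * (s * ln s) + b * s + c))"
proof -
  have a: "0 \<le> a" using ln_2_bounds by (simp add: a_def field_simps)
  \<comment> \<open>The induction step produces \<open>2 * a\<close>, one additive constant per
    subproblem. Beyond \<open>t0\<close> the integral is at most \<open>exp (- a)\<close> and
    removes one of them.\<close>
  obtain t0 where t0: "0 < t0" "\<And>s. s \<ge> t0 \<Longrightarrow>
      (\<integral>\<^sup>+u. ennreal (exp (- (s * (1 + (u * ln u + (1 - u) * ln (1 - u)) / ln 2)))) \<partial>unif01) \<le> ennreal (exp (- a))"
    using nn_integral_entropy_decay[of a] by auto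
  \<comment> \<open>Below \<open>t0\<close> the two-sided bound is used instead:
    \<open>64 * (exp s - 1 - s) <= 64 * s * exp t0 = b * s\<close>, while the constant
    \<open>a\<close> compensates \<open>a * s * ln s >= - a\<close>.\<close>
  define b where "b = 64 * exp t0"
  have "mgf (qs_iter n) (- s) \<le> ennreal (exp (a * (s * ln s) + b * s + a))" if "0 \<le> s" for n s
    using that
  proof (induction n arbitrary: s)
    case small: 0
    have "- 1 \<le> s * ln s"
      using mult_ln_ge[of s 1] small by (cases "s = 0") auto
    then have "a * (- 1) \<le> a * (s * ln s)" using a by (intro mult_left_mono) auto
    moreover have "0 \<le> b * s" using small by (simp add: b_def)
    ultimately have "0 \<le> a * (s * ln s) + b * s + a" by linarith
    then have "ennreal 1 \<le> ennreal (exp (a * (s * ln s) + b * s + a))"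
      by (intro ennreal_leI) simp
    then show ?case by (simp only: mgf_qs_iter_0 ennreal_1)
  next
    case (Suc n)
    interpret real_distribution "qs_iter n" by (rule real_distribution_qs_iter)
    show ?case
    proof (cases "s \<le> t0")
      case True
      have "exp s * (1 - s) \<le> exp s * exp (- s)"
        using exp_ge_add_one_self[of "- s"] by (intro mult_left_mono) auto
      then have "exp s - 1 - s \<le> s * exp s" using Suc.prems by (simp add: exp_minus algebra_simps)
      also have "\<dots> \<le> s * exp t0" using True Suc.prems by (intro mult_left_mono) auto
      finally have "64 * (exp s - 1 - s) \<le> 64 * (s * exp t0)" by (rule mult_left_mono) simp
      then have "64 * (exp s - 1 - s) \<le> b * s" by (simp add: b_def mult_ac)
      moreover have "- 1 \<le> s * ln s"
        using mult_ln_ge[of s 1] Suc.prems by (cases "s = 0") auto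
      then have "a * (- 1) \<le> a * (s * ln s)" using a by (intro mult_left_mono) auto
      ultimately have "64 * (exp \<bar>- s\<bar> - 1 - \<bar>- s\<bar>) \<le> a * (s * ln s) + b * s + a"
        using Suc.prems by simp
      then show ?thesis
        using mgf_qs_iter_le[of "Suc n" "- s"] by (meson ennreal_leI exp_le_cancel_iff order_trans)
    next
      case False
      then have s: "0 < s" using t0 by simp
      let ?B = "\<lambda>t. a * (- t * ln (- t)) + b * (- t) + a"
      let ?w = "\<lambda>u. 1 + (u * ln u + (1 - u) * ln (1 - u)) / ln 2"
      have "mgf (quicksort_map (qs_iter n)) (- s) \<le> ennreal (exp ((a * (s * ln s) + b * s + 2 * a) + - a))"
      proof (rule mgf_quicksort_map_le)
        fix u :: real assume u: "0 < u" "u < 1"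
        show "mgf (qs_iter n) (- s * u) \<le> ennreal (exp (?B (- s * u)))"
          using Suc.IH[of "s * u"] s u by simp
        have "ln (s * u) = ln s + ln u" "ln (s * (1 - u)) = ln s + ln (1 - u)"
          using s u by (simp_all add: ln_mult)
        then have "?B (- s * u) + ?B (- s * (1 - u)) =
            a * (s * ln s) + b * s + 2 * a + a * s * (u * ln u + (1 - u) * ln (1 - u))"
          by (simp only: minus_mult_left[symmetric] minus_minus) (simp add: algebra_simps)
        \<comment> \<open>The first share cancels the entropy in the toll; the second, together with
          \<open>- s\<close> from the toll's constant 1, is \<open>- (s * ?w u)\<close>.\<close>
        moreover have "a * s * (u * ln u + (1 - u) * ln (1 - u)) =
            s * (2 * (u * ln u + (1 - u) * ln (1 - u))) - s * ((u * ln u + (1 - u) * ln (1 - u)) / ln 2)"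
          by (simp add: a_def algebra_simps diff_divide_distrib add_divide_distrib)
        ultimately show "- s * quicksort_toll u + ?B (- s * u) + ?B (- s * (1 - u)) \<le>
            (a * (s * ln s) + b * s + 2 * a) + - (s * ?w u)"
          unfolding quicksort_toll_eq by (simp only: add.assoc) (simp add: algebra_simps)
      next
        show "(\<integral>\<^sup>+u. ennreal (exp (- (s * ?w u))) \<partial>unif01) \<le> ennreal (exp (- a))"
          using t0 False by simp
      qed measurable
      then show ?thesis by (simp add: qs_iter_simps algebra_simps)
    qed
  qed
  then show ?thesis by blast
qed

section \<open>Convergence of the iterates to the law, and passage of bounds to the limit\<close>

lemma norm_mult_diff_le_add:
  fixes a b c d :: complex
  assumes "norm b \<le> 1" "norm c \<le> 1"
  shows "norm (a * b - c * d) \<le> norm (a - c) + norm (b - d)"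
proof -
  have "norm (a * b - c * d) = norm ((a - c) * b + c * (b - d))" by (simp add: algebra_simps)
  also have "\<dots> \<le> norm (a - c) * norm b + norm c * norm (b - d)"
    by (metis norm_mult norm_triangle_ineq)
  also have "\<dots> \<le> norm (a - c) * 1 + 1 * norm (b - d)"
    using assms by (intro add_mono mult_left_mono mult_right_mono) auto
  finally show ?thesis by simp
qed

text \<open>The quadratic coefficient contracts because \<open>u^2 + (1 - u)^2\<close> has mean 2/3.
  The linear one is only reproduced, as \<open>u + (1 - u) = 1\<close>, so it has to be small from
  the start.\<close>

lemma char_quicksort_map_diff:
  assumes "real_distribution M" "real_distribution N"
    and bound: "\<And>t. norm (char M t - char N t) \<le> e * \<bar>t\<bar> + A * t\<^sup>2"
  shows "norm (char (quicksort_map M) t - char (quicksort_map N) t) \<le> e * \<bar>t\<bar> + (2 / 3 * A) * t\<^sup>2"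
proof -
  interpret M: real_distribution M by fact
  interpret N: real_distribution N by fact
  interpret U: prob_space unif01 by (rule prob_space_unif01)
  have int: "integrable unif01 (\<lambda>u. iexp (t * quicksort_toll u) * char K (t * u) * char K (t * (1 - u)))"
    if "real_distribution K" for K
  proof -
    interpret K: real_distribution K by fact
    show ?thesis
      by (rule U.integrable_const_bound[of _ 1])
         (auto simp: norm_mult intro!: mult_le_one K.cmod_char_le_1)
  qed
  let ?q = "\<lambda>u. e * \<bar>t\<bar> + A * t\<^sup>2 * (1 - 2 * u + 2 * u\<^sup>2)"
  have q: "integrable unif01 ?q" "(LINT u|unif01. ?q u) =
      (e * \<bar>t\<bar> * 1 + A * t\<^sup>2 * (1 - 1\<^sup>2 + 2 / 3 * 1 ^ 3)) - (e * \<bar>t\<bar> * 0 + A * t\<^sup>2 * (0 - 0\<^sup>2 + 2 / 3 * 0 ^ 3))"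
    by (intro integral_unif01_FTC[where F = "\<lambda>u. e * \<bar>t\<bar> * u + A * t\<^sup>2 * (u - u\<^sup>2 + 2 / 3 * u ^ 3)"];
      auto intro!: derivative_eq_intros continuous_intros simp: algebra_simps power2_eq_square)+
  have "norm (char (quicksort_map M) t - char (quicksort_map N) t) =
      norm (CLINT u|unif01. iexp (t * quicksort_toll u) * char M (t * u) * char M (t * (1 - u)) -
        iexp (t * quicksort_toll u) * char N (t * u) * char N (t * (1 - u)))"
    unfolding M.char_quicksort_map N.char_quicksort_map
    by (subst Bochner_Integration.integral_diff[OF int int]) (use assms in auto)
  also have "\<dots> \<le> (LINT u|unif01. norm (iexp (t * quicksort_toll u) * char M (t * u) * char M (t * (1 - u)) -
        iexp (t * quicksort_toll u) * char N (t * u) * char N (t * (1 - u))))"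
    by (rule integral_norm_bound)
  also have "\<dots> \<le> (LINT u|unif01. ?q u)"
  proof (rule integral_mono_AE)
    show "integrable unif01 (\<lambda>u. norm (iexp (t * quicksort_toll u) * char M (t * u) * char M (t * (1 - u)) -
        iexp (t * quicksort_toll u) * char N (t * u) * char N (t * (1 - u))))"
      by (intro integrable_norm Bochner_Integration.integrable_diff int assms)
    show "AE u in unif01. norm (iexp (t * quicksort_toll u) * char M (t * u) * char M (t * (1 - u)) -
        iexp (t * quicksort_toll u) * char N (t * u) * char N (t * (1 - u))) \<le> ?q u"
    proof (rule AE_mp[OF AE_unif01], rule AE_I2, rule impI)
      fix u :: real assume u: "0 < u \<and> u < 1"
      have "norm (iexp (t * quicksort_toll u) * char M (t * u) * char M (t * (1 - u)) -
        iexp (t * quicksort_toll u) * char N (t * u) * char N (t * (1 - u))) =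
        norm (iexp (t * quicksort_toll u) * (char M (t * u) * char M (t * (1 - u)) -
          char N (t * u) * char N (t * (1 - u))))"
        by (simp add: algebra_simps)
      also have "\<dots> = norm (char M (t * u) * char M (t * (1 - u)) - char N (t * u) * char N (t * (1 - u)))"
        by (simp add: norm_mult)
      also have "\<dots> \<le> norm (char M (t * u) - char N (t * u)) + norm (char M (t * (1 - u)) - char N (t * (1 - u)))"
        by (intro norm_mult_diff_le_add M.cmod_char_le_1 N.cmod_char_le_1)
      also have "\<dots> \<le> (e * \<bar>t * u\<bar> + A * (t * u)\<^sup>2) + (e * \<bar>t * (1 - u)\<bar> + A * (t * (1 - u))\<^sup>2)"
        by (intro add_mono bound)
      also have "\<bar>t * u\<bar> = \<bar>t\<bar> * u" using u by (simp add: abs_mult)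
      also have "\<bar>t * (1 - u)\<bar> = \<bar>t\<bar> * (1 - u)" using u by (simp add: abs_mult)
      also have "(e * (\<bar>t\<bar> * u) + A * (t * u)\<^sup>2) + (e * (\<bar>t\<bar> * (1 - u)) + A * (t * (1 - u))\<^sup>2) = ?q u"
        by (simp add: power2_eq_square algebra_simps)
      finally show "norm (iexp (t * quicksort_toll u) * char M (t * u) * char M (t * (1 - u)) -
        iexp (t * quicksort_toll u) * char N (t * u) * char N (t * (1 - u))) \<le> ?q u" .
    qed
  qed (use q in auto)
  also have "\<dots> = e * \<bar>t\<bar> + (2 / 3 * A) * t\<^sup>2" using q by simp
  finally show ?thesis .
qed

text \<open>With only a first moment, \<open>1 - char M t\<close> is \<open>o(t)\<close> and need
  not be \<open>O(t^2)\<close>: near 0 the linear coefficient is made small by dominated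
  convergence, and away from 0 the trivial bound 2 is absorbed by a large \<open>A\<close>.\<close>

lemma (in real_distribution) char_centered_small:
  assumes int1: "integrable M (\<lambda>z. z)" and mean0: "(LINT z|M. z) = 0" and "0 < e"
  shows "\<exists>A\<ge>0. \<forall>t. norm (1 - char M t) \<le> e * \<bar>t\<bar> + A * t\<^sup>2"
proof -
  let ?m = "\<lambda>t x. min (4 * \<bar>x\<bar>) (t * x\<^sup>2) :: real"
  have "(\<lambda>n. LINT x|M. ?m (1 / real (Suc n)) x) \<longlonglongrightarrow> (LINT x|M. 0)"
  proof (rule integral_dominated_convergence)
    show "AE x in M. (\<lambda>n. ?m (1 / real (Suc n)) x) \<longlonglongrightarrow> 0"
    proof (rule AE_I2)
      fix x
      have "(\<lambda>n. 1 / real (Suc n) * x\<^sup>2) \<longlonglongrightarrow> 0" by real_asymp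
      from tendsto_min[OF tendsto_const[of "4 * \<bar>x\<bar>"] this]
      show "(\<lambda>n. ?m (1 / real (Suc n)) x) \<longlonglongrightarrow> 0" by simp
    qed
    show "AE x in M. norm (?m (1 / real (Suc n)) x) \<le> 4 * \<bar>x\<bar>" for n by (rule AE_I2) simp
    show "integrable M (\<lambda>x. 4 * \<bar>x\<bar>)" using int1 by simp
  qed measurable
  then have "(\<lambda>n. LINT x|M. ?m (1 / real (Suc n)) x) \<longlonglongrightarrow> 0"
    unfolding Bochner_Integration.integral_zero .
  moreover have "0 < 2 * e" using \<open>0 < e\<close> by simp
  ultimately have "\<forall>\<^sub>F n in sequentially. (LINT x|M. ?m (1 / real (Suc n)) x) < 2 * e"
    by (rule order_tendstoD(2))
  then obtain n where n: "(LINT x|M. ?m (1 / real (Suc n)) x) < 2 * e"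
    by (auto simp: eventually_sequentially)
  define d where "d = 1 / real (Suc n)"
  have d: "0 < d" by (simp add: d_def)
  have int: "integrable M (?m t)" if "0 \<le> t" for t
  proof (rule Bochner_Integration.integrable_bound)
    show "integrable M (\<lambda>x. 4 * \<bar>x\<bar>)" using int1 by simp
    have "0 \<le> ?m t x" for x using that by (intro min.boundedI mult_nonneg_nonneg) auto
    then show "AE x in M. norm (?m t x) \<le> norm (4 * \<bar>x\<bar>)"
      by (intro AE_I2) (metis real_norm_def abs_of_nonneg min.cobounded1 abs_ge_self order_trans)
  qed measurable
  have "norm (1 - char M t) \<le> e * \<bar>t\<bar> + (2 / d\<^sup>2) * t\<^sup>2" for t
  proof (cases "\<bar>t\<bar> \<le> d")
    case True
    have "norm (char M t - 1) \<le> \<bar>t\<bar> / 2 * (LINT x|M. ?m \<bar>t\<bar> x)"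
    proof -
      have "integrable M (\<lambda>x. x ^ k)" if "k \<le> 1" for k :: nat
      proof -
        have "k = 0 \<or> k = 1" using that by linarith
        then show ?thesis using int1 by (elim disjE) (simp_all only: power_0 power_one_right, simp)
      qed
      then show ?thesis
        using char_approx2[of 1 t] prob_space by (simp add: power2_eq_square mean0)
    qed
    also have "\<dots> \<le> \<bar>t\<bar> / 2 * (2 * e)"
    proof (rule mult_left_mono)
      have "(LINT x|M. ?m \<bar>t\<bar> x) \<le> (LINT x|M. ?m d x)"
        using True d by (intro integral_mono int min.mono mult_right_mono) auto
      with n show "(LINT x|M. ?m \<bar>t\<bar> x) \<le> 2 * e" by (simp add: d_def)
    qed simp
    finally have "norm (1 - char M t) \<le> e * \<bar>t\<bar>"
      by (simp add: norm_minus_commute mult.commute)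
    moreover have "0 \<le> (2 / d\<^sup>2) * t\<^sup>2" by simp
    ultimately show ?thesis by linarith
  next
    case False
    have "norm (1 - char M t) \<le> 2"
      using norm_triangle_ineq4[of 1 "char M t"] cmod_char_le_1[of t] by simp
    moreover have "d\<^sup>2 \<le> \<bar>t\<bar>\<^sup>2" using False d by (intro power_mono) auto
    then have "1 \<le> t\<^sup>2 / d\<^sup>2" using d by simp
    ultimately show ?thesis using \<open>0 < e\<close> by (simp add: field_simps add_increasing)
  qed
  then show ?thesis using d by (intro exI[of _ "2 / d\<^sup>2"]) auto
qed

lemma char_qs_iter_tendsto:
  assumes "quicksort_law M"
  shows "(\<lambda>n. char (qs_iter n) t) \<longlonglongrightarrow> char M t"
proof -
  interpret real_distribution M using assms by (simp add: quicksort_law_def)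
  have M: "integrable M (\<lambda>z. z)" "(LINT z|M. z) = 0" "quicksort_map M = M"
    using assms by (simp_all add: quicksort_law_def)
  show ?thesis
  proof (rule LIMSEQ_I)
    fix r :: real assume r: "0 < r"
    \<comment> \<open>The linear error never shrinks under iteration, so it is fixed below
      \<open>r / 2\<close> at this \<open>t\<close> before \<open>n\<close> is sent to
      infinity.\<close>
    define e where "e = r / (2 * (\<bar>t\<bar> + 1))"
    have e: "0 < e" using r by (simp add: e_def add_nonneg_pos)
    have et: "e * \<bar>t\<bar> \<le> r / 2" using r by (simp add: e_def field_simps add_nonneg_pos)
    obtain A where A: "0 \<le> A" "\<And>t. norm (1 - char M t) \<le> e * \<bar>t\<bar> + A * t\<^sup>2"
      using char_centered_small[OF M(1,2) e] by auto
    have bound: "norm (char (qs_iter n) t - char M t) \<le> e * \<bar>t\<bar> + ((2 / 3) ^ n * A) * t\<^sup>2" for n t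
    proof (induction n arbitrary: t)
      case 0
      have "char (qs_iter 0) t = 1"
        by (simp add: char_def qs_iter_simps integral_return)
      then show ?case using A(2)[of t] by simp
    next
      case (Suc n)
      have "norm (char (quicksort_map (qs_iter n)) t - char (quicksort_map M) t) \<le>
          e * \<bar>t\<bar> + (2 / 3 * ((2 / 3) ^ n * A)) * t\<^sup>2"
        by (intro char_quicksort_map_diff real_distribution_qs_iter Suc) unfold_locales
      then show ?case by (simp add: qs_iter_simps M mult_ac)
    qed
    have "(\<lambda>n. (2 / 3) ^ n * A * t\<^sup>2) \<longlonglongrightarrow> 0 * A * t\<^sup>2"
      by (intro tendsto_intros LIMSEQ_power_zero) auto
    then have "\<forall>\<^sub>F n in sequentially. (2 / 3) ^ n * A * t\<^sup>2 < r / 2"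
      using r by (intro order_tendstoD) auto
    then obtain N where N: "\<And>n. n \<ge> N \<Longrightarrow> (2 / 3) ^ n * A * t\<^sup>2 < r / 2"
      by (auto simp: eventually_sequentially)
    show "\<exists>N. \<forall>n\<ge>N. norm (char (qs_iter n) t - char M t) < r"
    proof (intro exI[of _ N] allI impI)
      fix n assume "N \<le> n"
      then show "norm (char (qs_iter n) t - char M t) < r"
        using N[of n] bound[of n t] et by linarith
    qed
  qed
qed

text \<open>Weak convergence tests only bounded continuous functions, so the exponential is
  truncated at \<open>N\<close>, the bound is passed to the limit, and monotone convergence in
  \<open>N\<close> removes the truncation.\<close>

lemma mgf_quicksort_law_le:
  assumes law: "quicksort_law M" and bound: "\<And>n. mgf (qs_iter n) t \<le> ennreal B" and "0 \<le> B"
  shows "mgf M t \<le> ennreal B"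
proof -
  interpret real_distribution M using law by (simp add: quicksort_law_def)
  have wc: "weak_conv_m qs_iter M"
    by (intro levy_continuity real_distribution_qs_iter char_qs_iter_tendsto law) unfold_locales
  let ?f = "\<lambda>(N::nat) z. min (exp (t * z)) (real N)"
  have int_le: "(\<integral>\<^sup>+z. ennreal (?f N z) \<partial>M) \<le> ennreal B" for N
  proof -
    have int: "integrable K (?f N)" if "real_distribution K" for K
    proof -
      interpret K: real_distribution K by fact
      show ?thesis by (rule K.integrable_const_bound[of _ "real N"]) auto
    qed
    have "(\<lambda>n. integral\<^sup>L (qs_iter n) (?f N)) \<longlonglongrightarrow> integral\<^sup>L M (?f N)"
      by (rule weak_conv_imp_integral_bdd_continuous_conv[OF real_distribution_qs_iter _ wc, where B = "real N"])
         (auto intro!: continuous_intros, unfold_locales)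
    moreover have "integral\<^sup>L (qs_iter n) (?f N) \<le> B" for n
    proof -
      have "ennreal (integral\<^sup>L (qs_iter n) (?f N)) = (\<integral>\<^sup>+z. ennreal (?f N z) \<partial>qs_iter n)"
        by (rule nn_integral_eq_integral[symmetric]) (auto intro!: int real_distribution_qs_iter)
      also have "\<dots> \<le> mgf (qs_iter n) t"
        unfolding mgf_def by (intro nn_integral_mono ennreal_leI) auto
      also have "\<dots> \<le> ennreal B" by (rule bound)
      finally show ?thesis using \<open>0 \<le> B\<close> by (simp add: ennreal_le_iff)
    qed
    ultimately have "integral\<^sup>L M (?f N) \<le> B" by (auto intro: LIMSEQ_le_const2)
    moreover have "(\<integral>\<^sup>+z. ennreal (?f N z) \<partial>M) = ennreal (integral\<^sup>L M (?f N))"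
      by (rule nn_integral_eq_integral) (auto intro!: int, unfold_locales)
    ultimately show ?thesis by (simp add: ennreal_leI)
  qed
  have "mgf M t = (\<integral>\<^sup>+z. (SUP N. ennreal (?f N z)) \<partial>M)"
    unfolding mgf_def
  proof (rule nn_integral_cong)
    fix z
    show "ennreal (exp (t * z)) = (SUP N. ennreal (?f N z))"
    proof (rule antisym)
      have "?f (nat \<lceil>exp (t * z)\<rceil>) z = exp (t * z)"
        by (simp add: min_def of_nat_ceiling)
      then show "ennreal (exp (t * z)) \<le> (SUP N. ennreal (?f N z))"
        by (metis SUP_upper UNIV_I)
      show "(SUP N. ennreal (?f N z)) \<le> ennreal (exp (t * z))"
        by (intro SUP_least ennreal_leI) auto
    qed
  qed
  also have "\<dots> = (SUP N. \<integral>\<^sup>+z. ennreal (?f N z) \<partial>M)"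
    by (rule nn_integral_monotone_convergence_SUP) (auto simp: incseq_def le_fun_def intro!: ennreal_leI min.mono)
  also have "\<dots> \<le> ennreal B" by (intro SUP_least int_le)
  finally show ?thesis .
qed

section \<open>Upper bounds for both tails by Chernoff's inequality\<close>

lemma chernoff:
  assumes "real_distribution M" and "mgf M t \<le> ennreal B" "0 \<le> B"
  shows "measure M {z. y \<le> t * z} \<le> exp (- y) * B"
proof -
  interpret real_distribution M by fact
  have "emeasure M {z. y \<le> t * z} = (\<integral>\<^sup>+z. indicator {z. y \<le> t * z} z \<partial>M)"
    by (simp add: nn_integral_indicator)
  also have "\<dots> \<le> (\<integral>\<^sup>+z. ennreal (exp (- y)) * ennreal (exp (t * z)) \<partial>M)"
    by (rule nn_integral_mono)
       (auto simp: indicator_def ennreal_mult[symmetric] exp_add[symmetric] simp flip: ennreal_1 intro!: ennreal_leI)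
  also have "\<dots> = ennreal (exp (- y)) * mgf M t"
    unfolding mgf_def by (rule nn_integral_cmult) measurable
  also have "\<dots> \<le> ennreal (exp (- y)) * ennreal B"
    using assms by (intro mult_left_mono) auto
  finally show ?thesis
    using \<open>0 \<le> B\<close> by (simp add: emeasure_eq_measure ennreal_mult[symmetric] ennreal_le_iff)
qed

text \<open>The argument \<open>t = ln x\<close> makes the dominant term \<open>64 * exp t\<close>
  linear in \<open>x\<close> while \<open>t * x\<close> is the wanted
  \<open>x * ln x\<close>.\<close>

lemma upper_tail_chernoff:
  assumes "quicksort_law M" "1 \<le> x"
  shows "upper_tail M x \<le> exp (- x * ln x + 64 * x)"
proof -
  interpret real_distribution M using assms by (simp add: quicksort_law_def)
  have x: "0 \<le> ln x" using assms by simp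
  have "mgf M (ln x) \<le> ennreal (exp (64 * (exp \<bar>ln x\<bar> - 1 - \<bar>ln x\<bar>)))"
    by (rule mgf_quicksort_law_le[OF assms(1) mgf_qs_iter_le]) simp
  also have "\<dots> \<le> ennreal (exp (64 * x))"
  proof (intro ennreal_leI, subst exp_le_cancel_iff, rule mult_left_mono)
    have "exp \<bar>ln x\<bar> = x" using x assms(2) by (simp only: abs_of_nonneg exp_ln)
    then show "exp \<bar>ln x\<bar> - 1 - \<bar>ln x\<bar> \<le> x" by linarith
  qed simp
  finally have "mgf M (ln x) \<le> ennreal (exp (64 * x))" .
  from chernoff[OF real_distribution_axioms this, of "ln x * x"]
  have "measure M {z. ln x * x \<le> ln x * z} \<le> exp (- (ln x * x)) * exp (64 * x)" by simp
  also have "\<dots> = exp (- x * ln x + 64 * x)" by (simp add: exp_add[symmetric] algebra_simps)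
  finally have "measure M {z. ln x * x \<le> ln x * z} \<le> exp (- x * ln x + 64 * x)" .
  moreover have "upper_tail M x = measure M {x<..}"
    unfolding upper_tail_def cdf_def using prob_compl[of "{..x}"]
    by (simp add: Compl_eq_Diff_UNIV[symmetric] Compl_atMost)
  moreover have "measure M {x<..} \<le> measure M {z. ln x * x \<le> ln x * z}"
    using x by (intro finite_measure_mono) (auto intro!: mult_left_mono)
  ultimately show ?thesis by simp
qed

text \<open>The exponent \<open>a s ln s + (b - x) s\<close> is minimal at \<open>s = exp ((x - b)/a - 1)\<close>.\<close>

lemma lower_tail_chernoff:
  assumes "quicksort_law M"
  shows "\<exists>C. \<forall>x\<ge>C. lower_tail M x \<le> exp (- exp (quicksort_gamma * x - C))"
proof -
  interpret real_distribution M using assms by (simp add: quicksort_law_def)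
  define a where "a = 2 - 1 / ln (2::real)"
  have a: "0 < a" using ln_2_bounds by (simp add: a_def field_simps)
  obtain b c where bc: "\<And>n s. 0 \<le> s \<Longrightarrow> mgf (qs_iter n) (- s) \<le> ennreal (exp (a * (s * ln s) + b * s + c))"
    using mgf_qs_iter_left unfolding a_def by blast
  have g: "quicksort_gamma = 1 / a" by (simp add: quicksort_gamma_def a_def inverse_eq_divide)
  have *: "lower_tail M x \<le> exp (c - a * exp ((x - b) / a - 1))" for x
  proof -
    define s where "s = exp ((x - b) / a - 1)"
    have "mgf M (- s) \<le> ennreal (exp (a * (s * ln s) + b * s + c))"
      by (rule mgf_quicksort_law_le[OF assms bc]) (auto simp: s_def)
    from chernoff[OF real_distribution_axioms this, of "s * x"]
    have "measure M {z. s * x \<le> - s * z} \<le> exp (- (s * x)) * exp (a * (s * ln s) + b * s + c)"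
      by simp
    also have "\<dots> = exp (- (s * x) + a * (s * ln s) + b * s + c)"
      by (simp add: exp_add[symmetric])
    also have "- (s * x) + a * (s * ln s) + b * s + c = c - a * s"
      using a by (simp add: s_def field_simps)
    finally have "measure M {z. s * x \<le> - s * z} \<le> exp (c - a * s)" .
    moreover have "{z. s * x \<le> - s * z} = {..- x}"
    proof -
      have "s * x \<le> - s * z \<longleftrightarrow> z \<le> - x" for z
        using mult_le_cancel_left_pos[of s x "- z"] by (auto simp: s_def)
      then show ?thesis by auto
    qed
    ultimately show ?thesis by (simp add: lower_tail_def cdf_def s_def)
  qed
  have "\<forall>\<^sub>F x in at_top. c - a * exp ((x - b) / a - 1) \<le> - exp (1 / a * x - (b / a + 1 - ln (a / 2)))"
  proof -
    \<comment> \<open>Half of the double-exponential term absorbs \<open>c\<close>; the other half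
      is rewritten as a shift by \<open>ln (a / 2)\<close>.\<close>
    have eq: "exp (1 / a * x - (b / a + 1 - ln (a / 2))) = a / 2 * exp ((x - b) / a - 1)" for x
    proof -
      have "1 / a * x - (b / a + 1 - ln (a / 2)) = ln (a / 2) + ((x - b) / a - 1)"
        by (simp add: diff_divide_distrib)
      then show ?thesis using a by (simp only: exp_add exp_ln)
    qed
    have "\<forall>\<^sub>F x in at_top. c \<le> a / 2 * exp ((x - b) / a - 1)"
      using a by real_asymp
    then show ?thesis
    proof eventually_elim
      case (elim x)
      then show ?case using eq[of x] by linarith
    qed
  qed
  then obtain X where X: "\<And>x. x \<ge> X \<Longrightarrow> c - a * exp ((x - b) / a - 1) \<le> - exp (1 / a * x - (b / a + 1 - ln (a / 2)))"
    by (auto simp: eventually_at_top_linorder)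
  \<comment> \<open>One constant serves both as threshold for \<open>x\<close> and as shift in the
    exponent.\<close>
  define C where "C = max X (b / a + 1 - ln (a / 2))"
  have "lower_tail M x \<le> exp (- exp (quicksort_gamma * x - C))" if "x \<ge> C" for x
  proof -
    have "lower_tail M x \<le> exp (c - a * exp ((x - b) / a - 1))" by (rule *)
    also have "\<dots> \<le> exp (- exp (1 / a * x - (b / a + 1 - ln (a / 2))))"
      using X[of x] that by (simp add: C_def)
    also have "\<dots> \<le> exp (- exp (quicksort_gamma * x - C))"
      by (simp add: g C_def)
    finally show ?thesis .
  qed
  then show ?thesis by blast
qed

section \<open>Lower bounds for the tails\<close>

lemma emeasure_unif01_interval:
  fixes a b :: real
  assumes "0 \<le> a" "a \<le> b" "b \<le> 1"
  shows "emeasure unif01 {a<..<b} = ennreal (b - a)"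
proof -
  have "{0<..<1} \<inter> {a<..<b} = {a<..<b}" using assms by auto
  then show ?thesis using assms by (simp add: divide_ennreal_def)
qed

text \<open>Restricts the fixed-point equation to a product event, whose probability factors by
  independence. Both tail recursions are instances.\<close>

lemma quicksort_law_measure_ge:
  assumes law: "quicksort_law M" and ab: "0 \<le> a" "a \<le> b" "b \<le> 1"
    and [measurable]: "A \<in> sets borel" "B \<in> sets borel" "C \<in> sets borel"
    and imp: "\<And>u z z'. a < u \<Longrightarrow> u < b \<Longrightarrow> z \<in> B \<Longrightarrow> z' \<in> C \<Longrightarrow> qs_comb u z z' \<in> A"
  shows "(b - a) * measure M B * measure M C \<le> measure M A"
proof -
  interpret real_distribution M using law by (simp add: quicksort_law_def)
  have M: "quicksort_map M = M" using law by (simp add: quicksort_law_def)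
  have "ennreal ((b - a) * measure M B * measure M C) = emeasure unif01 {a<..<b} * emeasure M B * emeasure M C"
    unfolding emeasure_unif01_interval[OF ab] emeasure_eq_measure
    using ab by (simp add: ennreal_mult)
  also have "\<dots> = (\<integral>\<^sup>+u. \<integral>\<^sup>+z. \<integral>\<^sup>+z'. indicator {a<..<b} u * indicator B z * indicator C z' \<partial>M \<partial>M \<partial>unif01)"
    by (simp add: nn_integral_cmult nn_integral_multc)
  also have "\<dots> \<le> (\<integral>\<^sup>+u. \<integral>\<^sup>+z. \<integral>\<^sup>+z'. indicator A (qs_comb u z z') \<partial>M \<partial>M \<partial>unif01)"
    by (intro nn_integral_mono) (auto simp: indicator_def imp)
  also have "\<dots> = (\<integral>\<^sup>+z. indicator A z \<partial>quicksort_map M)"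
    by (rule nn_integral_quicksort_map[symmetric]) measurable
  also have "\<dots> = emeasure M A" unfolding M by (simp add: nn_integral_indicator)
  finally show ?thesis by (simp add: emeasure_eq_measure ennreal_le_iff)
qed

text \<open>An almost surely positive variable cannot have mean zero. Applied to \<open>z\<close>
  and to \<open>- z\<close>, this supplies the starting mass of both recursions.\<close>

lemma (in real_distribution) centered_measure_nonpos:
  fixes f :: "real \<Rightarrow> real"
  assumes int: "integrable M f" and mean: "(LINT z|M. f z) = 0"
  shows "0 < measure M {z. f z \<le> 0}"
proof (rule ccontr)
  assume "\<not> ?thesis"
  then have "measure M {z. f z \<le> 0} = 0" by (simp add: zero_less_measure_iff)
  have [measurable]: "f \<in> borel_measurable borel"
    using borel_measurable_integrable[OF int] by (simp cong: measurable_cong_sets)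
  have "emeasure M {z. f z \<le> 0} = 0"
    using \<open>measure M {z. f z \<le> 0} = 0\<close> by (simp add: emeasure_eq_measure)
  then have AE: "AE z in M. \<not> f z \<le> 0"
    by (intro AE_I[of _ _ "{z. f z \<le> 0}"]) (auto simp del: events_eq_borel, measurable)
  then have "AE z in M. 0 \<le> f z" by eventually_elim simp
  then have "AE z in M. f z = 0"
    using integral_nonneg_eq_0_iff_AE[OF int] mean by blast
  with AE have "AE z in M. False" by eventually_elim simp
  then show False by simp
qed

lemma quicksort_law_mass_0:
  assumes "quicksort_law M"
  shows "0 < measure M {..0}" "0 < measure M {0..}"
proof -
  interpret real_distribution M using assms by (simp add: quicksort_law_def)
  have int: "integrable M (\<lambda>z. z)" and mean: "(LINT z|M. z) = 0"
    using assms by (simp_all add: quicksort_law_def)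
  have "{z::real. z \<le> 0} = {..0}" "{z::real. - z \<le> 0} = {0..}" by auto
  then show "0 < measure M {..0}" "0 < measure M {0..}"
    using centered_measure_nonpos[OF int mean]
      centered_measure_nonpos[of "\<lambda>z. - z", OF Bochner_Integration.integrable_minus[OF int]]
    by (simp_all only: Bochner_Integration.integral_minus mean minus_zero simp_thms)
qed

text \<open>The event is \<open>|u - 1/2| < d\<close> with \<open>d = 1 / (4 * 2 ^ n)\<close> and
  both subproblems below \<open>- x n\<close>. The toll exceeds its minimum by at most
  \<open>8 d^2 = 1/2 * 1/4 ^ n\<close>, with total 2/3 over all \<open>n\<close>. The cost
  \<open>2 d\<close> is only a power of 2: with \<open>q = measure M {..0} / 4\<close>, the quantity
  \<open>2 d * (2 ^ (n + 2) * q ^ 2 ^ n)^2\<close> is exactly the bound for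
  \<open>n + 1\<close>.\<close>

lemma lower_tail_doubling:
  assumes "quicksort_law M"
  defines "x \<equiv> \<lambda>n::nat. real n * (2 * ln 2 - 1) - 2 / 3 * (1 - 1 / 4 ^ n)"
  shows "2 ^ (n + 2) * (measure M {..0} / 4) ^ 2 ^ n \<le> measure M {..- x n}"
proof (induction n)
  case 0
  then show ?case by (simp add: x_def)
next
  case (Suc n)
  define d where "d = 1 / (4 * 2 ^ n :: real)"
  have d: "0 < d" "d \<le> 1 / 4" by (simp_all add: d_def field_simps)
  let ?p = "measure M {..- x n}" and ?q = "measure M {..0} / 4"
  have "((1 / 2 + d) - (1 / 2 - d)) * ?p * ?p \<le> measure M {..- x (Suc n)}"
  proof (rule quicksort_law_measure_ge[OF assms(1)])
    fix u z z' assume u: "1 / 2 - d < u" "u < 1 / 2 + d" and z: "z \<in> {..- x n}" "z' \<in> {..- x n}"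
    have "u * z \<le> u * (- x n)" "(1 - u) * z' \<le> (1 - u) * (- x n)"
      using u z d by (intro mult_left_mono; auto)+
    moreover have "quicksort_toll u \<le> 1 - 2 * ln 2 + 8 * (u - 1 / 2)\<^sup>2"
      using u d by (intro quicksort_toll_upper_quadratic) auto
    moreover have "\<bar>u - 1 / 2\<bar> \<le> \<bar>d\<bar>" using u by auto
    then have "(u - 1 / 2)\<^sup>2 \<le> d\<^sup>2" by (simp add: abs_le_square_iff)
    moreover have "8 * d\<^sup>2 = 1 / 2 * (1 / 4 ^ n)"
      by (simp add: d_def power2_eq_square power_mult_distrib[symmetric])
    moreover have "x (Suc n) = x n + (2 * ln 2 - 1) - 1 / 2 * (1 / 4 ^ n)"
      by (simp add: x_def algebra_simps)
    ultimately show "qs_comb u z z' \<in> {..- x (Suc n)}"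
      by (simp add: qs_comb_def algebra_simps)
  qed (use d in auto)
  moreover have "(2 ^ (n + 2) * ?q ^ 2 ^ n) * (2 ^ (n + 2) * ?q ^ 2 ^ n) \<le> ?p * ?p"
    using Suc by (intro mult_mono) auto
  then have "2 * d * ((2 ^ (n + 2) * ?q ^ 2 ^ n) * (2 ^ (n + 2) * ?q ^ 2 ^ n)) \<le> 2 * d * (?p * ?p)"
    using d by (intro mult_left_mono) auto
  moreover have "2 * d * ((2 ^ (n + 2) * ?q ^ 2 ^ n) * (2 ^ (n + 2) * ?q ^ 2 ^ n)) =
      2 ^ (Suc n + 2) * ?q ^ 2 ^ Suc n"
  proof -
    have "?q ^ 2 ^ Suc n = ?q ^ 2 ^ n * ?q ^ 2 ^ n" by (metis mult_2 power_Suc power_add)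
    moreover have "2 * d * (2 ^ (n + 2) * 2 ^ (n + 2)) = 2 ^ (Suc n + 2)" by (simp add: d_def)
    moreover have "a * ((b * c) * (b * c)) = (a * (b * b)) * (c * c)" for a b c :: real by simp
    ultimately show ?thesis by metis
  qed
  moreover have "((1 / 2 + d) - (1 / 2 - d)) * ?p * ?p = 2 * d * (?p * ?p)" by simp
  ultimately show ?case by linarith
qed

lemma lower_tail_lower_bound:
  assumes "quicksort_law M"
  shows "\<exists>C. \<forall>x\<ge>0. exp (- exp (quicksort_gamma * x + C)) \<le> lower_tail M x"
proof -
  interpret real_distribution M using assms by (simp add: quicksort_law_def)
  define al where "al = 2 * ln (2::real) - 1"
  have al: "0 < al" using ln_2_bounds by (simp add: al_def)
  define q where "q = measure M {..0} / 4"
  have q: "0 < q" "q < 1"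
    using quicksort_law_mass_0[OF assms] prob_le_1[of "{..0}"] unfolding q_def by linarith+
  have "2 - 1 / ln 2 = al / ln (2::real)" by (simp add: al_def diff_divide_distrib)
  then have gam: "quicksort_gamma = ln 2 / al" by (simp add: quicksort_gamma_def)
  \<comment> \<open>\<open>ln (- ln q)\<close> moves the factor \<open>- ln q\<close> inside the
    double exponential; the other two terms pay for the extra 1 below and for rounding up.\<close>
  define C where "C = ln (- ln q) + quicksort_gamma + ln 2"
  have "exp (- exp (quicksort_gamma * x + C)) \<le> lower_tail M x" if x: "0 \<le> x" for x
  proof -
    \<comment> \<open>The 1 added to \<open>x\<close> covers the accumulated loss of at most
      2/3.\<close>
    define n where "n = nat \<lceil>(x + 1) / al\<rceil>"
    have n: "(x + 1) / al \<le> real n" "real n \<le> (x + 1) / al + 1"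
      using x al by (simp_all add: n_def of_nat_nat)
    define xn where "xn = real n * (2 * ln 2 - 1) - 2 / 3 * (1 - 1 / 4 ^ n :: real)"
    have "x + 1 \<le> real n * al" using n(1) al by (simp add: field_simps)
    moreover have "2 / 3 * (1 - 1 / 4 ^ n) \<le> (1::real)" by (simp add: field_simps)
    ultimately have "x \<le> xn" unfolding xn_def al_def by linarith
    have "(2::real) ^ n = exp (real n * ln 2)" by (simp add: exp_of_nat_mult)
    also have "\<dots> \<le> exp (((x + 1) / al + 1) * ln 2)" using n(2) by simp
    also have "((x + 1) / al + 1) * ln 2 = quicksort_gamma * x + quicksort_gamma + ln 2"
      using al by (simp add: gam field_simps)
    finally have "- ln q * 2 ^ n \<le> - ln q * exp (quicksort_gamma * x + quicksort_gamma + ln 2)"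
      using q by (intro mult_left_mono) auto
    also have "\<dots> = exp (ln (- ln q)) * exp (quicksort_gamma * x + quicksort_gamma + ln 2)"
      using q by (subst exp_ln) auto
    also have "\<dots> = exp (quicksort_gamma * x + C)"
      by (simp add: C_def exp_add[symmetric] algebra_simps)
    finally have "exp (- exp (quicksort_gamma * x + C)) \<le> exp (2 ^ n * ln q)"
      by (simp add: mult.commute)
    also have "\<dots> = q ^ 2 ^ n" using q exp_of_nat_mult[of "2 ^ n" "ln q"] by simp
    also have "\<dots> \<le> 2 ^ (n + 2) * q ^ 2 ^ n"
    proof -
      have "(1::real) \<le> 2 ^ (n + 2)" by (rule one_le_power) simp
      then have "1 * q ^ 2 ^ n \<le> 2 ^ (n + 2) * q ^ 2 ^ n" using q by (intro mult_right_mono) auto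
      then show ?thesis by simp
    qed
    also have "\<dots> \<le> measure M {..- xn}"
      unfolding q_def xn_def by (rule lower_tail_doubling[OF assms])
    also have "\<dots> \<le> measure M {..- x}" using \<open>x \<le> xn\<close> by (intro finite_measure_mono) auto
    finally show ?thesis by (simp add: lower_tail_def cdf_def)
  qed
  then show ?thesis by blast
qed

text \<open>With \<open>u\<close> in \<open>(d/2, d)\<close>, \<open>z >= 0\<close> and
  \<open>z' >= y\<close>, the loss against \<open>y + 1\<close> is at most
  \<open>u * y + 2 u + 2 u ln (1/u)\<close>. The lower end \<open>d/2\<close> controls the
  logarithm, and bounding \<open>y\<close> by a fixed \<open>x\<close> lets the same
  \<open>d\<close> and \<open>e\<close> serve every step.\<close>

lemma upper_tail_step:
  assumes "quicksort_law M" "0 < d" "d < 1" "0 \<le> y" "y \<le> x" "d * (x + 2 + 2 * ln (2 / d)) \<le> e"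
  shows "d / 2 * measure M {0..} * measure M {y..} \<le> measure M {y + 1 - e..}"
proof -
  have "(d - d / 2) * measure M {0..} * measure M {y..} \<le> measure M {y + 1 - e..}"
  proof (rule quicksort_law_measure_ge[OF assms(1)])
    fix u z z' :: real assume u: "d / 2 < u" "u < d" and z: "z \<in> {0..}" "z' \<in> {y..}"
    have u1: "0 < u" "u < 1" using u assms by auto
    have "0 \<le> u * z" using u1 z by simp
    moreover have "(1 - u) * y \<le> (1 - u) * z'" using u1 z by (intro mult_left_mono) auto
    moreover have "u * y \<le> d * x" using u u1 assms by (intro mult_mono) auto
    moreover have "u * ln (1 / u) \<le> d * ln (2 / d)"
      using u u1 assms by (intro mult_mono ln_mono) (auto simp: field_simps)
    ultimately show "qs_comb u z z' \<in> {y + 1 - e..}"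
      using quicksort_toll_lower_small[OF u1] u assms(6)
      by (simp add: qs_comb_def algebra_simps)
  qed (use assms in auto)
  then show ?thesis by simp
qed

lemma upper_tail_iterate:
  assumes "quicksort_law M" "0 < d" "d < 1" "d * (x + 2 + 2 * ln (2 / d)) \<le> e" "e \<le> 1"
    and "(real n - 1) * (1 - e) \<le> x"
  shows "(d / 2 * measure M {0..}) ^ n * measure M {0..} \<le> measure M {real n * (1 - e)..}"
  using assms(6)
proof (induction n)
  case 0
  then show ?case by simp
next
  case (Suc n)
  have c: "0 < measure M {0..}" by (rule quicksort_law_mass_0[OF assms(1)])
  have "(real n - 1) * (1 - e) \<le> real n * (1 - e)" using assms by (intro mult_right_mono) auto
  then have "d / 2 * measure M {0..} * ((d / 2 * measure M {0..}) ^ n * measure M {0..}) \<le>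
      d / 2 * measure M {0..} * measure M {real n * (1 - e)..}"
    using Suc c assms by (intro mult_left_mono) auto
  also have "\<dots> \<le> measure M {real n * (1 - e) + 1 - e..}"
    by (rule upper_tail_step) (use Suc.prems assms in auto)
  finally show ?case by (simp add: algebra_simps)
qed

text \<open>With \<open>d = 1 / (x ln x)\<close> the loss per step is below
  \<open>e = 2 / ln x\<close>, and a step costs a factor with logarithm
  \<open>ln x + ln (ln x) + K\<close>. About \<open>x * (1 + 4 / ln x)\<close> steps reach
  \<open>x\<close>; the surplus steps cost only \<open>O(x)\<close>.\<close>

lemma upper_tail_lower_bound:
  assumes "quicksort_law M"
  shows "\<exists>C. \<forall>\<^sub>F x in at_top. exp (- x * ln x - x * ln (ln x) - C * x) \<le> upper_tail M x"
proof -
  interpret real_distribution M using assms by (simp add: quicksort_law_def)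
  define c where "c = measure M {0..}"
  have c: "0 < c" "c \<le> 1" using quicksort_law_mass_0[OF assms] by (simp_all add: c_def)
  define K where "K = ln (2 / c)"
  have K: "0 \<le> K" using c by (simp add: K_def)
  have 1: "\<forall>\<^sub>F x::real in at_top. 1 / (x * ln x) * (x + 2 + 2 * ln (2 / (1 / (x * ln x)))) \<le> 2 / ln x"
    by real_asymp
  have 2: "\<forall>\<^sub>F x::real in at_top. 1 / (x * ln x) < 1"
    by real_asymp
  have 3: "\<forall>\<^sub>F x::real in at_top. 2 / ln x \<le> 1 / 2"
    by real_asymp
  have 4: "\<forall>\<^sub>F x::real in at_top. 1 < ln x"
    by real_asymp
  have 5: "\<forall>\<^sub>F x::real in at_top. (x * (1 + 4 / ln x) + 1) * (ln x + ln (ln x) + K) + K \<le>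
      x * ln x + x * ln (ln x) + (K + 6) * x"
    by real_asymp
  have "\<forall>\<^sub>F x in at_top. exp (- x * ln x - x * ln (ln x) - (K + 6) * x) \<le> upper_tail M x"
    using 1 2 3 4 5 eventually_gt_at_top[of "1::real"]
  proof eventually_elim
    case (elim x)
    define d where "d = 1 / (x * ln x)"
    define e where "e = 2 / ln x"
    have d: "0 < d" "d < 1" using elim by (simp_all add: d_def)
    have e: "0 < e" "e \<le> 1 / 2" using elim by (simp_all add: e_def)
    \<comment> \<open>\<open>Suc\<close> of the floor puts the final point strictly beyond
      \<open>x\<close> while the last starting point is still at most \<open>x\<close>.\<close>
    define n where "n = Suc (nat \<lfloor>x / (1 - e)\<rfloor>)"
    have fl: "0 \<le> x / (1 - e)" using elim e by simp
    have n: "x / (1 - e) < real n" "real n \<le> x / (1 - e) + 1"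
      using fl unfolding n_def by linarith+
    have "x / (1 - e) \<le> x * (1 + 2 * e)"
    proof -
      have "1 \<le> (1 + 2 * e) * (1 - e)" using e mult_left_mono[of e "1 / 2" "2 * e"] by (simp add: algebra_simps)
      then have "x * 1 \<le> x * ((1 + 2 * e) * (1 - e))" using elim by (intro mult_left_mono) auto
      then show ?thesis using e by (simp add: pos_divide_le_eq mult.assoc)
    qed
    with n(2) have n2: "real n \<le> x * (1 + 4 / ln x) + 1" by (simp add: e_def)
    have "(real n - 1) * (1 - e) \<le> x" using n(2) e by (simp add: field_simps)
    then have low: "(d / 2 * c) ^ n * c \<le> measure M {real n * (1 - e)..}"
      unfolding c_def using elim d e by (intro upper_tail_iterate assms) (auto simp: d_def e_def)
    have dc: "ln (d / 2 * c) = - (ln x + ln (ln x) + K)"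
      using elim c by (simp add: d_def K_def ln_mult ln_div)
    have nonneg: "0 \<le> ln x + ln (ln x) + K" using elim K by (intro add_nonneg_nonneg) auto
    have "- x * ln x - x * ln (ln x) - (K + 6) * x \<le> real n * ln (d / 2 * c) + ln c"
    proof -
      have "real n * (ln x + ln (ln x) + K) \<le> (x * (1 + 4 / ln x) + 1) * (ln x + ln (ln x) + K)"
        using n2 nonneg by (rule mult_right_mono)
      moreover have "- K \<le> ln c" using c by (simp add: K_def ln_div)
      ultimately show ?thesis using elim(5) unfolding dc by (simp add: algebra_simps)
    qed
    then have "exp (- x * ln x - x * ln (ln x) - (K + 6) * x) \<le> exp (real n * ln (d / 2 * c) + ln c)"
      by simp
    also have "\<dots> = (d / 2 * c) ^ n * c"
      using d c by (simp add: exp_add exp_of_nat_mult)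
    also note low
    also have "measure M {real n * (1 - e)..} \<le> measure M {x<..}"
      using n(1) e by (intro finite_measure_mono) (auto simp: field_simps)
    also have "measure M {x<..} = upper_tail M x"
      unfolding upper_tail_def cdf_def using prob_compl[of "{..x}"]
      by (simp add: Compl_eq_Diff_UNIV[symmetric] Compl_atMost)
    finally show ?case .
  qed
  then show ?thesis by blast
qed

section \<open>Decay of the characteristic function\<close>

text \<open>Integration by parts: \<open>G\<close> carries the boundary terms, \<open>R\<close> is
  what remains, and \<open>r = norm R\<close> has an explicit antiderivative. As \<open>h'\<close>
  is monotone of constant sign, the variation of \<open>1 / h'\<close> is at most
  \<open>1 / m\<close>; with the two boundary terms this gives the 3.\<close>

lemma oscillatory_integral_bound:
  fixes h h' h'' :: "real \<Rightarrow> real" and t m :: real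
  assumes "a \<le> b" "0 < m" "t \<noteq> 0"
    and h: "\<And>u. u \<in> {a..b} \<Longrightarrow> (h has_real_derivative h' u) (at u)"
    and h': "\<And>u. u \<in> {a..b} \<Longrightarrow> (h' has_real_derivative h'' u) (at u)"
    and cont: "continuous_on {a..b} h''"
    and pos: "\<And>u. u \<in> {a..b} \<Longrightarrow> 0 \<le> h'' u"
    and sgn: "(\<forall>u\<in>{a..b}. m \<le> h' u) \<or> (\<forall>u\<in>{a..b}. h' u \<le> - m)"
  shows "norm (integral {a..b} (\<lambda>u. iexp (t * h u))) \<le> 3 / (\<bar>t\<bar> * m)"
proof -
  have nz: "h' u \<noteq> 0" if "u \<in> {a..b}" for u using sgn \<open>0 < m\<close> that by fastforce
  have inv: "\<bar>1 / h' u\<bar> \<le> 1 / m" if "u \<in> {a..b}" for u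
  proof -
    have "m \<le> \<bar>h' u\<bar>" using sgn that by fastforce
    then show ?thesis using \<open>0 < m\<close> by (simp add: abs_divide frac_le)
  qed
  have conth: "continuous_on {a..b} h" "continuous_on {a..b} h'"
    by (rule DERIV_continuous_on, rule has_field_derivative_at_within, erule h h')+
  define G where "G = (\<lambda>u. iexp (t * h u) / (\<i> * t * h' u))"
  define R where "R = (\<lambda>u. iexp (t * h u) * h'' u / (\<i> * t * (h' u)\<^sup>2))"
  define r where "r = (\<lambda>u. h'' u / (\<bar>t\<bar> * (h' u)\<^sup>2))"
  have G: "((\<lambda>u. iexp (t * h u) - R u) has_integral (G b - G a)) {a..b}"
  proof (rule fundamental_theorem_of_calculus[OF \<open>a \<le> b\<close>])
    fix u assume u: "u \<in> {a..b}"
    have 1: "((\<lambda>u. iexp (t * h u)) has_vector_derivative (\<i> * (t * h' u) * iexp (t * h u))) (at u)"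
    proof -
      have "((\<lambda>u. t * h u) has_vector_derivative t * h' u) (at u)"
        using DERIV_cmult[OF h[OF u], of t] by (simp add: has_real_derivative_iff_has_vector_derivative)
      from vector_diff_chain_at[OF this has_vector_derivative_iexp]
      show ?thesis by (simp add: o_def scaleR_conv_of_real mult_ac)
    qed
    have 2: "((\<lambda>u. complex_of_real (1 / h' u)) has_vector_derivative complex_of_real (- h'' u / (h' u)\<^sup>2)) (at u)"
      using h'[OF u] nz[OF u]
      by (intro has_vector_derivative_of_real)
         (auto intro!: derivative_eq_intros simp: power2_eq_square)
    have "((\<lambda>u. iexp (t * h u) * complex_of_real (1 / h' u) * (1 / (\<i> * t))) has_vector_derivative
        (iexp (t * h u) * complex_of_real (- h'' u / (h' u)\<^sup>2) +
          (\<i> * (t * h' u) * iexp (t * h u)) * complex_of_real (1 / h' u)) * (1 / (\<i> * t))) (at u)"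
      by (intro has_vector_derivative_mult_left has_vector_derivative_mult 1 2)
    also have "(\<lambda>u. iexp (t * h u) * complex_of_real (1 / h' u) * (1 / (\<i> * t))) = G"
      by (auto simp: G_def)
    also have "(iexp (t * h u) * complex_of_real (- h'' u / (h' u)\<^sup>2) +
          (\<i> * (t * h' u) * iexp (t * h u)) * complex_of_real (1 / h' u)) * (1 / (\<i> * t)) =
        iexp (t * h u) - R u"
      using nz[OF u] \<open>t \<noteq> 0\<close> by (simp add: R_def field_simps power2_eq_square)
    finally show "(G has_vector_derivative iexp (t * h u) - R u) (at u within {a..b})"
      by (rule has_vector_derivative_at_within)
  qed
  have r: "(r has_integral (- 1 / (\<bar>t\<bar> * h' b) - - 1 / (\<bar>t\<bar> * h' a))) {a..b}"
  proof (rule fundamental_theorem_of_calculus[OF \<open>a \<le> b\<close>])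
    fix u assume u: "u \<in> {a..b}"
    have "((\<lambda>u. - 1 / (\<bar>t\<bar> * h' u)) has_real_derivative r u) (at u)"
      using h'[OF u] nz[OF u] \<open>t \<noteq> 0\<close>
      by (auto intro!: derivative_eq_intros simp: r_def field_simps power2_eq_square)
    then show "((\<lambda>u. - 1 / (\<bar>t\<bar> * h' u)) has_vector_derivative r u) (at u within {a..b})"
      by (simp add: has_real_derivative_iff_has_vector_derivative has_vector_derivative_at_within)
  qed
  have R: "R integrable_on {a..b}"
    unfolding R_def using nz \<open>t \<noteq> 0\<close>
    by (intro integrable_continuous_interval continuous_intros conth cont) auto
  have "integral {a..b} (\<lambda>u. iexp (t * h u)) = (G b - G a) + integral {a..b} R"
    using has_integral_add[OF G integrable_integral[OF R]] by (simp add: integral_unique)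
  also have "norm \<dots> \<le> (norm (G b) + norm (G a)) + norm (integral {a..b} R)"
    by (meson add_right_mono norm_triangle_ineq norm_triangle_ineq4 order_trans)
  also have "\<dots> \<le> (1 / (\<bar>t\<bar> * m) + 1 / (\<bar>t\<bar> * m)) + 1 / (\<bar>t\<bar> * m)"
  proof (intro add_mono)
    have "norm (G u) \<le> 1 / (\<bar>t\<bar> * m)" if "u \<in> {a..b}" for u
    proof -
      have "norm (G u) = 1 / \<bar>t\<bar> * \<bar>1 / h' u\<bar>" by (simp add: G_def norm_divide norm_mult)
      also have "\<dots> \<le> 1 / \<bar>t\<bar> * (1 / m)" using inv[OF that] by (intro mult_left_mono) auto
      finally show ?thesis by simp
    qed
    then show "norm (G b) \<le> 1 / (\<bar>t\<bar> * m)" "norm (G a) \<le> 1 / (\<bar>t\<bar> * m)"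
      using \<open>a \<le> b\<close> by auto
    have "norm (integral {a..b} R) \<le> integral {a..b} r"
    proof (rule integral_norm_bound_integral[OF R])
      show "r integrable_on {a..b}" using r by blast
      show "norm (R u) \<le> r u" if "u \<in> {a..b}" for u
        using pos[OF that] by (simp add: R_def r_def norm_divide norm_mult norm_power)
    qed
    also have "\<dots> = 1 / \<bar>t\<bar> * (1 / h' a - 1 / h' b)"
      using r by (simp add: integral_unique right_diff_distrib)
    also have "\<dots> \<le> 1 / \<bar>t\<bar> * (1 / m)"
    proof (rule mult_left_mono)
      have ab: "a \<in> {a..b}" "b \<in> {a..b}" using \<open>a \<le> b\<close> by auto
      have "0 < 1 / h' b \<or> 1 / h' a < 0" using sgn ab \<open>0 < m\<close> by fastforce
      then show "1 / h' a - 1 / h' b \<le> 1 / m"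
        using inv[OF ab(1)] inv[OF ab(2)] by linarith
    qed simp
    finally show "norm (integral {a..b} R) \<le> 1 / (\<bar>t\<bar> * m)" by simp
  qed
  finally show ?thesis by (simp add: mult.commute)
qed

section \<open>Oscillation in the splitting variable, uniformly in the subproblems\<close>

definition qs_saddle :: "real \<Rightarrow> real \<Rightarrow> real" where
  "qs_saddle z z' = 1 / (1 + exp ((z - z') / 2))"

definition qs_comb_deriv :: "real \<Rightarrow> real \<Rightarrow> real \<Rightarrow> real" where
  "qs_comb_deriv z z' u = z - z' + 2 * ln u - 2 * ln (1 - u)"

lemma qs_saddle_bounds: "0 < qs_saddle z z'" "qs_saddle z z' < 1"
  by (simp_all add: qs_saddle_def add_pos_pos)

text \<open>\<open>qs_saddle z z'\<close> is the zero of the derivative in \<open>u\<close>.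
  Measuring from it eliminates \<open>z\<close> and \<open>z'\<close>, which makes the later bounds
  uniform.\<close>

lemma qs_comb_deriv_saddle:
  "qs_comb_deriv z z' u = 2 * (ln u - ln (qs_saddle z z')) + 2 * (ln (1 - qs_saddle z z') - ln (1 - u))"
proof -
  have p: "0 < 1 + exp ((z - z') / 2)" by (simp add: add_pos_pos)
  have "1 - qs_saddle z z' = exp ((z - z') / 2) / (1 + exp ((z - z') / 2))"
    using p by (simp add: qs_saddle_def field_simps)
  then have "ln (1 - qs_saddle z z') = (z - z') / 2 - ln (1 + exp ((z - z') / 2))"
    using p by (simp add: ln_div)
  moreover have "ln (qs_saddle z z') = - ln (1 + exp ((z - z') / 2))"
    using p by (simp add: qs_saddle_def ln_div)
  ultimately show ?thesis by (simp add: qs_comb_deriv_def)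
qed

lemma ln_diff_ge:
  fixes u v :: real
  assumes "0 < v" "v \<le> u" "u \<le> 1"
  shows "u - v \<le> ln u - ln v"
proof -
  have "(u - v) * u \<le> (u - v) * 1" using assms by (intro mult_left_mono) auto
  then have "u - v \<le> (u - v) / u" using assms by (simp add: pos_le_divide_eq)
  also have "\<dots> = 1 - 1 / (u / v)" using assms by (simp add: field_simps)
  also have "\<dots> \<le> ln (u / v)" using assms by (intro ln_ge_one_minus_inverse) auto
  finally show ?thesis using assms by (simp add: ln_div)
qed

text \<open>On \<open>(0, 1]\<close> the logarithm has slope at least 1, so each of the two
  differences in \<open>qs_comb_deriv_saddle\<close> is at least \<open>d\<close>; the toll's
  coefficients 2 make this \<open>4 * d\<close>.\<close>

lemma qs_comb_deriv_ge:
  assumes "qs_saddle z z' + d \<le> u" "u < 1" "0 \<le> d"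
  shows "4 * d \<le> qs_comb_deriv z z' u"
  using ln_diff_ge[of "qs_saddle z z'" u] ln_diff_ge[of "1 - u" "1 - qs_saddle z z'"]
    qs_saddle_bounds[of z z'] assms
  by (simp add: qs_comb_deriv_saddle)

lemma qs_comb_deriv_le:
  assumes "u \<le> qs_saddle z z' - d" "0 < u" "0 \<le> d"
  shows "qs_comb_deriv z z' u \<le> - (4 * d)"
  using ln_diff_ge[of u "qs_saddle z z'"] ln_diff_ge[of "1 - qs_saddle z z'" "1 - u"]
    qs_saddle_bounds[of z z'] assms
  by (simp add: qs_comb_deriv_saddle)

lemma qs_iexp_integrable:
  fixes t :: real
  assumes "0 \<le> a" "b \<le> 1"
  shows "set_integrable lborel {a..b} (\<lambda>u. iexp (t * qs_comb u z z'))"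
    and "(\<lambda>u. iexp (t * qs_comb u z z')) integrable_on {a..b}"
proof -
  show "set_integrable lborel {a..b} (\<lambda>u. iexp (t * qs_comb u z z'))"
    unfolding set_integrable_def
    by (rule Bochner_Integration.integrable_bound[of _ "indicator {a..b} :: real \<Rightarrow> real"])
       (auto simp: indicator_def emeasure_lborel_Icc_eq intro!: integrable_real_indicator)
  then show "(\<lambda>u. iexp (t * qs_comb u z z')) integrable_on {a..b}"
    by (rule set_borel_integral_eq_integral(1))
qed

lemma norm_qs_iexp_integral_le:
  assumes "0 \<le> a" "a \<le> b" "b \<le> 1"
  shows "norm (integral {a..b} (\<lambda>u. iexp (t * qs_comb u z z'))) \<le> b - a"
proof -
  have "norm (integral {a..b} (\<lambda>u. iexp (t * qs_comb u z z'))) \<le> integral {a..b} (\<lambda>u. 1::real)"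
    by (rule integral_norm_bound_integral[OF qs_iexp_integrable(2)]) (use assms in auto)
  then show ?thesis using assms by simp
qed

text \<open>Pieces of length \<open>d\<close> are cut off at both ends and estimated trivially: one
  end may be the saddle, where the derivative vanishes, the other may be 0 or 1, where the second
  derivative blows up.\<close>

lemma qs_oscillatory_half:
  assumes "0 \<le> a" "a \<le> b" "b \<le> 1" "qs_saddle z z' \<le> a \<or> b \<le> qs_saddle z z'"
    and "0 < d" "t \<noteq> 0"
  shows "norm (integral {a..b} (\<lambda>u. iexp (t * qs_comb u z z'))) \<le> 2 * d + 3 / (\<bar>t\<bar> * (4 * d))"
proof (cases "b - a \<le> 2 * d")
  case True
  moreover have "0 \<le> 3 / (\<bar>t\<bar> * (4 * d))" using assms by simp
  ultimately show ?thesis using norm_qs_iexp_integral_le[OF assms(1-3), of t z z'] by linarith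
next
  case False
  let ?f = "\<lambda>u. iexp (t * qs_comb u z z')"
  have int: "?f integrable_on {p..q}" if "0 \<le> p" "q \<le> 1" for p q
    using that by (rule qs_iexp_integrable(2))
  have "integral {a..a + d} ?f + integral {a + d..b} ?f = integral {a..b} ?f"
    using False assms by (intro Henstock_Kurzweil_Integration.integral_combine int) auto
  moreover have "integral {a + d..b - d} ?f + integral {b - d..b} ?f = integral {a + d..b} ?f"
    using False assms by (intro Henstock_Kurzweil_Integration.integral_combine int) auto
  ultimately have split: "integral {a..b} ?f =
      integral {a..a + d} ?f + (integral {a + d..b - d} ?f + integral {b - d..b} ?f)"
    by (simp only:)
  have mid: "norm (integral {a + d..b - d} ?f) \<le> 3 / (\<bar>t\<bar> * (4 * d))"
  proof (rule oscillatory_integral_bound[where h' = "qs_comb_deriv z z'" and h'' = "\<lambda>u. 2 / u + 2 / (1 - u)"])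
    fix u assume "u \<in> {a + d..b - d}"
    then have u: "0 < u" "u < 1" using assms by auto
    have "2 + u * 2 / (1 - u) = 2 / (1 - u)" using u by (simp add: field_simps)
    with u show "((\<lambda>u. qs_comb u z z') has_real_derivative qs_comb_deriv z z' u) (at u)"
      unfolding qs_comb_def qs_comb_deriv_def quicksort_toll_def
      by (auto intro!: derivative_eq_intros simp: algebra_simps)
    show "(qs_comb_deriv z z' has_real_derivative 2 / u + 2 / (1 - u)) (at u)"
      unfolding qs_comb_deriv_def using u by (auto intro!: derivative_eq_intros)
    show "0 \<le> 2 / u + 2 / (1 - u)" using u by simp
  next
    show "continuous_on {a + d..b - d} (\<lambda>u. 2 / u + 2 / (1 - u))"
      using assms by (intro continuous_intros) auto
    from assms(4)
    show "(\<forall>u\<in>{a + d..b - d}. 4 * d \<le> qs_comb_deriv z z' u) \<or> (\<forall>u\<in>{a + d..b - d}. qs_comb_deriv z z' u \<le> - (4 * d))"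
    proof
      assume "qs_saddle z z' \<le> a"
      then have "\<forall>u\<in>{a + d..b - d}. 4 * d \<le> qs_comb_deriv z z' u"
        using assms by (auto intro!: qs_comb_deriv_ge)
      then show ?thesis ..
    next
      assume "b \<le> qs_saddle z z'"
      then have "\<forall>u\<in>{a + d..b - d}. qs_comb_deriv z z' u \<le> - (4 * d)"
        using assms by (auto intro!: qs_comb_deriv_le)
      then show ?thesis ..
    qed
  qed (use False assms in auto)
  have "norm (integral {a..a + d} ?f) \<le> (a + d) - a" "norm (integral {b - d..b} ?f) \<le> b - (b - d)"
    using False assms by (intro norm_qs_iexp_integral_le; simp)+
  then have ends: "norm (integral {a..a + d} ?f) \<le> d" "norm (integral {b - d..b} ?f) \<le> d" by simp_all
  have "norm (integral {a..b} ?f) \<le> norm (integral {a..a + d} ?f) +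
      (norm (integral {a + d..b - d} ?f) + norm (integral {b - d..b} ?f))"
    unfolding split by (meson add_left_mono norm_triangle_ineq order_trans)
  then show ?thesis using mid ends by linarith
qed

text \<open>The choice \<open>d = 1 / sqrt |t|\<close> balances the cut-off pieces against the
  oscillatory part; the two halves together give \<open>5.5 * d\<close>.\<close>

lemma norm_qs_oscillatory:
  assumes "t \<noteq> 0"
  shows "norm (CLINT u|unif01. iexp (t * qs_comb u z z')) \<le> 6 / sqrt \<bar>t\<bar>"
proof -
  let ?f = "\<lambda>u. iexp (t * qs_comb u z z')" and ?s = "qs_saddle z z'"
  have s: "0 < ?s" "?s < 1" by (rule qs_saddle_bounds)+
  have "set_integrable lborel {0<..<1} ?f"
    by (rule set_integrable_subset[OF qs_iexp_integrable(1)[of 0 1]]) auto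
  then have "(CLINT u|unif01. ?f u) = integral {0<..<1} ?f"
    by (simp add: integral_unif01 set_borel_integral_eq_integral(2))
  also have "\<dots> = integral {0..1} ?f"
    using integral_open_interval[of 0 "1::real" ?f] by (simp only: box_real cbox_interval)
  also have "\<dots> = integral {0..?s} ?f + integral {?s..1} ?f"
    using s by (intro Henstock_Kurzweil_Integration.integral_combine[symmetric] qs_iexp_integrable) auto
  finally have eq: "(CLINT u|unif01. ?f u) = integral {0..?s} ?f + integral {?s..1} ?f" .
  define d where "d = 1 / sqrt \<bar>t\<bar>"
  have d: "0 < d" using assms by (simp add: d_def)
  have "\<bar>t\<bar> * d * d = 1" using assms by (simp add: d_def)
  then have "3 / (\<bar>t\<bar> * (4 * d)) = 3 / 4 * d" using d assms by (simp add: field_simps)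
  moreover have "norm (integral {0..?s} ?f) \<le> 2 * d + 3 / (\<bar>t\<bar> * (4 * d))"
    "norm (integral {?s..1} ?f) \<le> 2 * d + 3 / (\<bar>t\<bar> * (4 * d))"
    using s d assms by (intro qs_oscillatory_half; simp)+
  ultimately have "norm (CLINT u|unif01. ?f u) \<le> 6 * d"
    unfolding eq using d norm_triangle_ineq[of "integral {0..?s} ?f" "integral {?s..1} ?f"] by linarith
  then show ?thesis by (simp add: d_def)
qed

lemma inverse_sqrt_integral:
  "set_integrable lborel {0<..<1} (\<lambda>u::real. 1 / sqrt u + 1 / sqrt (1 - u))"
  "(LINT u:{0<..<1}|lborel. 1 / sqrt u + 1 / sqrt (1 - u)) = (4::real)"
proof -
  let ?F = "\<lambda>u::real. 2 * sqrt u - 2 * sqrt (1 - u)"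
  have lim: "(?F \<longlongrightarrow> - 2) (at_right 0)" "(?F \<longlongrightarrow> 2) (at_left 1)"
    by real_asymp+
  have D: "DERIV ?F x :> 1 / sqrt x + 1 / sqrt (1 - x)" if "0 < x" "x < 1" for x
    using that by (auto intro!: derivative_eq_intros simp: field_simps)
  have C: "isCont (\<lambda>u::real. 1 / sqrt u + 1 / sqrt (1 - u)) x" if "0 < x" "x < 1" for x
    using that by (intro continuous_intros) auto
  have "set_integrable lborel (einterval 0 1) (\<lambda>u::real. 1 / sqrt u + 1 / sqrt (1 - u))"
    "(LBINT u=0..1. 1 / sqrt u + 1 / sqrt (1 - u)) = 2 - - (2::real)"
    by (rule interval_integral_FTC_nonneg[where F = ?F];
        use lim D C in \<open>auto simp: zero_ereal_def one_ereal_def ereal_tendsto_simps\<close>)+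
  then show "set_integrable lborel {0<..<1} (\<lambda>u::real. 1 / sqrt u + 1 / sqrt (1 - u))"
    "(LINT u:{0<..<1}|lborel. 1 / sqrt u + 1 / sqrt (1 - u)) = (4::real)"
    by (simp_all add: interval_lebesgue_integral_def zero_ereal_def one_ereal_def)
qed

text \<open>For \<open>u <= 1/2\<close> only the rate \<open>1 / sqrt\<close> is used at
  \<open>t * u\<close>, since its singularity at \<open>u = 0\<close> is integrable, and the
  inductive rate is used at \<open>t * (1 - u)\<close>, which stays of size \<open>t\<close>. A step
  multiplies the constant by \<open>6 * 4 * 2 ^ m\<close>, whence \<open>2 ^ (m^2)\<close>.\<close>

lemma char_decay:
  assumes "quicksort_law M" "t \<noteq> 0"
  shows "norm (char M t) \<le> 24 ^ m * 2 ^ (m\<^sup>2) / sqrt \<bar>t\<bar> ^ m"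
  using assms(2)
proof (induction m arbitrary: t)
  case 0
  interpret real_distribution M using assms by (simp add: quicksort_law_def)
  show ?case using cmod_char_le_1 by simp
next
  case (Suc m)
  interpret real_distribution M using assms by (simp add: quicksort_law_def)
  have M: "quicksort_map M = M" using assms by (simp add: quicksort_law_def)
  interpret U: prob_space unif01 by (rule prob_space_unif01)
  have half: "norm (char M t) \<le> 6 / sqrt \<bar>t\<bar>" if "t \<noteq> 0" for t
    using norm_char_quicksort_map_le[OF norm_qs_oscillatory[OF that]] by (simp add: M)
  define c :: real where "c = 24 ^ m * 2 ^ (m\<^sup>2)"
  have c: "0 \<le> c" by (simp add: c_def)
  have prod: "norm (char M (t * u)) * norm (char M (t * (1 - u))) \<le>
      6 * c * 2 ^ m / sqrt \<bar>t\<bar> ^ Suc m * (1 / sqrt u)" if u: "0 < u" "u \<le> 1 / 2" for u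
  proof -
    have "norm (char M (t * u)) \<le> 6 / sqrt \<bar>t * u\<bar>"
      using Suc.prems u by (intro half) auto
    moreover have "norm (char M (t * (1 - u))) \<le> c / sqrt \<bar>t * (1 - u)\<bar> ^ m"
      unfolding c_def using Suc.prems u by (intro Suc.IH) auto
    moreover have "c / sqrt \<bar>t * (1 - u)\<bar> ^ m \<le> c * 2 ^ m / sqrt \<bar>t\<bar> ^ m"
    proof -
      \<comment> \<open>Weakened from 1/2 to 1/4 so that the square root is 1/2 and the loss is
        exactly \<open>2 ^ m\<close>.\<close>
      have "\<bar>t\<bar> * (1 / 4) \<le> \<bar>t\<bar> * (1 - u)" using u by (intro mult_left_mono) auto
      then have "\<bar>t\<bar> / 4 \<le> \<bar>t * (1 - u)\<bar>" using u by (simp add: abs_mult)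
      then have "sqrt (\<bar>t\<bar> / 4) \<le> sqrt \<bar>t * (1 - u)\<bar>" by (rule real_sqrt_le_mono)
      then have "sqrt \<bar>t\<bar> / 2 \<le> sqrt \<bar>t * (1 - u)\<bar>" by (simp add: real_sqrt_divide)
      then have "(sqrt \<bar>t\<bar> / 2) ^ m \<le> sqrt \<bar>t * (1 - u)\<bar> ^ m" by (rule power_mono) simp
      then have "c / sqrt \<bar>t * (1 - u)\<bar> ^ m \<le> c / (sqrt \<bar>t\<bar> / 2) ^ m"
        using c Suc.prems u by (intro divide_left_mono mult_pos_pos zero_less_power) auto
      then show ?thesis by (simp add: power_divide)
    qed
    ultimately have "norm (char M (t * u)) * norm (char M (t * (1 - u))) \<le>
        6 / sqrt \<bar>t * u\<bar> * (c * 2 ^ m / sqrt \<bar>t\<bar> ^ m)"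
      using Suc.prems u by (intro mult_mono) auto
    also have "\<dots> = 6 * c * 2 ^ m / sqrt \<bar>t\<bar> ^ Suc m * (1 / sqrt u)"
      using u by (simp add: abs_mult real_sqrt_mult mult_ac)
    finally show ?thesis .
  qed
  let ?K = "6 * c * 2 ^ m / sqrt \<bar>t\<bar> ^ Suc m"
  have K: "0 \<le> ?K" using c by simp
  have int: "integrable unif01 (\<lambda>u. ?K * (1 / sqrt u + 1 / sqrt (1 - u)))"
    "(LINT u|unif01. ?K * (1 / sqrt u + 1 / sqrt (1 - u))) = ?K * 4"
    using inverse_sqrt_integral by (simp_all add: integral_unif01)
  have "norm (char M t) = norm (CLINT u|unif01. iexp (t * quicksort_toll u) * char M (t * u) * char M (t * (1 - u)))"
    using char_quicksort_map[of t] by (simp add: M)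
  also have "\<dots> \<le> (LINT u|unif01. norm (iexp (t * quicksort_toll u) * char M (t * u) * char M (t * (1 - u))))"
    by (rule integral_norm_bound)
  also have "\<dots> \<le> (LINT u|unif01. ?K * (1 / sqrt u + 1 / sqrt (1 - u)))"
  proof (rule integral_mono_AE)
    show "integrable unif01 (\<lambda>u. norm (iexp (t * quicksort_toll u) * char M (t * u) * char M (t * (1 - u))))"
      by (rule U.integrable_const_bound[of _ 1])
         (auto simp: norm_mult intro!: mult_le_one cmod_char_le_1)
    show "AE u in unif01. norm (iexp (t * quicksort_toll u) * char M (t * u) * char M (t * (1 - u))) \<le>
        ?K * (1 / sqrt u + 1 / sqrt (1 - u))"
    proof (rule AE_mp[OF AE_unif01], rule AE_I2, rule impI)
      fix u :: real assume u: "0 < u \<and> u < 1"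
      have "norm (char M (t * u)) * norm (char M (t * (1 - u))) \<le> ?K * (1 / sqrt u) \<or>
          norm (char M (t * u)) * norm (char M (t * (1 - u))) \<le> ?K * (1 / sqrt (1 - u))"
        using prod[of u] prod[of "1 - u"] u by (cases "u \<le> 1 / 2") (auto simp: mult.commute)
      moreover have "0 \<le> ?K * (1 / sqrt u)" "0 \<le> ?K * (1 / sqrt (1 - u))"
        using u by (intro mult_nonneg_nonneg K; simp)+
      ultimately have "norm (char M (t * u)) * norm (char M (t * (1 - u))) \<le> ?K * (1 / sqrt u) + ?K * (1 / sqrt (1 - u))"
        by linarith
      then show "norm (iexp (t * quicksort_toll u) * char M (t * u) * char M (t * (1 - u))) \<le>
        ?K * (1 / sqrt u + 1 / sqrt (1 - u))"
        by (simp only: norm_mult norm_exp_i_times mult_1 distrib_left)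
    qed
  qed (use int in auto)
  also have "\<dots> = 24 * c * 2 ^ m / sqrt \<bar>t\<bar> ^ Suc m" using int by simp
  also have "\<dots> \<le> 24 ^ Suc m * 2 ^ ((Suc m)\<^sup>2) / sqrt \<bar>t\<bar> ^ Suc m"
  proof (rule divide_right_mono)
    have "(2::real) ^ (m\<^sup>2 + m) \<le> 2 ^ ((Suc m)\<^sup>2)"
      by (intro power_increasing) (auto simp: power2_eq_square)
    then have "24 ^ Suc m * (2::real) ^ (m\<^sup>2 + m) \<le> 24 ^ Suc m * 2 ^ ((Suc m)\<^sup>2)"
      by (intro mult_left_mono) auto
    then show "24 * c * 2 ^ m \<le> 24 ^ Suc m * 2 ^ ((Suc m)\<^sup>2)"
      by (simp add: c_def power_add mult_ac)
  qed simp
  finally show ?case .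
qed

section \<open>Fourier inversion\<close>

lemma inverse_1_plus_square_integral:
  "integrable lborel (\<lambda>t::real. inverse (1 + t\<^sup>2))" "(LINT t|lborel. inverse (1 + t\<^sup>2)) = pi"
  using integrable_inverse_1_plus_square LBINT_inverse_1_plus_square
  by (simp_all add: set_integrable_def interval_lebesgue_integral_def set_lebesgue_integral_def)

text \<open>The decay of order \<open>m = 2 * n + 4\<close> leaves \<open>1 / t^2\<close> after
  multiplication by \<open>|t| ^ n\<close>. With \<open>24 <= exp 4\<close> and
  \<open>2 <= exp 1\<close> its constant is at most \<open>exp (8 (n + 2) + 4 (n + 2)^2)\<close>,
  which is below the stated exponential.\<close>

lemma char_moment_bound:
  assumes "quicksort_law M"
  shows "\<bar>t\<bar> ^ n * norm (char M t) \<le> 2 * exp (20 * (real n + 2)\<^sup>2) * inverse (1 + t\<^sup>2)"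
proof -
  interpret real_distribution M using assms by (simp add: quicksort_law_def)
  let ?E = "exp (20 * (real n + 2)\<^sup>2)"
  have E1: "1 \<le> ?E" by simp
  have p: "0 < 1 + t\<^sup>2" by (simp add: add_pos_nonneg)
  have "\<bar>t\<bar> ^ n * norm (char M t) * (1 + t\<^sup>2) \<le> 2 * ?E"
  proof (cases "\<bar>t\<bar> \<le> 1")
    case True
    have "\<bar>t\<bar> ^ n * norm (char M t) \<le> 1 * 1"
      using True cmod_char_le_1 by (intro mult_mono power_le_one) auto
    moreover have "t\<^sup>2 \<le> 1" using True by (simp add: abs_square_le_1)
    ultimately have "\<bar>t\<bar> ^ n * norm (char M t) * (1 + t\<^sup>2) \<le> 1 * 2"
      by (intro mult_mono) auto
    then show ?thesis using E1 by linarith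
  next
    case False
    let ?m = "2 * n + 4"
    have t0: "t \<noteq> 0" using False by auto
    have "?m = 2 * (n + 2)" by simp
    then have "sqrt \<bar>t\<bar> ^ ?m = (sqrt \<bar>t\<bar> ^ 2) ^ (n + 2)"
      by (simp only: power_mult)
    then have sq: "sqrt \<bar>t\<bar> ^ ?m = \<bar>t\<bar> ^ n * t\<^sup>2"
      by (simp add: power_add power2_eq_square)
    have "norm (char M t) \<le> 24 ^ ?m * 2 ^ (?m\<^sup>2) / sqrt \<bar>t\<bar> ^ ?m"
      by (rule char_decay[OF assms t0])
    also have "\<dots> \<le> ?E / sqrt \<bar>t\<bar> ^ ?m"
    proof (rule divide_right_mono)
      have "(24::real) \<le> exp 4"
      proof -
        have "5 / 2 \<le> exp (1::real)" using exp_lower_Taylor_quadratic[of "1::real"] by simp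
        then have "(5 / 2) ^ 4 \<le> exp (1::real) ^ 4" by (intro power_mono) auto
        also have "exp (1::real) ^ 4 = exp 4" by (simp add: exp_of_nat_mult[symmetric])
        finally show ?thesis by (simp add: power4_eq_xxxx)
      qed
      then have "(24::real) ^ ?m \<le> exp 4 ^ ?m" by (intro power_mono) auto
      also have "\<dots> = exp (4 * real ?m)" by (simp only: exp_of_nat_mult[symmetric] mult.commute)
      finally have 1: "(24::real) ^ ?m \<le> exp (4 * real ?m)" .
      have "(2::real) ^ (?m\<^sup>2) \<le> exp 1 ^ (?m\<^sup>2)"
        using exp_ge_add_one_self[of "1::real"] by (intro power_mono) auto
      also have "\<dots> = exp (real (?m\<^sup>2))" by (simp only: exp_of_nat_mult[symmetric] mult_1_right)
      finally have 2: "(2::real) ^ (?m\<^sup>2) \<le> exp (real (?m\<^sup>2))" .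
      have "24 ^ ?m * (2::real) ^ (?m\<^sup>2) \<le> exp (4 * real ?m) * exp (real (?m\<^sup>2))"
        by (intro mult_mono 1 2) auto
      also have "\<dots> = exp (4 * real ?m + real (?m\<^sup>2))" by (simp add: exp_add)
      also have "\<dots> \<le> ?E"
      proof -
        have "real ?m = 2 * (real n + 2)" by simp
        then have "4 * real ?m + real (?m\<^sup>2) = 8 * (real n + 2) + 4 * (real n + 2)\<^sup>2"
          by (simp only: of_nat_power) (simp add: power2_eq_square algebra_simps)
        moreover have "(real n + 2) * 1 \<le> (real n + 2) * (real n + 2)" by (intro mult_left_mono) auto
        ultimately show ?thesis unfolding exp_le_cancel_iff power2_eq_square by linarith
      qed
      finally show "24 ^ ?m * 2 ^ (?m\<^sup>2) \<le> ?E" .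
    qed simp
    also have "\<dots> = ?E / (\<bar>t\<bar> ^ n * t\<^sup>2)" by (simp only: sq)
    finally have "norm (char M t) * (\<bar>t\<bar> ^ n * t\<^sup>2) \<le> ?E"
      using t0 by (simp add: pos_le_divide_eq)
    then have 1: "\<bar>t\<bar> ^ n * norm (char M t) * t\<^sup>2 \<le> ?E" by (simp add: mult_ac)
    have "1 \<le> t\<^sup>2" using False by (simp add: abs_square_le_1[symmetric] not_le abs_square_less_1[symmetric] linorder_not_less)
    then have "\<bar>t\<bar> ^ n * norm (char M t) * 1 \<le> \<bar>t\<bar> ^ n * norm (char M t) * t\<^sup>2"
      by (intro mult_left_mono) auto
    with 1 show ?thesis by (simp add: distrib_left)
  qed
  then show ?thesis using p by (simp add: pos_le_divide_eq[symmetric] divide_inverse)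
qed

definition char_moment :: "real measure \<Rightarrow> nat \<Rightarrow> real" where
  "char_moment M n = (LINT t|lborel. \<bar>t\<bar> ^ n * norm (char M t))"

text \<open>The \<open>n\<close>-th derivative in \<open>x\<close>, formed under the integral sign,
  of \<open>2 * pi\<close> times the density given by Fourier inversion.\<close>

definition inversion_integral :: "real measure \<Rightarrow> nat \<Rightarrow> real \<Rightarrow> complex" where
  "inversion_integral M n x = (CLINT t|lborel. (- \<i> * t) ^ n * iexp (- (t * x)) * char M t)"

text \<open>Kernel of Levy's inversion formula for \<open>{a<..b}\<close>. At \<open>t = 0\<close>
  division by zero yields 0 instead of the limit \<open>b - a\<close>, harmless on a null
  set.\<close>

definition inversion_kernel :: "real \<Rightarrow> real \<Rightarrow> real \<Rightarrow> complex" where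
  "inversion_kernel a b t = (iexp (- (t * a)) - iexp (- (t * b))) / (\<i> * t)"

lemma iexp_quadratic: "norm (iexp y - 1 - \<i> * y) \<le> y\<^sup>2 / 2"
proof -
  have "norm (iexp y - (\<Sum>k\<le>1. (\<i> * y) ^ k / fact k)) \<le> \<bar>y\<bar> ^ Suc 1 / fact (Suc 1)"
    by (rule iexp_approx1)
  then show ?thesis by (simp add: algebra_simps numeral_2_eq_2)
qed

text \<open>Reduces differentiation under the integral to a remainder estimate: the second-order
  bound for \<open>iexp\<close> leaves \<open>h^2\<close> times an absolute moment of the
  characteristic function.\<close>

lemma has_real_derivative_quadratic_bound:
  fixes f :: "real \<Rightarrow> real"
  assumes "\<And>h. \<bar>f (x + h) - f x - h * d\<bar> \<le> C * h\<^sup>2"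
  shows "(f has_real_derivative d) (at x)"
  unfolding DERIV_def
proof (rule LIM_zero_cancel, rule Lim_null_comparison)
  show "\<forall>\<^sub>F h in at 0. norm ((f (x + h) - f x) / h - d) \<le> \<bar>C\<bar> * \<bar>h\<bar>"
  proof (rule eventually_mono[OF eventually_neq_at_within])
    fix h :: real assume h: "h \<noteq> 0"
    have "\<bar>(f (x + h) - f x) / h - d\<bar> = \<bar>f (x + h) - f x - h * d\<bar> / \<bar>h\<bar>"
      using h by (simp add: abs_divide[symmetric] diff_divide_distrib)
    also have "\<dots> \<le> \<bar>C\<bar> * h\<^sup>2 / \<bar>h\<bar>"
    proof (rule divide_right_mono)
      have "C * h\<^sup>2 \<le> \<bar>C\<bar> * h\<^sup>2" by (intro mult_right_mono) auto
      then show "\<bar>f (x + h) - f x - h * d\<bar> \<le> \<bar>C\<bar> * h\<^sup>2" using assms[of h] by linarith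
    qed simp
    also have "\<dots> = \<bar>C\<bar> * \<bar>h\<bar>" using h by (simp add: power2_eq_square abs_if)
    finally show "norm ((f (x + h) - f x) / h - d) \<le> \<bar>C\<bar> * \<bar>h\<bar>" by simp
  qed
  show "((\<lambda>h. \<bar>C\<bar> * \<bar>h\<bar>) \<longlongrightarrow> 0) (at 0)"
    by (auto intro!: tendsto_eq_intros)
qed

lemma abs_Re_diff_le:
  fixes a b c :: complex
  assumes "norm (a - b - complex_of_real h * c) \<le> B"
  shows "\<bar>Re a - Re b - h * Re c\<bar> \<le> B"
  using abs_Re_le_cmod[of "a - b - complex_of_real h * c"] assms by simp

lemma abs_diff_Re_le:
  fixes c :: complex
  assumes "norm (complex_of_real r - complex_of_real h * c / complex_of_real p) \<le> B"
  shows "\<bar>r - h * (Re c / p)\<bar> \<le> B"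
  using abs_Re_le_cmod[of "complex_of_real r - complex_of_real h * c / complex_of_real p"] assms
  by (simp add: Re_divide_of_real)

section \<open>Smoothness of the distribution function\<close>

locale quicksort_distribution =
  fixes M :: "real measure"
  assumes law: "quicksort_law M"
begin

sublocale real_distribution M using law by (simp add: quicksort_law_def)

lemma char_moment_integrable: "integrable lborel (\<lambda>t. \<bar>t\<bar> ^ n * norm (char M t))"
proof (rule Bochner_Integration.integrable_bound)
  show "integrable lborel (\<lambda>t. 2 * exp (20 * (real n + 2)\<^sup>2) * inverse (1 + t\<^sup>2) :: real)"
    by (intro integrable_mult_right inverse_1_plus_square_integral)
  show "AE t in lborel. norm (\<bar>t\<bar> ^ n * norm (char M t)) \<le> norm (2 * exp (20 * (real n + 2)\<^sup>2) * inverse (1 + t\<^sup>2))"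
  proof (rule AE_I2)
    fix t
    have "0 \<le> \<bar>t\<bar> ^ n * norm (char M t)" by simp
    then show "norm (\<bar>t\<bar> ^ n * norm (char M t)) \<le> norm (2 * exp (20 * (real n + 2)\<^sup>2) * inverse (1 + t\<^sup>2))"
      using char_moment_bound[OF law, of t n] by (simp only: real_norm_def)
  qed
qed measurable

lemma char_moment_nonneg: "0 \<le> char_moment M n"
  unfolding char_moment_def by (rule integral_nonneg_AE) simp

lemma char_moment_le: "char_moment M n \<le> 2 * pi * exp (20 * (real n + 2)\<^sup>2)"
proof -
  have "char_moment M n \<le> (LINT t|lborel. 2 * exp (20 * (real n + 2)\<^sup>2) * inverse (1 + t\<^sup>2))"
    unfolding char_moment_def
    by (intro integral_mono char_moment_integrable integrable_mult_right inverse_1_plus_square_integral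
        char_moment_bound law)
  then show ?thesis by (simp add: inverse_1_plus_square_integral mult_ac)
qed

lemma norm_integral_char_le:
  fixes G :: "real \<Rightarrow> complex"
  assumes [measurable]: "G \<in> borel_measurable borel" and "0 \<le> c"
    and bound: "\<And>t. t \<noteq> 0 \<Longrightarrow> norm (G t) \<le> c * (\<bar>t\<bar> ^ n * norm (char M t))"
  shows "integrable lborel G" "norm (CLINT t|lborel. G t) \<le> c * char_moment M n"
proof -
  have int: "integrable lborel (\<lambda>t. c * (\<bar>t\<bar> ^ n * norm (char M t)))"
    by (intro integrable_mult_right char_moment_integrable)
  have bound_AE: "AE t in lborel. norm (G t) \<le> c * (\<bar>t\<bar> ^ n * norm (char M t))"
    using AE_lborel_singleton[of "0::real"] by eventually_elim (rule bound)
  show G: "integrable lborel G"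
  proof (rule Bochner_Integration.integrable_bound[OF int])
    show "AE t in lborel. norm (G t) \<le> norm (c * (\<bar>t\<bar> ^ n * norm (char M t)))"
      using bound_AE by eventually_elim (simp add: order_trans[OF _ abs_ge_self])
  qed measurable
  have "norm (CLINT t|lborel. G t) \<le> (LINT t|lborel. norm (G t))"
    by (rule integral_norm_bound)
  also have "\<dots> \<le> (LINT t|lborel. c * (\<bar>t\<bar> ^ n * norm (char M t)))"
    by (rule integral_mono_AE[OF integrable_norm[OF G] int bound_AE])
  finally have "norm (CLINT t|lborel. G t) \<le> (LINT t|lborel. c * (\<bar>t\<bar> ^ n * norm (char M t)))" .
  then show "norm (CLINT t|lborel. G t) \<le> c * char_moment M n"
    by (simp add: char_moment_def)
qed

lemma inversion_integrand_integrable: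
  "integrable lborel (\<lambda>t. (- \<i> * t) ^ n * iexp (- (t * x)) * char M t)"
  by (rule norm_integral_char_le(1)[of _ 1 n]) (simp_all add: norm_mult norm_power)

lemma inversion_integral_le: "norm (inversion_integral M n x) \<le> 2 * pi * exp (20 * (real n + 2)\<^sup>2)"
proof -
  have "norm (inversion_integral M n x) \<le> 1 * char_moment M n"
    unfolding inversion_integral_def
    by (rule norm_integral_char_le(2)) (simp_all add: norm_mult norm_power)
  with char_moment_le[of n] show ?thesis by simp
qed

lemma inversion_integral_has_derivative:
  "((\<lambda>x. Re (inversion_integral M n x)) has_real_derivative Re (inversion_integral M (Suc n) x)) (at x)"
proof (rule has_real_derivative_quadratic_bound)
  fix h
  let ?I = "\<lambda>n x t. (- \<i> * t) ^ n * iexp (- (t * x)) * char M t"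
  have eq: "inversion_integral M n (x + h) - inversion_integral M n x - h * inversion_integral M (Suc n) x =
      (CLINT t|lborel. ?I n (x + h) t - ?I n x t - h * ?I (Suc n) x t)"
    unfolding inversion_integral_def
    by (simp only: Bochner_Integration.integral_diff Bochner_Integration.integrable_diff
        inversion_integrand_integrable integrable_mult_right integral_mult_right_zero)
  have "norm (CLINT t|lborel. ?I n (x + h) t - ?I n x t - h * ?I (Suc n) x t) \<le> h\<^sup>2 / 2 * char_moment M (n + 2)"
  proof (rule norm_integral_char_le(2))
    fix t :: real
    have "iexp (- (t * (x + h))) = iexp (- (t * x)) * iexp (- (t * h))"
      by (simp add: exp_add[symmetric] algebra_simps)
    then have "?I n (x + h) t - ?I n x t - h * ?I (Suc n) x t =
        (- \<i> * t) ^ n * iexp (- (t * x)) * char M t * (iexp (- (t * h)) - 1 - \<i> * complex_of_real (- (t * h)))"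
      by (simp add: algebra_simps)
    then have "norm (?I n (x + h) t - ?I n x t - h * ?I (Suc n) x t) =
        \<bar>t\<bar> ^ n * norm (char M t) * norm (iexp (- (t * h)) - 1 - \<i> * complex_of_real (- (t * h)))"
      by (simp only: norm_mult norm_power norm_minus_cancel norm_ii norm_of_real norm_exp_i_times mult_1_left mult_1_right)
    also have "\<dots> \<le> \<bar>t\<bar> ^ n * norm (char M t) * ((- (t * h))\<^sup>2 / 2)"
      by (intro mult_left_mono iexp_quadratic) simp
    also have "\<dots> = h\<^sup>2 / 2 * (\<bar>t\<bar> ^ (n + 2) * norm (char M t))"
      by (simp add: power_add power_mult_distrib power2_eq_square)
    finally show "norm (?I n (x + h) t - ?I n x t - h * ?I (Suc n) x t) \<le>
      h\<^sup>2 / 2 * (\<bar>t\<bar> ^ (n + 2) * norm (char M t))" .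
  next
    have "integrable lborel (\<lambda>t. ?I n (x + h) t - ?I n x t - h * ?I (Suc n) x t)"
      by (intro Bochner_Integration.integrable_diff integrable_mult_right inversion_integrand_integrable)
    then show "(\<lambda>t. ?I n (x + h) t - ?I n x t - h * ?I (Suc n) x t) \<in> borel_measurable borel"
      using borel_measurable_integrable by fastforce
  qed simp
  also have "h\<^sup>2 / 2 * char_moment M (n + 2) = char_moment M (n + 2) / 2 * h\<^sup>2" by simp
  finally have "norm (inversion_integral M n (x + h) - inversion_integral M n x - h * inversion_integral M (Suc n) x)
      \<le> char_moment M (n + 2) / 2 * h\<^sup>2"
    unfolding eq .
  then show "\<bar>Re (inversion_integral M n (x + h)) - Re (inversion_integral M n x) -
      h * Re (inversion_integral M (Suc n) x)\<bar> \<le> char_moment M (n + 2) / 2 * h\<^sup>2"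
    by (rule abs_Re_diff_le)
qed

lemma inversion_kernel_measurable [measurable]: "inversion_kernel a b \<in> borel_measurable borel"
  unfolding inversion_kernel_def[abs_def] by measurable

lemma norm_inversion_kernel_le:
  assumes "a \<le> b"
  shows "norm (inversion_kernel a b t) \<le> b - a"
proof (cases "t = 0")
  case False
  have "norm (inversion_kernel a b t) = norm ((iexp ((- t) * b) - iexp ((- t) * a)) / (\<i> * complex_of_real (- t)))"
    by (simp add: inversion_kernel_def norm_divide norm_mult norm_minus_commute)
  also have "\<dots> \<le> b - a" by (rule Levy_Inversion_aux2) (use assms False in auto)
  finally show ?thesis .
qed (use assms in \<open>simp add: inversion_kernel_def\<close>)

lemma inversion_kernel_integrable:
  assumes "a \<le> b"
  shows "integrable lborel (\<lambda>t. inversion_kernel a b t * char M t)"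
    "norm (CLINT t|lborel. inversion_kernel a b t * char M t) \<le> (b - a) * char_moment M 0"
proof -
  have "norm (inversion_kernel a b t * char M t) \<le> (b - a) * (\<bar>t\<bar> ^ 0 * norm (char M t))" for t
    using norm_inversion_kernel_le[OF assms, of t] by (simp add: norm_mult mult_right_mono)
  from norm_integral_char_le[OF _ _ this]
  show "integrable lborel (\<lambda>t. inversion_kernel a b t * char M t)"
    "norm (CLINT t|lborel. inversion_kernel a b t * char M t) \<le> (b - a) * char_moment M 0"
    using assms by auto
qed

text \<open>Levy's formula is a limit of symmetric truncated integrals; absolute integrability of
  \<open>char M\<close> turns it into one integral over the line.\<close>

lemma inversion_continuity_points:
  assumes "a \<le> b" "measure M {a} = 0" "measure M {b} = 0"
  shows "complex_of_real (measure M {a<..b}) =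
    1 / (2 * pi) * (CLINT t|lborel. inversion_kernel a b t * char M t)"
proof (rule LIMSEQ_unique)
  let ?f = "\<lambda>t. inversion_kernel a b t * char M t"
  show "(\<lambda>T::nat. 1 / (2 * pi) * (CLBINT t=-(real T)..real T. ?f t)) \<longlonglongrightarrow> complex_of_real (measure M {a<..b})"
    using Levy_Inversion[OF assms] unfolding inversion_kernel_def by simp
  have "(\<lambda>T::nat. (CLINT t|lborel. indicator {- real T<..<real T} t *\<^sub>R ?f t)) \<longlonglongrightarrow> (CLINT t|lborel. ?f t)"
  proof (rule integral_dominated_convergence)
    show "integrable lborel (\<lambda>t. norm (?f t))"
      by (intro integrable_norm inversion_kernel_integrable assms)
    show "AE t in lborel. (\<lambda>T::nat. indicator {- real T<..<real T} t *\<^sub>R ?f t) \<longlonglongrightarrow> ?f t"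
    proof (rule AE_I2)
      fix t
      have "\<forall>\<^sub>F T in sequentially. \<bar>t\<bar> < real T"
        using filterlim_real_sequentially by (simp add: filterlim_at_top_dense)
      then have "\<forall>\<^sub>F T in sequentially. indicator {- real T<..<real T} t *\<^sub>R ?f t = ?f t"
        by eventually_elim (auto simp: indicator_def)
      then show "(\<lambda>T::nat. indicator {- real T<..<real T} t *\<^sub>R ?f t) \<longlonglongrightarrow> ?f t"
        by (rule tendsto_eventually)
    qed
    show "AE t in lborel. norm (indicator {- real T<..<real T} t *\<^sub>R ?f t) \<le> norm (?f t)" for T :: nat
      by (rule AE_I2) (auto simp: indicator_def)
  qed measurable
  moreover have "(CLBINT t=-(real T)..real T. ?f t) = (CLINT t|lborel. indicator {- real T<..<real T} t *\<^sub>R ?f t)" for T :: nat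
    by (simp add: interval_lebesgue_integral_def set_lebesgue_integral_def)
  ultimately have "(\<lambda>T::nat. (CLBINT t=-(real T)..real T. ?f t)) \<longlonglongrightarrow> (CLINT t|lborel. ?f t)"
    by simp
  then show "(\<lambda>T::nat. 1 / (2 * pi) * (CLBINT t=-(real T)..real T. ?f t)) \<longlonglongrightarrow>
      1 / (2 * pi) * (CLINT t|lborel. ?f t)"
    by (intro tendsto_mult tendsto_const)
qed

text \<open>Atoms are countable, so continuity points exist on both sides arbitrarily close to
  \<open>x\<close>; the mass between them is at most a constant times their distance.\<close>

lemma measure_point: "measure M {x} = 0"
proof -
  have "measure M {x} \<le> 2 * e * char_moment M 0" if e: "0 < e" for e
  proof -
    obtain a where a: "a \<in> {x - e<..<x}" "measure M {a} = 0"
      using open_minus_countable[OF countable_support, of "{x - e<..<x}"] e by auto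
    obtain b where b: "b \<in> {x<..<x + e}" "measure M {b} = 0"
      using open_minus_countable[OF countable_support, of "{x<..<x + e}"] e by auto
    have ab: "a \<le> b" using a b by auto
    have "measure M {x} \<le> measure M {a<..b}"
      using a b by (intro finite_measure_mono) auto
    also have "\<dots> = norm (complex_of_real (measure M {a<..b}))" by simp
    also have "\<dots> = 1 / (2 * pi) * norm (CLINT t|lborel. inversion_kernel a b t * char M t)"
      unfolding inversion_continuity_points[OF ab a(2) b(2)] by (simp add: norm_mult norm_divide)
    also have "\<dots> \<le> 1 * ((b - a) * char_moment M 0)"
      using pi_ge_two by (intro mult_mono inversion_kernel_integrable ab) (auto simp: field_simps)
    also have "\<dots> \<le> 2 * e * char_moment M 0"
      using a b by (simp add: mult_right_mono char_moment_nonneg)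
    finally show ?thesis .
  qed
  then have *: "measure M {x} \<le> 2 * e * char_moment M 0" if "0 < e" for e using that by blast
  have "((\<lambda>e. 2 * e * char_moment M 0) \<longlongrightarrow> 2 * 0 * char_moment M 0) (at_right 0)"
    by (intro tendsto_intros)
  then have "measure M {x} \<le> 2 * 0 * char_moment M 0"
    by (rule tendsto_lowerbound) (auto intro!: eventually_at_right_less[THEN eventually_mono] *)
  then show ?thesis by (simp add: measure_le_0_iff)
qed

lemma cdf_diff:
  "complex_of_real (cdf M b - cdf M a) = 1 / (2 * pi) * (CLINT t|lborel. inversion_kernel a b t * char M t)"
proof -
  have le: "complex_of_real (cdf M b - cdf M a) = 1 / (2 * pi) * (CLINT t|lborel. inversion_kernel a b t * char M t)"
    if "a \<le> b" for a b
  proof (cases "a = b")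
    case True
    then show ?thesis by (simp add: inversion_kernel_def)
  next
    case False
    then have "cdf M b - cdf M a = measure M {a<..b}" using that by (intro cdf_diff_eq) auto
    then show ?thesis using inversion_continuity_points[OF that] by (simp add: measure_point)
  qed
  show ?thesis
  proof (cases "a \<le> b")
    case False
    have "inversion_kernel a b t * char M t = - (inversion_kernel b a t * char M t)" for t
      by (simp add: inversion_kernel_def diff_divide_distrib algebra_simps)
    then have "(CLINT t|lborel. inversion_kernel a b t * char M t) = - (CLINT t|lborel. inversion_kernel b a t * char M t)"
      by simp
    then show ?thesis using le[of b a] False by (simp add: algebra_simps)
  qed (rule le)
qed

lemma cdf_has_derivative:
  "(cdf M has_real_derivative Re (inversion_integral M 0 x) / (2 * pi)) (at x)"
proof (rule has_real_derivative_quadratic_bound)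
  fix h
  let ?g = "\<lambda>t. inversion_kernel x (x + h) t * char M t"
  let ?I = "\<lambda>t. iexp (- (t * x)) * char M t"
  have intg: "integrable lborel ?g"
  proof (cases "0 \<le> h")
    case False
    have "inversion_kernel x (x + h) t * char M t = - (inversion_kernel (x + h) x t * char M t)" for t
      by (simp add: inversion_kernel_def diff_divide_distrib algebra_simps)
    then show ?thesis using inversion_kernel_integrable(1)[of "x + h" x] False by simp
  qed (auto intro: inversion_kernel_integrable)
  have intI: "integrable lborel ?I" using inversion_integrand_integrable[of 0 x] by simp
  have eq: "(CLINT t|lborel. ?g t) - h * inversion_integral M 0 x = (CLINT t|lborel. ?g t - h * ?I t)"
    unfolding inversion_integral_def using intg intI by simp
  have "norm (CLINT t|lborel. ?g t - h * ?I t) \<le> h\<^sup>2 / 2 * char_moment M 1"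
  proof (rule norm_integral_char_le(2))
    fix t :: real assume t: "t \<noteq> 0"
    have "iexp (- (t * (x + h))) = iexp (- (t * x)) * iexp (- (t * h))"
      by (simp add: exp_add[symmetric] algebra_simps)
    then have "?g t - h * ?I t = - (iexp (- (t * x)) * char M t / (\<i> * t) *
        (iexp (- (t * h)) - 1 - \<i> * complex_of_real (- (t * h))))"
      using t by (simp add: inversion_kernel_def field_simps)
    then have "norm (?g t - h * ?I t) =
        norm (char M t) / \<bar>t\<bar> * norm (iexp (- (t * h)) - 1 - \<i> * complex_of_real (- (t * h)))"
      by (simp only: norm_mult norm_divide norm_minus_cancel norm_ii norm_of_real norm_exp_i_times mult_1_left
          real_norm_def)
    also have "\<dots> \<le> norm (char M t) / \<bar>t\<bar> * ((- (t * h))\<^sup>2 / 2)"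
      by (intro mult_left_mono iexp_quadratic) simp
    also have "\<dots> = h\<^sup>2 / 2 * (\<bar>t\<bar> ^ 1 * norm (char M t))"
      using t by (simp add: power_mult_distrib field_simps power2_eq_square abs_if)
    finally show "norm (?g t - h * ?I t) \<le> h\<^sup>2 / 2 * (\<bar>t\<bar> ^ 1 * norm (char M t))" .
  next
    have "integrable lborel (\<lambda>t. ?g t - h * ?I t)"
      by (intro Bochner_Integration.integrable_diff integrable_mult_right intg intI)
    then show "(\<lambda>t. ?g t - h * ?I t) \<in> borel_measurable borel"
      using borel_measurable_integrable by fastforce
  qed simp
  then have le: "norm ((CLINT t|lborel. ?g t) - h * inversion_integral M 0 x) \<le> h\<^sup>2 / 2 * char_moment M 1"
    unfolding eq .
  have arith: "1 / (2 * pi) * A - h * B / (2 * pi) = (A - h * B) / (2 * pi)" for A B :: complex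
    by (simp add: diff_divide_distrib)
  have "complex_of_real (cdf M (x + h) - cdf M x) - h * inversion_integral M 0 x / (2 * pi) =
      ((CLINT t|lborel. ?g t) - h * inversion_integral M 0 x) / (2 * pi)"
    unfolding cdf_diff by (rule arith)
  then have "norm (complex_of_real (cdf M (x + h) - cdf M x) - h * inversion_integral M 0 x / (2 * pi)) =
      norm ((CLINT t|lborel. ?g t) - h * inversion_integral M 0 x) / (2 * pi)"
    by (simp only: norm_divide norm_of_real) simp
  also have "\<dots> \<le> norm ((CLINT t|lborel. ?g t) - h * inversion_integral M 0 x)"
  proof -
    have "y / (2 * pi) \<le> y / 1" if "0 \<le> y" for y
      using that pi_ge_two by (intro divide_left_mono) auto
    then show ?thesis by simp
  qed
  also have "\<dots> \<le> char_moment M 1 * h\<^sup>2"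
  proof -
    have "0 \<le> h\<^sup>2 / 2 * char_moment M 1" by (intro mult_nonneg_nonneg char_moment_nonneg) simp
    then show ?thesis using le by (simp add: mult.commute)
  qed
  finally have "norm (complex_of_real (cdf M (x + h) - cdf M x) - h * inversion_integral M 0 x / (2 * pi)) \<le>
    char_moment M 1 * h\<^sup>2" .
  then show "\<bar>cdf M (x + h) - cdf M x - h * (Re (inversion_integral M 0 x) / (2 * pi))\<bar> \<le>
      char_moment M 1 * h\<^sup>2"
    by (rule abs_diff_Re_le)
qed

end

section \<open>Sup-norms of derivatives on half-lines\<close>

text \<open>On a half-line only forward Taylor steps are available; a step \<open>s\<close> gives
  \<open>|D (Suc k) t| * s <= 2 * A + s^2 / 2 * B\<close>, and \<open>s\<close> is then
  optimized.\<close>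

lemma taylor_landau:
  fixes D :: "nat \<Rightarrow> real \<Rightarrow> real"
  assumes D: "\<And>k x. (D k has_real_derivative D (Suc k) x) (at x)"
    and A: "\<And>t. x \<le> t \<Longrightarrow> \<bar>D k t\<bar> \<le> A" and B: "\<And>t. x \<le> t \<Longrightarrow> \<bar>D (Suc (Suc k)) t\<bar> \<le> B"
    and "x \<le> t"
  shows "(D (Suc k) t)\<^sup>2 \<le> 4 * A * B"
proof -
  have A0: "0 \<le> A" and B0: "0 \<le> B" using A[OF \<open>x \<le> t\<close>] B[OF \<open>x \<le> t\<close>] by linarith+
  have *: "\<bar>D (Suc k) t\<bar> * s \<le> 2 * A + s\<^sup>2 / 2 * B" if s: "0 < s" for s
  proof -
    have "\<exists>\<xi>. t < \<xi> \<and> \<xi> < t + s \<and> D k (t + s) =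
        (\<Sum>m<2. D (k + m) t / fact m * (t + s - t) ^ m) + D (k + 2) \<xi> / fact 2 * (t + s - t) ^ 2"
      by (rule Taylor_up[where diff = "\<lambda>m. D (k + m)" and a = t]) (use D s in auto)
    then obtain \<xi> where \<xi>: "t < \<xi>" "D k (t + s) = D k t + D (Suc k) t * s + D (Suc (Suc k)) \<xi> * (s\<^sup>2 / 2)"
      by (auto simp: numeral_2_eq_2)
    have "\<bar>D (Suc (Suc k)) \<xi> * (s\<^sup>2 / 2)\<bar> \<le> B * (s\<^sup>2 / 2)"
      unfolding abs_mult using B[of \<xi>] \<xi>(1) \<open>x \<le> t\<close> by (intro mult_mono) auto
    moreover have "\<bar>D (Suc k) t\<bar> * s = \<bar>D (Suc k) t * s\<bar>" using s by (simp add: abs_mult)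
    ultimately show ?thesis
      using A[of t] A[of "t + s"] \<xi>(2) \<open>x \<le> t\<close> s by (simp add: mult.commute)
  qed
  define y where "y = \<bar>D (Suc k) t\<bar>"
  have "y\<^sup>2 \<le> 4 * A * B"
  proof (cases "y = 0")
    case True
    then show ?thesis using A0 B0 by simp
  next
    case False
    then have y: "0 < y" by (simp add: y_def)
    show ?thesis
    proof (cases "B = 0")
      case True
      \<comment> \<open>For \<open>B = 0\<close> this step length gives
        \<open>2 * A + 1 <= 2 * A\<close>, so the case is contradictory.\<close>
      have "y * ((2 * A + 1) / y) \<le> 2 * A + ((2 * A + 1) / y)\<^sup>2 / 2 * B"
        unfolding y_def by (rule *) (use y A0 in \<open>simp add: y_def\<close>)
      then show ?thesis using True y by simp
    next
      case False
      then have B1: "0 < B" using B0 by simp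
      have "y * (y / B) \<le> 2 * A + (y / B)\<^sup>2 / 2 * B"
        unfolding y_def by (rule *) (use y B1 in \<open>simp add: y_def\<close>)
      then have "y\<^sup>2 / B \<le> 2 * A + y\<^sup>2 / B / 2" using B1 by (simp add: power2_eq_square)
      then have "y\<^sup>2 / B \<le> 4 * A" by simp
      then show ?thesis using B1 by (simp add: pos_divide_le_eq)
    qed
  qed
  then show ?thesis by (simp add: y_def)
qed

text \<open>Real-valued counterpart of \<open>tail_norm\<close>, meaningful for bounded
  \<open>h\<close>; products and powers of norms are easier to handle there.\<close>

definition sup_tail :: "(real \<Rightarrow> real) \<Rightarrow> real \<Rightarrow> real" where
  "sup_tail h x = (SUP t\<in>{x..}. \<bar>h t\<bar>)"

lemma bdd_above_tail:
  assumes "\<And>t. \<bar>h t\<bar> \<le> (K::real)"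
  shows "bdd_above ((\<lambda>t. \<bar>h t\<bar>) ` {x..})"
  using assms by (auto intro!: bdd_aboveI2)

lemma sup_tail_upper:
  fixes h :: "real \<Rightarrow> real"
  assumes "\<And>t. \<bar>h t\<bar> \<le> K" "x \<le> t"
  shows "\<bar>h t\<bar> \<le> sup_tail h x"
  unfolding sup_tail_def by (rule cSUP_upper[OF _ bdd_above_tail[OF assms(1)]]) (use assms(2) in auto)

lemma sup_tail_least:
  fixes h :: "real \<Rightarrow> real"
  assumes "\<And>t. x \<le> t \<Longrightarrow> \<bar>h t\<bar> \<le> K"
  shows "sup_tail h x \<le> K"
  unfolding sup_tail_def by (rule cSUP_least) (use assms in auto)

lemma tail_norm_eq_sup_tail:
  fixes h :: "real \<Rightarrow> real"
  assumes "\<And>t. \<bar>h t\<bar> \<le> K"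
  shows "tail_norm h x = ereal (sup_tail h x)"
proof (rule antisym)
  show le: "tail_norm h x \<le> ereal (sup_tail h x)"
    unfolding tail_norm_def by (rule SUP_least) (auto intro: sup_tail_upper[OF assms])
  have "ereal \<bar>h x\<bar> \<le> tail_norm h x"
    unfolding tail_norm_def by (rule SUP_upper) auto
  then obtain r where r: "tail_norm h x = ereal r"
    using le by (cases "tail_norm h x") auto
  have "sup_tail h x \<le> r"
  proof (rule sup_tail_least)
    fix t assume "x \<le> t"
    then have "ereal \<bar>h t\<bar> \<le> tail_norm h x"
      unfolding tail_norm_def by (intro SUP_upper) auto
    then show "\<bar>h t\<bar> \<le> r" by (simp add: r)
  qed
  then show "ereal (sup_tail h x) \<le> tail_norm h x" by (simp add: r)
qed

section \<open>Transfer of tail bounds to derivatives of every order\<close>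

locale derivative_sequence =
  fixes D :: "nat \<Rightarrow> real \<Rightarrow> real"
  assumes deriv_D: "\<And>k x. (D k has_real_derivative D (Suc k) x) (at x)"
    and bound_D: "\<And>k x. \<bar>D k x\<bar> \<le> exp (20 * (real k + 2)\<^sup>2)"
begin

abbreviation "N k \<equiv> sup_tail (D k)"

lemma funpow_deriv: "(deriv ^^ k) (D 0) = D k"
proof (induction k)
  case (Suc k)
  have "deriv (D k) = D (Suc k)" by (rule ext) (rule DERIV_imp_deriv[OF deriv_D])
  with Suc show ?case by simp
qed simp

lemma tail_norm_D: "tail_norm ((deriv ^^ k) (D 0)) x = ereal (N k x)"
  unfolding funpow_deriv by (rule tail_norm_eq_sup_tail[OF bound_D])

lemma N_upper: "x \<le> t \<Longrightarrow> \<bar>D k t\<bar> \<le> N k x"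
  by (rule sup_tail_upper[OF bound_D])

lemma N_nonneg: "0 \<le> N k x"
  using N_upper[of x x k] by linarith

lemma N_bound: "N k x \<le> exp (20 * (real k + 2)\<^sup>2)"
  by (rule sup_tail_least) (rule bound_D)

lemma N_landau: "(N (Suc k) x)\<^sup>2 \<le> 4 * N k x * N (Suc (Suc k)) x"
proof -
  have "N (Suc k) x \<le> sqrt (4 * N k x * N (Suc (Suc k)) x)"
  proof (rule sup_tail_least)
    fix t assume "x \<le> t"
    then have "(D (Suc k) t)\<^sup>2 \<le> 4 * N k x * N (Suc (Suc k)) x"
      by (intro taylor_landau[where D = D and x = x] deriv_D N_upper)
    then show "\<bar>D (Suc k) t\<bar> \<le> sqrt (4 * N k x * N (Suc (Suc k)) x)"
      by (metis real_sqrt_abs real_sqrt_le_mono)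
  qed
  then have "(N (Suc k) x)\<^sup>2 \<le> (sqrt (4 * N k x * N (Suc (Suc k)) x))\<^sup>2"
    by (rule power_mono[OF _ N_nonneg])
  then show ?thesis by (simp add: N_nonneg)
qed

text \<open>Up to powers of 4, \<open>N_landau\<close> says that \<open>N (Suc k) x / N k x\<close>
  increases with \<open>k\<close>. The ratios are multiplied out because a norm might
  vanish.\<close>

lemma N_ratio: "N (k + j) x * N (Suc k) x \<le> 4 ^ j * N k x * N (Suc (k + j)) x"
proof (induction j)
  case (Suc j)
  let ?a = "N (k + j) x" and ?b = "N (Suc (k + j)) x" and ?c = "N (Suc (Suc (k + j))) x"
    and ?d = "N k x" and ?e = "N (Suc k) x"
  show ?case
  proof (cases "?b = 0")
    case True
    then show ?thesis by (simp add: N_nonneg)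
  next
    case False
    then have b: "0 < ?b" using N_nonneg[of "Suc (k + j)" x] by simp
    have "?b * (?b * ?e) = ?b\<^sup>2 * ?e" by (simp add: power2_eq_square)
    also have "\<dots> \<le> 4 * ?a * ?c * ?e" by (intro mult_right_mono N_landau N_nonneg)
    also have "\<dots> = 4 * ?c * (?a * ?e)" by simp
    also have "\<dots> \<le> 4 * ?c * (4 ^ j * ?d * ?b)" by (intro mult_left_mono Suc) (simp add: N_nonneg)
    also have "\<dots> = ?b * (4 ^ Suc j * ?d * ?c)" by simp
    finally show ?thesis using b by simp
  qed
qed simp

text \<open>Product of the ratio inequalities; the factors \<open>4 ^ j\<close> for
  \<open>j <= p\<close> combine to \<open>2 ^ (p * Suc p)\<close>.\<close>

lemma N_interpolation: "N (Suc k) x ^ Suc p \<le> 2 ^ (p * Suc p) * N k x ^ p * N (k + Suc p) x"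
proof (induction p)
  case (Suc p)
  have "N (Suc k) x ^ Suc (Suc p) = N (Suc k) x ^ Suc p * N (Suc k) x" by simp
  also have "\<dots> \<le> 2 ^ (p * Suc p) * N k x ^ p * N (k + Suc p) x * N (Suc k) x"
    by (intro mult_right_mono Suc N_nonneg)
  also have "\<dots> = 2 ^ (p * Suc p) * N k x ^ p * (N (k + Suc p) x * N (Suc k) x)" by simp
  also have "\<dots> \<le> 2 ^ (p * Suc p) * N k x ^ p * (4 ^ Suc p * N k x * N (Suc (k + Suc p)) x)"
    by (intro mult_left_mono N_ratio) (simp add: N_nonneg)
  also have "\<dots> = (2 ^ (p * Suc p) * 4 ^ Suc p) * N k x ^ Suc p * N (k + Suc (Suc p)) x" by simp
  also have "(4::real) ^ Suc p = 2 ^ (2 * Suc p)" by (simp add: power_mult)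
  also have "(2::real) ^ (p * Suc p) * 2 ^ (2 * Suc p) = 2 ^ (Suc p * Suc (Suc p))"
    by (simp only: power_add[symmetric]) (simp add: algebra_simps)
  finally show ?case .
qed simp

text \<open>Mean value theorem between \<open>t\<close> and \<open>t + x\<close>. When
  \<open>N k (2 * x)\<close> is negligible, it bounds \<open>N (Suc k) x\<close> from below by about
  \<open>N k x / x\<close>.\<close>

lemma N_shift:
  assumes "0 \<le> x"
  shows "N k x \<le> N k (2 * x) + x * N (Suc k) x"
proof (rule sup_tail_least)
  fix t assume t: "x \<le> t"
  have "\<bar>D k (t + x) - D k t\<bar> \<le> N (Suc k) x * \<bar>(t + x) - t\<bar>"
    using field_differentiable_bound[of "{x..}" "D k" "D (Suc k)" "N (Suc k) x" "t + x" t] t assms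
    by (auto intro: has_field_derivative_at_within[OF deriv_D] N_upper)
  moreover have "\<bar>D k (t + x)\<bar> \<le> N k (2 * x)" using t by (intro N_upper) auto
  ultimately show "\<bar>D k t\<bar> \<le> N k (2 * x) + x * N (Suc k) x"
    using assms by (simp add: mult.commute)
qed

text \<open>One use of \<open>N_landau\<close> would halve \<open>x * ln x\<close>. Interpolating
  between \<open>k\<close> and \<open>k + p + 1\<close> with \<open>p\<close> about
  \<open>ln x\<close> keeps the fraction \<open>p / (p + 1)\<close>, and the missing part
  \<open>x * ln x / (p + 1)\<close> is at most \<open>x\<close>.\<close>

lemma N_upper_right:
  assumes "\<exists>C. \<forall>\<^sub>F x in at_top. N 0 x \<le> exp (- x * ln x + C * x)"
  shows "\<exists>C. \<forall>\<^sub>F x in at_top. N k x \<le> exp (- x * ln x + C * x)"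
proof (induction k)
  case 0
  show ?case by (rule assms)
next
  case (Suc k)
  then obtain C where C: "\<forall>\<^sub>F x in at_top. N k x \<le> exp (- x * ln x + C * x)" by blast
  \<comment> \<open>The 2 pays for the lost part of \<open>x * ln x\<close> and for
    \<open>2 ^ (p * Suc p)\<close>; the last term pays for the a priori bound at order
    \<open>k + p + 1\<close>.\<close>
  define C' where "C' = 2 + \<bar>C\<bar> + 20 * (real k + 3)\<^sup>2"
  have big: "\<forall>\<^sub>F x::real in at_top. ln x + 2 \<le> x" by real_asymp
  have "\<forall>\<^sub>F x in at_top. N (Suc k) x \<le> exp (- x * ln x + C' * x)"
    using C big eventually_gt_at_top[of 1]
  proof eventually_elim
    case (elim x)
    define p where "p = nat \<lceil>ln x\<rceil>"
    have lnx: "0 < ln x" using elim by simp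
    have p: "ln x \<le> real p" "real p \<le> ln x + 1"
      using lnx unfolding p_def by linarith+
    define n where "n = real (Suc p)"
    have n: "1 \<le> n" "ln x \<le> n" "n \<le> x" "real p \<le> n" "n = real p + 1" using p elim by (auto simp: n_def)
    have "N (Suc k) x ^ Suc p \<le> 2 ^ (p * Suc p) * N k x ^ p * N (k + Suc p) x"
      by (rule N_interpolation)
    also have "\<dots> \<le> exp (real p * n) * exp (real p * (- x * ln x + C * x)) * exp (20 * (real (k + Suc p) + 2)\<^sup>2)"
    proof (intro mult_mono)
      have "(2::real) ^ (p * Suc p) \<le> exp 1 ^ (p * Suc p)"
        using exp_ge_add_one_self[of "1::real"] by (intro power_mono) auto
      also have "\<dots> = exp (real p * n)" by (simp add: n_def exp_of_nat_mult[symmetric] algebra_simps)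
      finally show "(2::real) ^ (p * Suc p) \<le> exp (real p * n)" .
      have "N k x ^ p \<le> exp (- x * ln x + C * x) ^ p"
        by (intro power_mono elim N_nonneg)
      then show "N k x ^ p \<le> exp (real p * (- x * ln x + C * x))" by (simp add: exp_of_nat_mult)
      show "N (k + Suc p) x \<le> exp (20 * (real (k + Suc p) + 2)\<^sup>2)" by (rule N_bound)
    qed (auto intro: N_nonneg zero_le_power)
    also have "\<dots> = exp (real p * n + real p * (- x * ln x + C * x) + 20 * (real (k + Suc p) + 2)\<^sup>2)"
      by (simp add: exp_add)
    also have "\<dots> \<le> exp (n * (- x * ln x + C' * x))"
    proof -
      have 1: "x * ln x \<le> n * x" using n elim by (simp add: mult.commute)
      have 2: "real p * n \<le> n * x" using n by (simp add: mult.commute mult_left_mono)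
      have 3: "real p * (C * x) \<le> n * (\<bar>C\<bar> * x)"
      proof -
        have "real p * (C * x) \<le> real p * (\<bar>C\<bar> * x)"
          using elim by (intro mult_left_mono mult_right_mono) auto
        also have "\<dots> \<le> n * (\<bar>C\<bar> * x)" using n elim by (intro mult_right_mono) auto
        finally show ?thesis .
      qed
      have 4: "(real (k + Suc p) + 2)\<^sup>2 \<le> (real k + 3)\<^sup>2 * (n * x)"
      proof -
        have "real (k + Suc p) + 2 = real k + 2 + n" by (simp add: n_def)
        also have "\<dots> \<le> (real k + 2) * n + n"
        proof -
          have "(real k + 2) * 1 \<le> (real k + 2) * n" using n by (intro mult_left_mono) auto
          then show ?thesis unfolding mult_1_right by (rule add_right_mono)
        qed
        also have "\<dots> = (real k + 3) * n" by (simp add: algebra_simps)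
        finally have "(real (k + Suc p) + 2)\<^sup>2 \<le> ((real k + 3) * n)\<^sup>2" by (intro power_mono) auto
        also have "\<dots> = (real k + 3)\<^sup>2 * (n * n)" by (simp add: power2_eq_square)
        also have "\<dots> \<le> (real k + 3)\<^sup>2 * (n * x)" using n by (intro mult_left_mono) auto
        finally show ?thesis .
      qed
      have "n * (- x * ln x + C' * x) = - (real p) * (x * ln x) - x * ln x + n * x + n * x
          + n * (\<bar>C\<bar> * x) + 20 * ((real k + 3)\<^sup>2 * (n * x))"
        using n(5) by (simp add: C'_def algebra_simps)
      moreover have "real p * (- x * ln x + C * x) = - (real p) * (x * ln x) + real p * (C * x)"
        by (simp add: algebra_simps)
      ultimately show ?thesis using 1 2 3 4 unfolding exp_le_cancel_iff by linarith
    qed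
    also have "\<dots> = exp (- x * ln x + C' * x) ^ Suc p" by (simp only: n_def exp_of_nat_mult)
    finally show ?case by (rule power_le_imp_le_base) simp
  qed
  then show ?case by blast
qed

text \<open>A single use of \<open>N_landau\<close> suffices: dividing a double-exponential exponent
  by a constant only changes \<open>C\<close>. One third of the exponent absorbs the factor
  \<open>4 * B\<close>, and the square root of the rest costs the shift 2, as
  \<open>3 <= exp 2\<close>.\<close>

lemma N_upper_left:
  assumes "\<exists>C. \<forall>\<^sub>F x in at_top. N 0 x \<le> exp (- exp (g * x - C))" "0 < g"
  shows "\<exists>C. \<forall>\<^sub>F x in at_top. N k x \<le> exp (- exp (g * x - C))"
proof (induction k)
  case 0
  show ?case by (rule assms)
next
  case (Suc k)
  then obtain C where C: "\<forall>\<^sub>F x in at_top. N k x \<le> exp (- exp (g * x - C))" by blast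
  define B where "B = exp (20 * (real (Suc (Suc k)) + 2)\<^sup>2)"
  have B: "0 < B" by (simp add: B_def)
  have "\<forall>\<^sub>F x in at_top. 4 * B \<le> exp (exp (g * x - C) / 3)"
    using \<open>0 < g\<close> by real_asymp
  with C have "\<forall>\<^sub>F x in at_top. N (Suc k) x \<le> exp (- exp (g * x - (C + 2)))"
  proof eventually_elim
    case (elim x)
    have "(N (Suc k) x)\<^sup>2 \<le> 4 * N k x * N (Suc (Suc k)) x" by (rule N_landau)
    also have "\<dots> \<le> 4 * exp (- exp (g * x - C)) * B"
      unfolding B_def by (intro mult_mono elim N_bound) (auto simp: N_nonneg)
    also have "\<dots> = 4 * B * exp (- exp (g * x - C))" by simp
    also have "\<dots> \<le> exp (exp (g * x - C) / 3) * exp (- exp (g * x - C))"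
      by (intro mult_right_mono elim) simp
    also have "\<dots> = exp (- (2 * (exp (g * x - C) / 3)))" by (simp add: exp_add[symmetric])
    also have "\<dots> \<le> exp (- (2 * exp (g * x - (C + 2))))"
    proof -
      have "3 * exp (g * x - (C + 2)) \<le> exp 2 * exp (g * x - (C + 2))"
        using exp_ge_add_one_self[of "2::real"] by (intro mult_right_mono) auto
      also have "\<dots> = exp (g * x - C)" by (simp add: exp_add[symmetric])
      finally show ?thesis by simp
    qed
    also have "\<dots> = (exp (- exp (g * x - (C + 2))))\<^sup>2" by (simp add: exp_double[symmetric])
    finally show ?case by (rule power2_le_imp_le) simp
  qed
  then show ?case by blast
qed

text \<open>At \<open>2 * x\<close> the upper bound has leading exponent
  \<open>- 2 * x * ln x\<close>, so \<open>N k (2 * x)\<close> is below half the lower bound for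
  \<open>N k x\<close>. Dividing by \<open>x\<close> costs \<open>ln x\<close> in the exponent,
  absorbed by \<open>C + 1\<close>; thus the coefficient of \<open>x * ln (ln x)\<close> stays 1 at
  every order.\<close>

lemma N_lower_right:
  assumes up: "\<exists>C. \<forall>\<^sub>F x in at_top. N 0 x \<le> exp (- x * ln x + C * x)"
    and low: "\<exists>C. \<forall>\<^sub>F x in at_top. exp (- x * ln x - x * ln (ln x) - C * x) \<le> N 0 x"
  shows "\<exists>C. \<forall>\<^sub>F x in at_top. exp (- x * ln x - x * ln (ln x) - C * x) \<le> N k x"
proof (induction k)
  case 0
  show ?case by (rule low)
next
  case (Suc k)
  then obtain C where C: "\<forall>\<^sub>F x in at_top. exp (- x * ln x - x * ln (ln x) - C * x) \<le> N k x" by blast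
  obtain C' where "\<forall>\<^sub>F x in at_top. N k x \<le> exp (- x * ln x + C' * x)"
    using N_upper_right[OF up] by blast
  then have C': "\<forall>\<^sub>F x in at_top. N k (2 * x) \<le> exp (- (2 * x) * ln (2 * x) + C' * (2 * x))"
    by (rule eventually_compose_filterlim) real_asymp
  have 1: "\<forall>\<^sub>F x in at_top. exp (- (2 * x) * ln (2 * x) + C' * (2 * x)) \<le>
      exp (- x * ln x - x * ln (ln x) - C * x) / 2" by real_asymp
  have 2: "\<forall>\<^sub>F x in at_top. exp (- x * ln x - x * ln (ln x) - (C + 1) * x) * x \<le>
      exp (- x * ln x - x * ln (ln x) - C * x) / 2" by real_asymp
  have "\<forall>\<^sub>F x in at_top. exp (- x * ln x - x * ln (ln x) - (C + 1) * x) \<le> N (Suc k) x"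
    using C C' 1 2 eventually_gt_at_top[of 0]
  proof eventually_elim
    case (elim x)
    have "exp (- x * ln x - x * ln (ln x) - (C + 1) * x) * x \<le> N (Suc k) x * x"
      using elim N_shift[of x k] unfolding mult.commute[of "N (Suc k) x"] by linarith
    then show ?case using elim by simp
  qed
  then show ?case by blast
qed

lemma N_lower_left:
  assumes up: "\<exists>C. \<forall>\<^sub>F x in at_top. N 0 x \<le> exp (- exp (g * x - C))" and g: "0 < g"
    and low: "\<exists>C. \<forall>\<^sub>F x in at_top. exp (- exp (g * x + C)) \<le> N 0 x"
  shows "\<exists>C. \<forall>\<^sub>F x in at_top. exp (- exp (g * x + C)) \<le> N k x"
proof (induction k)
  case 0
  show ?case by (rule low)
next
  case (Suc k)
  then obtain C where C: "\<forall>\<^sub>F x in at_top. exp (- exp (g * x + C)) \<le> N k x" by blast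
  obtain C' where "\<forall>\<^sub>F x in at_top. N k x \<le> exp (- exp (g * x - C'))"
    using N_upper_left[OF up g] by blast
  then have C': "\<forall>\<^sub>F x in at_top. N k (2 * x) \<le> exp (- exp (g * (2 * x) - C'))"
    by (rule eventually_compose_filterlim) real_asymp
  have 1: "\<forall>\<^sub>F x in at_top. exp (- exp (g * (2 * x) - C')) \<le> exp (- exp (g * x + C)) / 2"
    using g by real_asymp
  have 2: "\<forall>\<^sub>F x in at_top. exp (- exp (g * x + (C + 1))) * x \<le> exp (- exp (g * x + C)) / 2"
    using g by real_asymp
  have "\<forall>\<^sub>F x in at_top. exp (- exp (g * x + (C + 1))) \<le> N (Suc k) x"
    using C C' 1 2 eventually_gt_at_top[of 0]
  proof eventually_elim
    case (elim x)
    have "exp (- exp (g * x + (C + 1))) * x \<le> N (Suc k) x * x"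
      using elim N_shift[of x k] unfolding mult.commute[of "N (Suc k) x"] by linarith
    then show ?case using elim by simp
  qed
  then show ?case by blast
qed

end

section \<open>The two tails of the law as derivative sequences\<close>

context quicksort_distribution
begin

fun cdf_deriv :: "nat \<Rightarrow> real \<Rightarrow> real" where
  "cdf_deriv 0 x = cdf M x"
| "cdf_deriv (Suc n) x = Re (inversion_integral M n x) / (2 * pi)"

lemma cdf_deriv_has_derivative: "(cdf_deriv k has_real_derivative cdf_deriv (Suc k) x) (at x)"
proof (cases k)
  case 0
  have "cdf_deriv 0 = cdf M" by (rule ext) simp
  then show ?thesis using 0 cdf_has_derivative[of x] by simp
next
  case (Suc n)
  have "cdf_deriv (Suc n) = (\<lambda>x. Re (inversion_integral M n x) / (2 * pi))" by (rule ext) simp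
  then show ?thesis
    using Suc DERIV_cdivide[OF inversion_integral_has_derivative[of n x], of "2 * pi"] by simp
qed

lemma cdf_deriv_bound: "\<bar>cdf_deriv k x\<bar> \<le> exp (20 * (real k + 2)\<^sup>2)"
proof (cases k)
  case 0
  have "\<bar>cdf M x\<bar> \<le> 1" by (simp add: cdf_def)
  also have "1 \<le> exp (20 * (real k + 2)\<^sup>2)" by simp
  finally show ?thesis by (simp add: 0)
next
  case (Suc n)
  have "\<bar>Re (inversion_integral M n x)\<bar> \<le> 2 * pi * exp (20 * (real n + 2)\<^sup>2)"
    using abs_Re_le_cmod inversion_integral_le by (rule order_trans)
  also have "\<dots> \<le> 2 * pi * exp (20 * (real k + 2)\<^sup>2)"
    using Suc by (intro mult_left_mono) (auto intro!: power_mono)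
  finally have "\<bar>Re (inversion_integral M n x)\<bar> / (2 * pi) \<le> exp (20 * (real k + 2)\<^sup>2)"
    by (simp add: pos_divide_le_eq mult.commute)
  then show ?thesis by (simp add: Suc abs_divide)
qed

sublocale left: derivative_sequence "\<lambda>k x. (- 1) ^ k * cdf_deriv k (- x)"
proof
  fix k x
  have "((\<lambda>x. cdf_deriv k (- x)) has_real_derivative cdf_deriv (Suc k) (- x) * - 1) (at x)"
    by (rule DERIV_chain2[OF cdf_deriv_has_derivative]) (auto intro!: derivative_eq_intros)
  from DERIV_cmult[OF this, of "(- 1) ^ k"]
  show "((\<lambda>x. (- 1) ^ k * cdf_deriv k (- x)) has_real_derivative
      (- 1) ^ Suc k * cdf_deriv (Suc k) (- x)) (at x)" by (simp del: cdf_deriv.simps)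
  show "\<bar>(- 1) ^ k * cdf_deriv k (- x)\<bar> \<le> exp (20 * (real k + 2)\<^sup>2)"
    using cdf_deriv_bound[of k "- x"] by (simp add: abs_mult power_abs)
qed

sublocale right: derivative_sequence "\<lambda>k x. if k = 0 then upper_tail M x else - cdf_deriv k x"
proof
  fix k x
  show "((\<lambda>x. if k = 0 then upper_tail M x else - cdf_deriv k x) has_real_derivative
      (if Suc k = 0 then upper_tail M x else - cdf_deriv (Suc k) x)) (at x)"
  proof (cases "k = 0")
    case True
    have "((\<lambda>x. 1 - cdf M x) has_real_derivative 0 - Re (inversion_integral M 0 x) / (2 * pi)) (at x)"
      by (intro DERIV_diff DERIV_const cdf_has_derivative)
    then show ?thesis using True by (simp add: upper_tail_def[abs_def])
  next
    case False
    then show ?thesis using DERIV_minus[OF cdf_deriv_has_derivative[of k x]] by (simp del: cdf_deriv.simps)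
  qed
  show "\<bar>if k = 0 then upper_tail M x else - cdf_deriv k x\<bar> \<le> exp (20 * (real k + 2)\<^sup>2)"
  proof (cases "k = 0")
    case True
    have "\<bar>1 - cdf M x\<bar> \<le> 1" by (simp add: cdf_def)
    also have "1 \<le> exp (20 * (real k + 2)\<^sup>2)" by simp
    finally show ?thesis using True by (simp add: upper_tail_def)
  next
    case False
    then show ?thesis using cdf_deriv_bound[of k x] by simp
  qed
qed

lemma lower_tail_eq: "lower_tail M = (\<lambda>x. (- 1) ^ 0 * cdf_deriv 0 (- x))"
  by (rule ext) (simp add: lower_tail_def)

lemma upper_tail_eq: "upper_tail M = (\<lambda>x. if (0::nat) = 0 then upper_tail M x else - cdf_deriv 0 x)"
  by (rule ext) simp

lemma tail_norm_lower_tail: "tail_norm ((deriv ^^ k) (lower_tail M)) x = ereal (left.N k x)"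
  unfolding lower_tail_eq by (rule left.tail_norm_D)

lemma tail_norm_upper_tail: "tail_norm ((deriv ^^ k) (upper_tail M)) x = ereal (right.N k x)"
  by (subst upper_tail_eq) (rule right.tail_norm_D)

lemma left_N_0: "left.N 0 x = lower_tail M x"
proof (rule antisym)
  show "left.N 0 x \<le> lower_tail M x"
    by (rule sup_tail_least) (auto simp: lower_tail_def cdf_def intro!: finite_measure_mono)
  show "lower_tail M x \<le> left.N 0 x"
    using left.N_upper[of x x 0] by (simp add: lower_tail_def cdf_def)
qed

lemma right_N_0: "right.N 0 x = upper_tail M x"
proof (rule antisym)
  have "\<bar>upper_tail M t\<bar> = upper_tail M t" for t by (simp add: upper_tail_def cdf_def)
  then show "right.N 0 x \<le> upper_tail M x"
    by (intro sup_tail_least) (auto simp: upper_tail_def cdf_def intro!: finite_measure_mono)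
  show "upper_tail M x \<le> right.N 0 x"
    using right.N_upper[of x x 0] by simp
qed

lemma quicksort_gamma_pos: "0 < quicksort_gamma"
  using ln_2_bounds by (simp add: quicksort_gamma_def field_simps)

lemma left_bounds:
  "\<exists>C. \<forall>\<^sub>F x in at_top. left.N k x \<le> exp (- exp (quicksort_gamma * x - C))"
  "\<exists>C. \<forall>\<^sub>F x in at_top. exp (- exp (quicksort_gamma * x + C)) \<le> left.N k x"
proof -
  obtain C where "\<forall>x\<ge>C. lower_tail M x \<le> exp (- exp (quicksort_gamma * x - C))"
    using lower_tail_chernoff[OF law] by blast
  then have up: "\<exists>C. \<forall>\<^sub>F x in at_top. left.N 0 x \<le> exp (- exp (quicksort_gamma * x - C))"
    unfolding left_N_0 by (intro exI[of _ C]) (auto simp: eventually_at_top_linorder)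
  obtain C' where "\<forall>x\<ge>0. exp (- exp (quicksort_gamma * x + C')) \<le> lower_tail M x"
    using lower_tail_lower_bound[OF law] by blast
  then have low: "\<exists>C. \<forall>\<^sub>F x in at_top. exp (- exp (quicksort_gamma * x + C)) \<le> left.N 0 x"
    unfolding left_N_0 by (intro exI[of _ C']) (auto simp: eventually_at_top_linorder)
  show "\<exists>C. \<forall>\<^sub>F x in at_top. left.N k x \<le> exp (- exp (quicksort_gamma * x - C))"
    by (rule left.N_upper_left[OF up quicksort_gamma_pos])
  show "\<exists>C. \<forall>\<^sub>F x in at_top. exp (- exp (quicksort_gamma * x + C)) \<le> left.N k x"
    by (rule left.N_lower_left[OF up quicksort_gamma_pos low])
qed

lemma right_bounds:
  "\<exists>C. \<forall>\<^sub>F x in at_top. right.N k x \<le> exp (- x * ln x + C * x)"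
  "\<exists>C. \<forall>\<^sub>F x in at_top. exp (- x * ln x - x * ln (ln x) - C * x) \<le> right.N k x"
proof -
  have up: "\<exists>C. \<forall>\<^sub>F x in at_top. right.N 0 x \<le> exp (- x * ln x + C * x)"
    unfolding right_N_0
    by (intro exI[of _ 64] eventually_mono[OF eventually_ge_at_top[of 1]] upper_tail_chernoff law)
  have low: "\<exists>C. \<forall>\<^sub>F x in at_top. exp (- x * ln x - x * ln (ln x) - C * x) \<le> right.N 0 x"
    unfolding right_N_0 by (rule upper_tail_lower_bound[OF law])
  show "\<exists>C. \<forall>\<^sub>F x in at_top. right.N k x \<le> exp (- x * ln x + C * x)"
    by (rule right.N_upper_right[OF up])
  show "\<exists>C. \<forall>\<^sub>F x in at_top. exp (- x * ln x - x * ln (ln x) - C * x) \<le> right.N k x"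
    by (rule right.N_lower_right[OF up low])
qed

end

theorem theorem1p2:
  fixes M :: "real measure" and k :: nat
  assumes "quicksort_law M"
  shows "\<exists>r1 r2 r3 r4 :: real \<Rightarrow> real.
    r1 \<in> O[at_top](\<lambda>_. 1) \<and> r2 \<in> O[at_top](\<lambda>_. 1) \<and>
    r3 \<in> O[at_top](\<lambda>x. x) \<and> r4 \<in> O[at_top](\<lambda>x. x) \<and>
    (\<forall>\<^sub>F x in at_top.
      ereal (exp (- exp (quicksort_gamma * x + ln (ln x) + r1 x)))
        \<le> tail_norm ((deriv ^^ k) (lower_tail M)) x \<and>
      tail_norm ((deriv ^^ k) (lower_tail M)) x
        \<le> ereal (exp (- exp (quicksort_gamma * x + r2 x))) \<and>
      ereal (exp (- x * ln x - real (max k 1) * x * ln (ln x) + r3 x))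
        \<le> tail_norm ((deriv ^^ k) (upper_tail M)) x \<and>
      tail_norm ((deriv ^^ k) (upper_tail M)) x
        \<le> ereal (exp (- x * ln x + r4 x)))"
proof -
  interpret quicksort_distribution M by unfold_locales (rule assms)
  obtain C1 where 1: "\<forall>\<^sub>F x in at_top. exp (- exp (quicksort_gamma * x + C1)) \<le> left.N k x"
    using left_bounds(2) by blast
  obtain C2 where 2: "\<forall>\<^sub>F x in at_top. left.N k x \<le> exp (- exp (quicksort_gamma * x - C2))"
    using left_bounds(1) by blast
  obtain C3 where 3: "\<forall>\<^sub>F x in at_top. exp (- x * ln x - x * ln (ln x) - C3 * x) \<le> right.N k x"
    using right_bounds(2) by blast
  obtain C4 where 4: "\<forall>\<^sub>F x in at_top. right.N k x \<le> exp (- x * ln x + C4 * x)"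
    using right_bounds(1) by blast
  \<comment> \<open>The bounds obtained have no \<open>ln (ln x)\<close> on the left and coefficient
    1 in place of \<open>max k 1\<close> on the right; they imply the stated ones once
    \<open>ln (ln x)\<close> is nonnegative.\<close>
  have lnln: "\<forall>\<^sub>F x::real in at_top. 0 \<le> ln (ln x)" by real_asymp
  show ?thesis
    unfolding tail_norm_lower_tail tail_norm_upper_tail
  proof (intro exI conjI)
    show "(\<lambda>_. C1) \<in> O[at_top](\<lambda>_. 1)" "(\<lambda>_. - C2) \<in> O[at_top](\<lambda>_. 1)"
      "(\<lambda>x. - C3 * x) \<in> O[at_top](\<lambda>x. x)" "(\<lambda>x. C4 * x) \<in> O[at_top](\<lambda>x. x)"
      by simp_all
    show "\<forall>\<^sub>F x in at_top.
      ereal (exp (- exp (quicksort_gamma * x + ln (ln x) + C1))) \<le> ereal (left.N k x) \<and>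
      ereal (left.N k x) \<le> ereal (exp (- exp (quicksort_gamma * x + - C2))) \<and>
      ereal (exp (- x * ln x - real (max k 1) * x * ln (ln x) + - C3 * x)) \<le> ereal (right.N k x) \<and>
      ereal (right.N k x) \<le> ereal (exp (- x * ln x + C4 * x))"
      using 1 2 3 4 lnln eventually_gt_at_top[of 0]
    proof eventually_elim
      case (elim x)
      have left: "exp (- exp (quicksort_gamma * x + ln (ln x) + C1)) \<le> exp (- exp (quicksort_gamma * x + C1))"
        using elim(5) by simp
      have "1 * (x * ln (ln x)) \<le> real (max k 1) * (x * ln (ln x))"
        using elim(5,6) by (intro mult_right_mono) auto
      then have right: "exp (- x * ln x - real (max k 1) * x * ln (ln x) + - C3 * x) \<le>
          exp (- x * ln x - x * ln (ln x) - C3 * x)"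
        unfolding exp_le_cancel_iff mult.assoc by linarith
      show ?case
        using order_trans[OF left elim(1)] elim(2) order_trans[OF right elim(3)] elim(4) by simp
    qed
  qed
qed

end
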